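(* Let $E$ be an infinite dimensional Banach space isomorphic to a subspace of $L_1(\mu)$ for some Borel measure $\mu$, let $F$ be an infinite dimensional Banach space containing an isomorphic copy of $\ell_1$, and let $(\mathcal{I},\|\cdot\|_{\mathcal{I}})$ be a Banach operator ideal such that the identity operator of $\ell_1$ belongs to $\mathcal{I}$. Then there exists an infinite dimensional Banach space (a closed infinite dimensional subspace of $(\mathcal{I}(E;F),\|\cdot\|_{\mathcal{I}})$) all of whose nonzero elements are linear operators from $E$ to $F$ belonging to $\mathcal{I}$ that are not absolutely $1$-summing.
   Context: A bounded linear operator $u\colon E\to F$ is absolutely $1$-summing if $\sum_j\|u(x_j)\|<\infty$ whenever $(x_j)$ is a sequence in $E$ with $\sup_{x^*\in B_{E^*}}\sum_j|x^*(x_j)|<\infty$. A Banach operator ideal is an operator ideal $\mathcal{I}$ with a complete norm $\|\cdot\|_{\mathcal{I}}$ on each component satisfying $\|u\|\le\|u\|_{\mathcal{I}}$, $\|id_{\mathbb{K}}\|_{\mathcal{I}}=1$ and $\|v\circ u\circ w\|_{\mathcal{I}}\le\|v\|\|u\|_{\mathcal{I}}\|w\|$. *)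

theory Defs
  imports "HOL-Analysis.Analysis" "HOL-Library.FuncSet"
begin

text \<open>Banach spaces are represented as explicit structures whose carrier lives in a
  universe type 'u; scalars are of type 'k (\<real> or \<complex>). An operator ideal is a
  family of operator sets indexed by ALL such Banach spaces of the universe.\<close>

record ('k, 'u) nspace =
  spc   :: "'u set"
  vadd  :: "'u \<Rightarrow> 'u \<Rightarrow> 'u"
  vzero :: "'u"
  vsmul :: "'k \<Rightarrow> 'u \<Rightarrow> 'u"
  vnorm :: "'u \<Rightarrow> real"

definition vsub :: "('k::real_normed_field, 'u, 'z) nspace_scheme \<Rightarrow> 'u \<Rightarrow> 'u \<Rightarrow> 'u" where
  "vsub X x y = vadd X x (vsmul X (- 1) y)"

definition vector_sp :: "('k::real_normed_field, 'u, 'z) nspace_scheme \<Rightarrow> bool" where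
  "vector_sp X \<longleftrightarrow>
     vzero X \<in> spc X \<and>
     (\<forall>x\<in>spc X. \<forall>y\<in>spc X. vadd X x y \<in> spc X) \<and>
     (\<forall>a. \<forall>x\<in>spc X. vsmul X a x \<in> spc X) \<and>
     (\<forall>x\<in>spc X. \<forall>y\<in>spc X. \<forall>z\<in>spc X. vadd X (vadd X x y) z = vadd X x (vadd X y z)) \<and>
     (\<forall>x\<in>spc X. \<forall>y\<in>spc X. vadd X x y = vadd X y x) \<and>
     (\<forall>x\<in>spc X. vadd X x (vzero X) = x) \<and>
     (\<forall>x\<in>spc X. \<exists>y\<in>spc X. vadd X x y = vzero X) \<and>
     (\<forall>a. \<forall>x\<in>spc X. \<forall>y\<in>spc X. vsmul X a (vadd X x y) = vadd X (vsmul X a x) (vsmul X a y)) \<and>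
     (\<forall>a b. \<forall>x\<in>spc X. vsmul X (a + b) x = vadd X (vsmul X a x) (vsmul X b x)) \<and>
     (\<forall>a b. \<forall>x\<in>spc X. vsmul X (a * b) x = vsmul X a (vsmul X b x)) \<and>
     (\<forall>x\<in>spc X. vsmul X 1 x = x)"

definition normed_sp :: "('k::real_normed_field, 'u, 'z) nspace_scheme \<Rightarrow> bool" where
  "normed_sp X \<longleftrightarrow> vector_sp X \<and>
     (\<forall>x\<in>spc X. 0 \<le> vnorm X x \<and> (vnorm X x = 0 \<longleftrightarrow> x = vzero X)) \<and>
     (\<forall>a. \<forall>x\<in>spc X. vnorm X (vsmul X a x) = norm a * vnorm X x) \<and>
     (\<forall>x\<in>spc X. \<forall>y\<in>spc X. vnorm X (vadd X x y) \<le> vnorm X x + vnorm X y)"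

definition banach_sp :: "('k::real_normed_field, 'u, 'z) nspace_scheme \<Rightarrow> bool" where
  "banach_sp X \<longleftrightarrow> normed_sp X \<and>
     (\<forall>s::nat \<Rightarrow> 'u. (\<forall>n. s n \<in> spc X) \<and>
        (\<forall>e>0. \<exists>N. \<forall>m\<ge>N. \<forall>n\<ge>N. vnorm X (vsub X (s m) (s n)) < e) \<longrightarrow>
        (\<exists>x\<in>spc X. (\<lambda>n. vnorm X (vsub X (s n) x)) \<longlonglongrightarrow> 0))"

fun lincomb :: "('k::real_normed_field, 'u, 'z) nspace_scheme \<Rightarrow> ('k \<times> 'u) list \<Rightarrow> 'u" where
  "lincomb X [] = vzero X"
| "lincomb X ((a, b) # xs) = vadd X (vsmul X a b) (lincomb X xs)"

definition infinite_dim :: "('k::real_normed_field, 'u, 'z) nspace_scheme \<Rightarrow> bool" where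
  "infinite_dim X \<longleftrightarrow> \<not> (\<exists>B. set B \<subseteq> spc X \<and>
      (\<forall>x\<in>spc X. \<exists>cs. length cs = length B \<and> x = lincomb X (zip cs B)))"

definition lin_map :: "('k::real_normed_field, 'u, 'z) nspace_scheme \<Rightarrow> ('k, 'v, 'y) nspace_scheme
     \<Rightarrow> ('u \<Rightarrow> 'v) \<Rightarrow> bool" where
  "lin_map X Y f \<longleftrightarrow> f \<in> spc X \<rightarrow> spc Y \<and>
     (\<forall>x\<in>spc X. \<forall>y\<in>spc X. f (vadd X x y) = vadd Y (f x) (f y)) \<and>
     (\<forall>a. \<forall>x\<in>spc X. f (vsmul X a x) = vsmul Y a (f x))"

definition ops :: "('k::real_normed_field, 'u, 'z) nspace_scheme \<Rightarrow> ('k, 'v, 'y) nspace_scheme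
     \<Rightarrow> ('u \<Rightarrow> 'v) set" where
  "ops X Y = {f. lin_map X Y f \<and> f \<in> extensional (spc X) \<and>
      (\<exists>C. \<forall>x\<in>spc X. vnorm Y (f x) \<le> C * vnorm X x)}"

definition opnorm :: "('k::real_normed_field, 'u, 'z) nspace_scheme \<Rightarrow> ('k, 'v, 'y) nspace_scheme
     \<Rightarrow> ('u \<Rightarrow> 'v) \<Rightarrow> real" where
  "opnorm X Y f = Inf {C. 0 \<le> C \<and> (\<forall>x\<in>spc X. vnorm Y (f x) \<le> C * vnorm X x)}"

definition idop :: "('k, 'u, 'z) nspace_scheme \<Rightarrow> 'u \<Rightarrow> 'u" where
  "idop X = restrict (\<lambda>x. x) (spc X)"

definition opadd :: "('k, 'u, 'z) nspace_scheme \<Rightarrow> ('k, 'v, 'y) nspace_scheme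
     \<Rightarrow> ('u \<Rightarrow> 'v) \<Rightarrow> ('u \<Rightarrow> 'v) \<Rightarrow> 'u \<Rightarrow> 'v" where
  "opadd X Y f g = restrict (\<lambda>x. vadd Y (f x) (g x)) (spc X)"

definition opsmul :: "('k, 'u, 'z) nspace_scheme \<Rightarrow> ('k, 'v, 'y) nspace_scheme
     \<Rightarrow> 'k \<Rightarrow> ('u \<Rightarrow> 'v) \<Rightarrow> 'u \<Rightarrow> 'v" where
  "opsmul X Y a f = restrict (\<lambda>x. vsmul Y a (f x)) (spc X)"

definition opzero :: "('k, 'u, 'z) nspace_scheme \<Rightarrow> ('k, 'v, 'y) nspace_scheme \<Rightarrow> 'u \<Rightarrow> 'v" where
  "opzero X Y = restrict (\<lambda>x. vzero Y) (spc X)"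

definition opsub :: "('k::real_normed_field, 'u, 'z) nspace_scheme \<Rightarrow> ('k, 'v, 'y) nspace_scheme
     \<Rightarrow> ('u \<Rightarrow> 'v) \<Rightarrow> ('u \<Rightarrow> 'v) \<Rightarrow> 'u \<Rightarrow> 'v" where
  "opsub X Y f g = opadd X Y f (opsmul X Y (- 1) g)"

definition opcomp :: "('k, 'u, 'z) nspace_scheme \<Rightarrow> ('v \<Rightarrow> 'w) \<Rightarrow> ('u \<Rightarrow> 'v) \<Rightarrow> 'u \<Rightarrow> 'w" where
  "opcomp X g f = restrict (g \<circ> f) (spc X)"

definition dual :: "('k::real_normed_field, 'u, 'z) nspace_scheme \<Rightarrow> ('u \<Rightarrow> 'k) set" where
  "dual X = {\<phi>. (\<forall>x\<in>spc X. \<forall>y\<in>spc X. \<phi> (vadd X x y) = \<phi> x + \<phi> y) \<and>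
                (\<forall>a. \<forall>x\<in>spc X. \<phi> (vsmul X a x) = a * \<phi> x) \<and>
                (\<exists>C. \<forall>x\<in>spc X. norm (\<phi> x) \<le> C * vnorm X x)}"

definition dual_ball :: "('k::real_normed_field, 'u, 'z) nspace_scheme \<Rightarrow> ('u \<Rightarrow> 'k) set" where
  "dual_ball X = {\<phi>\<in>dual X. \<forall>x\<in>spc X. norm (\<phi> x) \<le> vnorm X x}"

definition rank_one :: "('k, 'u, 'z) nspace_scheme \<Rightarrow> ('k, 'v, 'y) nspace_scheme
     \<Rightarrow> ('u \<Rightarrow> 'k) \<Rightarrow> 'v \<Rightarrow> 'u \<Rightarrow> 'v" where
  "rank_one X Y \<phi> y = restrict (\<lambda>x. vsmul Y (\<phi> x) y) (spc X)"

definition abs_1_summing :: "('k::real_normed_field, 'u, 'z) nspace_scheme \<Rightarrow> ('k, 'v, 'y) nspace_scheme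
     \<Rightarrow> ('u \<Rightarrow> 'v) \<Rightarrow> bool" where
  "abs_1_summing X Y f \<longleftrightarrow>
     (\<forall>xs::nat \<Rightarrow> 'u. (\<forall>j. xs j \<in> spc X) \<and>
        (\<exists>B. \<forall>\<phi>\<in>dual_ball X. \<forall>n. (\<Sum>j<n. norm (\<phi> (xs j))) \<le> B) \<longrightarrow>
        summable (\<lambda>j. vnorm Y (f (xs j))))"

definition banach_op_ideal ::
  "(('k::real_normed_field, 'u) nspace \<Rightarrow> ('k, 'u) nspace \<Rightarrow> ('u \<Rightarrow> 'u) set)
   \<Rightarrow> (('k, 'u) nspace \<Rightarrow> ('k, 'u) nspace \<Rightarrow> ('u \<Rightarrow> 'u) \<Rightarrow> real) \<Rightarrow> bool" where
  "banach_op_ideal I nI \<longleftrightarrow>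
     (\<forall>X Y. banach_sp X \<and> banach_sp Y \<longrightarrow>
        I X Y \<subseteq> ops X Y \<and>
        (\<forall>\<phi>\<in>dual X. \<forall>y\<in>spc Y. rank_one X Y \<phi> y \<in> I X Y) \<and>
        (\<forall>f\<in>I X Y. \<forall>g\<in>I X Y. opadd X Y f g \<in> I X Y) \<and>
        (\<forall>a. \<forall>f\<in>I X Y. opsmul X Y a f \<in> I X Y) \<and>
        (\<forall>f\<in>I X Y. 0 \<le> nI X Y f \<and> (nI X Y f = 0 \<longleftrightarrow> f = opzero X Y)) \<and>
        (\<forall>a. \<forall>f\<in>I X Y. nI X Y (opsmul X Y a f) = norm a * nI X Y f) \<and>
        (\<forall>f\<in>I X Y. \<forall>g\<in>I X Y. nI X Y (opadd X Y f g) \<le> nI X Y f + nI X Y g) \<and>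
        (\<forall>s::nat \<Rightarrow> 'u \<Rightarrow> 'u. (\<forall>n. s n \<in> I X Y) \<and>
            (\<forall>e>0. \<exists>N. \<forall>m\<ge>N. \<forall>n\<ge>N. nI X Y (opsub X Y (s m) (s n)) < e) \<longrightarrow>
            (\<exists>f\<in>I X Y. (\<lambda>n. nI X Y (opsub X Y (s n) f)) \<longlonglongrightarrow> 0)) \<and>
        (\<forall>f\<in>I X Y. opnorm X Y f \<le> nI X Y f)) \<and>
     (\<forall>W X Y Z. banach_sp W \<and> banach_sp X \<and> banach_sp Y \<and> banach_sp Z \<longrightarrow>
        (\<forall>w\<in>ops W X. \<forall>u\<in>I X Y. \<forall>v\<in>ops Y Z.
           opcomp W v (opcomp W u w) \<in> I W Z \<and>
           nI W Z (opcomp W v (opcomp W u w)) \<le> opnorm Y Z v * nI X Y u * opnorm W X w)) \<and>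
     (\<forall>K. banach_sp K \<and> (\<exists>e\<in>spc K. e \<noteq> vzero K \<and> (\<forall>x\<in>spc K. \<exists>a. x = vsmul K a e)) \<longrightarrow>
        nI K K (idop K) = 1)"

text \<open>X is isomorphic to a subspace of L1(M): a linear map into (representatives of)
  integrable functions with two-sided norm estimates.\<close>
definition embeds_in_L1 :: "('k::{real_normed_field, banach, second_countable_topology}, 'u, 'z) nspace_scheme
     \<Rightarrow> 'm measure \<Rightarrow> bool" where
  "embeds_in_L1 X M \<longleftrightarrow> (\<exists>(T :: 'u \<Rightarrow> 'm \<Rightarrow> 'k) c C. 0 < c \<and>
     (\<forall>x\<in>spc X. \<forall>y\<in>spc X. T (vadd X x y) = (\<lambda>t. T x t + T y t)) \<and>
     (\<forall>a. \<forall>x\<in>spc X. T (vsmul X a x) = (\<lambda>t. a * T x t)) \<and>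
     (\<forall>x\<in>spc X. integrable M (T x) \<and>
        c * vnorm X x \<le> (\<integral>t. norm (T x t) \<partial>M) \<and> (\<integral>t. norm (T x t) \<partial>M) \<le> C * vnorm X x))"

definition l1_embedding :: "('k::real_normed_field, 'u, 'z) nspace_scheme \<Rightarrow> ((nat \<Rightarrow> 'k) \<Rightarrow> 'u) \<Rightarrow> bool" where
  "l1_embedding X J \<longleftrightarrow> (\<exists>c C. 0 < c \<and>
     (\<forall>a b. summable (\<lambda>n. norm (a n)) \<and> summable (\<lambda>n. norm (b n)) \<longrightarrow>
        J (\<lambda>n. a n + b n) = vadd X (J a) (J b)) \<and>
     (\<forall>s a. summable (\<lambda>n. norm (a n)) \<longrightarrow> J (\<lambda>n. s * a n) = vsmul X s (J a)) \<and>
     (\<forall>a. summable (\<lambda>n. norm (a n)) \<longrightarrow> J a \<in> spc X \<and>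
        c * (\<Sum>n. norm (a n)) \<le> vnorm X (J a) \<and> vnorm X (J a) \<le> C * (\<Sum>n. norm (a n))))"

definition contains_l1 :: "('k::real_normed_field, 'u, 'z) nspace_scheme \<Rightarrow> bool" where
  "contains_l1 X \<longleftrightarrow> (\<exists>J. l1_embedding X J)"

definition isomorphic_to_l1 :: "('k::real_normed_field, 'u, 'z) nspace_scheme \<Rightarrow> bool" where
  "isomorphic_to_l1 X \<longleftrightarrow> (\<exists>J. l1_embedding X J \<and>
      (\<forall>x\<in>spc X. \<exists>a. summable (\<lambda>n. norm (a n)) \<and> J a = x))"

definition opspace :: "('k, 'u) nspace \<Rightarrow> ('k, 'u) nspace \<Rightarrow> ('u \<Rightarrow> 'u) set
     \<Rightarrow> (('u \<Rightarrow> 'u) \<Rightarrow> real) \<Rightarrow> ('k, 'u \<Rightarrow> 'u) nspace" where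
  "opspace X Y V n = \<lparr>spc = V, vadd = opadd X Y, vzero = opzero X Y, vsmul = opsmul X Y, vnorm = n\<rparr>"

end

theory Submission
  imports Defs "HOL-Library.Function_Algebras"
begin

text \<open>It suffices to find a bounded \<open>u : E \<rightarrow> l\<^sub>1\<close> that is not absolutely 1-summing: splitting \<open>l\<^sub>1\<close> into
  infinitely many copies of itself, the operators \<open>J (\<alpha> \<otimes> u)\<close> with \<open>\<alpha> \<in> l\<^sub>1\<close>, where \<open>J\<close> embeds \<open>l\<^sub>1\<close> into \<open>F\<close>, form a
  closed subspace of \<open>I(E;F)\<close> isomorphic to \<open>l\<^sub>1\<close>, and \<open>\<parallel>J (\<alpha> \<otimes> u x)\<parallel> \<ge> c \<parallel>\<alpha>\<parallel>\<^sub>1 \<parallel>u x\<parallel>\<^sub>1\<close> shows that none of them except 0 is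
  absolutely 1-summing. By the Dvoretzky-Rogers theorem some weakly 1-summable sequence in \<open>E\<close> has
  divergent norm sums; integrating the embedding \<open>E \<rightarrow> L\<^sub>1(\<mu>)\<close> over the cells of fine partitions and gluing
  countably many such operators gives \<open>u\<close>.

  For subspaces of \<open>L\<^sub>1\<close> the Dvoretzky-Rogers theorem is obtained as follows. If it failed, then by
  Khinchine's inequality \<open>\<integral> (\<Sum> |f\<^sub>i|\<^sup>2)\<^sup>1\<^sup>/\<^sup>2\<close> would be bounded by a multiple of the norm of
  \<open>(b\<^sub>i) \<mapsto> \<Sum> b\<^sub>i f\<^sub>i\<close> on \<open>l\<^sub>2\<close>, and a system that nearly attains the best constant would provide a weight
  for which \<open>\<integral> |f|\<^sup>2 / W\<close> is comparable with \<open>(\<integral> |f|)\<^sup>2\<close>; orthonormal systems for this form contradict the bound.\<close>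

subsection \<open>Real normed fields embed into the complex numbers\<close>

text \<open>The scalars form an abstract real normed field, while the Rademacher estimates need an
  inner product. A multiplicative norm leaves only the real and the complex numbers (Gelfand-Mazur
  in Ostrowski's form), so functions are pushed into \<open>complex\<close> by a real-linear map;
  this costs factors 2 but keeps all later arguments over real coefficients. The weighted form
  arises variationally: a function of L1 norm d, appended to a near-maximiser and renormalised,
  changes the admissible bound only to second order in d, and the second-order gain in the square
  function is a weighted L2 norm. Comparing the two orders gives the estimate without any
  factorization theorem. The ideal is indexed by spaces with carriers in \<open>'u\<close>, where
  the sequence space itself need not live; the copy of l1 used is therefore the image of
  \<open>J\<close> inside F. Closedness holds because the ideal norm dominates the operator norm, so
  limits are pointwise, and evaluation at a single x with \<open>u x\<close> nonzero already
  recovers the coefficient sequence.\<close>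

text \<open>With X = x + s/2 and r = p - s^2/4 the left side is formally X^2 + r + e w times its
  conjugate, where w = c + i sqrt (1 - c^2). Its roots are g, -g and their conjugates, g^2 = -(r + e
  w); pairing each root with its conjugate gives real factors. The number g stays in
  \<open>complex\<close>: only a = Re g and N = |g|^2 enter the field.\<close>

lemma quartic_factors_into_real_quadratics:
  fixes x :: "'k::real_normed_field" and s p e c :: real
  assumes c: "\<bar>c\<bar> \<le> 1"
  obtains s1 p1 s2 p2 :: real where
    "(x\<^sup>2 + of_real s * x + of_real p)\<^sup>2 + of_real (2 * e * c) * (x\<^sup>2 + of_real s * x + of_real p) + of_real (e\<^sup>2)
      = (x\<^sup>2 + of_real s1 * x + of_real p1) * (x\<^sup>2 + of_real s2 * x + of_real p2)"
proof -
  define r where "r = p - s\<^sup>2 / 4"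
  define g where "g = csqrt (- Complex (r + e * c) (e * sqrt (1 - c\<^sup>2)))"
  define a b where "a = Re g" and "b = Im g"
  define N where "N = a\<^sup>2 + b\<^sup>2"
  have g2: "g\<^sup>2 = - Complex (r + e * c) (e * sqrt (1 - c\<^sup>2))" unfolding g_def by simp
  have re: "a\<^sup>2 - b\<^sup>2 = - (r + e * c)"
    using arg_cong[OF g2, of Re] by (simp add: a_def b_def power2_eq_square)
  have im: "2 * a * b = - (e * sqrt (1 - c\<^sup>2))"
    using arg_cong[OF g2, of Im] by (simp add: a_def b_def power2_eq_square mult.commute)
  have c2: "c\<^sup>2 \<le> 1" using c by (simp add: abs_square_le_1)
  have "N\<^sup>2 = (a\<^sup>2 - b\<^sup>2)\<^sup>2 + (2 * a * b)\<^sup>2"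
    unfolding N_def by (simp add: power2_eq_square algebra_simps)
  also have "\<dots> = (r + e * c)\<^sup>2 + e\<^sup>2 * (1 - c\<^sup>2)"
    unfolding re im using c2 by (simp only: power2_minus power_mult_distrib) simp
  also have "\<dots> = r\<^sup>2 + 2 * e * c * r + e\<^sup>2" by (simp add: power2_eq_square algebra_simps)
  finally have N2: "N\<^sup>2 = r\<^sup>2 + 2 * e * c * r + e\<^sup>2" .
  have N1: "2 * N - 4 * a\<^sup>2 = 2 * r + 2 * e * c" unfolding N_def using re by simp
  define X where "X = x + of_real (s / 2)"
  have y: "x\<^sup>2 + of_real s * x + of_real p = X\<^sup>2 + of_real r"
    unfolding X_def r_def by (simp add: power2_eq_square field_simps)
  have f1: "x\<^sup>2 + of_real (s - 2 * a) * x + of_real (s\<^sup>2 / 4 - a * s + N) = X\<^sup>2 - of_real (2 * a) * X + of_real N"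
    unfolding X_def by (simp add: power2_eq_square field_simps)
  have f2: "x\<^sup>2 + of_real (s + 2 * a) * x + of_real (s\<^sup>2 / 4 + a * s + N) = X\<^sup>2 + of_real (2 * a) * X + of_real N"
    unfolding X_def by (simp add: power2_eq_square field_simps)
  have "(X\<^sup>2 - of_real (2 * a) * X + of_real N) * (X\<^sup>2 + of_real (2 * a) * X + of_real N)
      = X^4 + of_real (2 * N - 4 * a\<^sup>2) * X\<^sup>2 + of_real (N\<^sup>2)"
    by (simp add: power2_eq_square power4_eq_xxxx algebra_simps)
  also have "\<dots> = (X\<^sup>2 + of_real r)\<^sup>2 + of_real (2 * e * c) * (X\<^sup>2 + of_real r) + of_real (e\<^sup>2)"
    unfolding N1 N2 by (simp add: power2_eq_square power4_eq_xxxx algebra_simps)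
  finally show ?thesis
    using that[of "s - 2 * a" "s\<^sup>2 / 4 - a * s + N" "s + 2 * a" "s\<^sup>2 / 4 + a * s + N"]
    unfolding f1 f2 y by simp
qed

text \<open>The passage from level \<open>j\<close> to \<open>j + 1\<close> is the identity
  \<open>y\<^sup>4 + 2 e\<^sup>2 c y\<^sup>2 + e\<^sup>4 = (y\<^sup>2 + 2 e k y + e\<^sup>2) (y\<^sup>2 - 2 e k y + e\<^sup>2)\<close> with \<open>2 k\<^sup>2 = 1 - c\<close>.\<close>

lemma norm_quadratic_power_ge:
  fixes y :: "'k::real_normed_field" and m e :: real
  assumes m: "0 \<le> m"
    and base: "\<And>c. \<bar>c\<bar> \<le> 1 \<Longrightarrow> m\<^sup>2 \<le> norm (y\<^sup>2 + of_real (2 * e * c) * y + of_real (e\<^sup>2))"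
    and c: "\<bar>c\<bar> \<le> 1"
  shows "(m ^ (2^j))\<^sup>2 \<le> norm ((y ^ (2^j))\<^sup>2 + of_real (2 * e ^ (2^j) * c) * y ^ (2^j) + of_real ((e ^ (2^j))\<^sup>2))"
  using c
proof (induction j arbitrary: c)
  case 0
  then show ?case using base by simp
next
  case (Suc j)
  define Y where "Y = y ^ (2^j)"
  define d where "d = e ^ (2^j)"
  define k where "k = sqrt ((1 - c) / 2)"
  have k2: "k\<^sup>2 = (1 - c) / 2" using Suc.prems unfolding k_def by simp
  have k: "\<bar>k\<bar> \<le> 1" "\<bar>- k\<bar> \<le> 1"
    using abs_square_le_1[of k] k2 Suc.prems by auto
  have c: "c = 1 - 2 * k\<^sup>2" using k2 by simp
  have p: "z ^ (2 ^ Suc j) = (z ^ (2^j))\<^sup>2" for z :: "'z::comm_monoid_mult"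
    by (simp add: power_mult[symmetric] mult.commute)
  have "(Y\<^sup>2)\<^sup>2 + of_real (2 * d\<^sup>2 * c) * Y\<^sup>2 + of_real ((d\<^sup>2)\<^sup>2)
     = (Y\<^sup>2 + of_real (2 * d * k) * Y + of_real (d\<^sup>2)) * (Y\<^sup>2 + of_real (2 * d * (- k)) * Y + of_real (d\<^sup>2))"
    unfolding c by (simp add: power2_eq_square algebra_simps)
  then have "norm ((Y\<^sup>2)\<^sup>2 + of_real (2 * d\<^sup>2 * c) * Y\<^sup>2 + of_real ((d\<^sup>2)\<^sup>2))
     = norm (Y\<^sup>2 + of_real (2 * d * k) * Y + of_real (d\<^sup>2)) * norm (Y\<^sup>2 + of_real (2 * d * (- k)) * Y + of_real (d\<^sup>2))"
    by (simp only: norm_mult)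
  also have "\<dots> \<ge> (m ^ (2^j))\<^sup>2 * (m ^ (2^j))\<^sup>2"
    using Suc.IH[OF k(1)] Suc.IH[OF k(2)] unfolding Y_def[symmetric] d_def[symmetric]
    by (intro mult_mono) auto
  finally show ?case unfolding p Y_def[symmetric] d_def[symmetric] by (simp add: power2_eq_square)
qed

text \<open>Otherwise the norm of monic real quadratics in x attains a positive minimum m, and
  adding any e in (0, m) to a minimiser y gives a minimiser again. Iterating this makes the constant
  term grow while the norm stays m, which is absurd. The shift works because the norm is
  multiplicative: y^(2^k) - e^(2^k) is the product of y - e, y + e and factors y^(2^j) + e^(2^j),
  and apart from y + e each has norm at least the corresponding power of m. Hence norm (y + e) *
  m^(2^k - 1) \<le> m^(2^k) + e^(2^k), and k tends to infinity.\<close>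

lemma real_normed_field_quadratic:
  fixes x :: "'k::real_normed_field"
  shows "\<exists>s p :: real. x\<^sup>2 + of_real s * x + of_real p = 0"
proof (rule ccontr)
  assume "\<not> ?thesis"
  then have nz: "x\<^sup>2 + of_real s * x + of_real p \<noteq> 0" for s p :: real by blast
  define f where "f z = norm (x\<^sup>2 + of_real (fst z) * x + of_real (snd z))" for z :: "real \<times> real"
  have notreal: "x + of_real r \<noteq> 0" for r :: real
  proof
    assume "x + of_real r = 0"
    then have "x\<^sup>2 + of_real r * x + of_real 0 = 0"
      by (simp add: power2_eq_square flip: distrib_right)
    then show False using nz by blast
  qed
  have x0: "0 < norm x" using notreal[of 0] by simp
  obtain r0 where r0: "r0 \<in> {- (2 * norm x)..2 * norm x}"
    "\<forall>r\<in>{- (2 * norm x)..2 * norm x}. norm (x + of_real r0) \<le> norm (x + of_real r)"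
  proof -
    have "continuous_on {- (2 * norm x)..2 * norm x} (\<lambda>r. norm (x + of_real r))"
      by (intro continuous_intros)
    then show thesis
      using continuous_attains_inf[of "{- (2 * norm x)..2 * norm x}" "\<lambda>r. norm (x + of_real r)"] that x0
      by fastforce
  qed
  \<comment> \<open>The distance from x to the reals. Its positivity bounds s and p in terms of the
    norm of s x + p, so that the minimum may be sought in a compact box.\<close>
  define d where "d = norm (x + of_real r0)"
  have d0: "0 < d" unfolding d_def using notreal by simp
  have d: "d \<le> norm (x + of_real r)" for r :: real
  proof (cases "\<bar>r\<bar> \<le> 2 * norm x")
    case True
    then show ?thesis unfolding d_def by (intro bspec[OF r0(2)]) auto
  next
    case False
    have "d \<le> norm (x + of_real 0)" unfolding d_def using r0(2) by (intro bspec[OF r0(2)]) auto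
    also have "\<dots> \<le> \<bar>r\<bar> - norm x" using False by simp
    also have "\<dots> \<le> norm (x + of_real r)"
      using norm_triangle_ineq2[of "of_real r :: 'k" "- x"] by (simp add: add.commute)
    finally show ?thesis .
  qed
  have ds: "\<bar>s\<bar> * d \<le> norm (of_real s * x + of_real p)" for s p :: real
  proof (cases "s = 0")
    case False
    have "of_real s * x + of_real p = of_real s * (x + of_real (p / s))"
      using False by (simp add: algebra_simps)
    then have "norm (of_real s * x + of_real p) = \<bar>s\<bar> * norm (x + of_real (p / s))"
      by (simp only: norm_mult norm_of_real)
    then show ?thesis using d[of "p / s"] by (simp only: mult_left_mono abs_ge_zero)
  qed simp
  \<comment> \<open>If x^2 + s x + p is no larger than x^2, then s x + p has norm at most D; S and P
    are the resulting bounds for the coefficients.\<close>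
  define D where "D = 2 * norm (x\<^sup>2)"
  define S where "S = D / d"
  define P where "P = D + S * norm x"
  have D0: "0 \<le> D" "0 \<le> S" "0 \<le> P" unfolding D_def S_def P_def using d0 by simp_all
  define Q where "Q = {-S..S} \<times> {-P..P}"
  have Q0: "(0,0) \<in> Q" using D0 unfolding Q_def by simp
  have inQ: "z \<in> Q" if z: "f z \<le> f (0,0)" for z
  proof -
    obtain s p where sp: "z = (s,p)" by force
    let ?v = "of_real s * x + of_real p :: 'k"
    have "norm ?v \<le> norm (x\<^sup>2 + ?v) + norm (x\<^sup>2)"
      using norm_triangle_ineq4[of "x\<^sup>2 + ?v" "x\<^sup>2"] by simp
    then have v: "norm ?v \<le> D" using z unfolding sp f_def D_def by (simp add: add.assoc)
    have "\<bar>s\<bar> * d \<le> D" using ds[of s p] v by linarith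
    then have s: "\<bar>s\<bar> \<le> S" unfolding S_def using d0 by (simp add: pos_le_divide_eq)
    have "\<bar>p\<bar> = norm (?v - of_real s * x)" by simp
    also have "\<dots> \<le> norm ?v + norm (of_real s * x :: 'k)" by (rule norm_triangle_ineq4)
    also have "\<dots> = norm ?v + \<bar>s\<bar> * norm x" by (simp add: norm_mult)
    also have "\<dots> \<le> D + S * norm x" using v s by (intro add_mono mult_right_mono) auto
    finally show ?thesis using s unfolding sp Q_def P_def by auto
  qed
  obtain z0 where z0: "z0 \<in> Q" "\<forall>z\<in>Q. f z0 \<le> f z"
  proof -
    have "compact Q" unfolding Q_def by (intro compact_Times compact_Icc)
    moreover have "continuous_on Q f" unfolding f_def by (intro continuous_intros)
    ultimately show thesis using continuous_attains_inf[of Q f] Q0 that by blast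
  qed
  define m where "m = f z0"
  have min: "m \<le> norm (x\<^sup>2 + of_real s * x + of_real p)" for s p :: real
    using z0(2) inQ[of "(s,p)"] Q0 unfolding m_def f_def
    by (cases "f (s,p) \<le> f (0,0)") (force simp: f_def)+
  obtain s p0 where sp: "z0 = (s, p0)" by force
  have m0: "0 < m" unfolding m_def f_def sp using nz by simp
  have shift: "norm (x\<^sup>2 + of_real s * x + of_real (p + e)) \<le> m"
    if p: "norm (x\<^sup>2 + of_real s * x + of_real p) = m" and e: "0 < e" "e < m" for p e
  proof -
    define y where "y = x\<^sup>2 + of_real s * x + of_real p"
    have ny: "norm y = m" using p y_def by simp
    have base: "m\<^sup>2 \<le> norm (y\<^sup>2 + of_real (2 * e * c) * y + of_real (e\<^sup>2))" if c: "\<bar>c\<bar> \<le> 1" for c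
    proof -
      obtain s1 p1 s2 p2 where eq: "y\<^sup>2 + of_real (2 * e * c) * y + of_real (e\<^sup>2)
         = (x\<^sup>2 + of_real s1 * x + of_real p1) * (x\<^sup>2 + of_real s2 * x + of_real p2)"
        unfolding y_def by (rule quartic_factors_into_real_quadratics[OF c])
      show ?thesis unfolding eq norm_mult power2_eq_square[of m]
        using min m0 by (intro mult_mono) auto
    qed
    have plus: "m ^ (2 ^ Suc j) \<le> norm (y ^ (2 ^ Suc j) + of_real (e ^ (2 ^ Suc j)))" for j
    proof -
      have "(m ^ (2^j))\<^sup>2 \<le> norm ((y ^ (2^j))\<^sup>2 + of_real ((e ^ (2^j))\<^sup>2))"
        using norm_quadratic_power_ge[of m y e 0 j, OF _ base] m0 by simp
      then show ?thesis by (simp add: power_mult[symmetric] mult.commute)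
    qed
    have minus: "norm (y + of_real e) * m ^ (2 ^ Suc j) \<le> norm (y ^ (2 ^ Suc j) - of_real (e ^ (2 ^ Suc j))) * m" for j
    proof (induction j)
      case 0
      have "y - of_real e = x\<^sup>2 + of_real s * x + of_real (p - e)" unfolding y_def by simp
      then have "m \<le> norm (y - of_real e)" using min[of s "p - e"] by (simp only:)
      then have "norm (y + of_real e) * (m * m) \<le> norm (y + of_real e) * (norm (y - of_real e) * m)"
        using m0 by (intro mult_left_mono mult_right_mono) auto
      moreover have "y ^ (2 ^ Suc 0) - of_real (e ^ (2 ^ Suc 0)) = (y + of_real e) * (y - of_real e)"
        by (simp add: power2_eq_square algebra_simps)
      ultimately show ?case by (simp only: norm_mult mult.assoc) (simp add: power2_eq_square)
    next
      case (Suc j)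
      let ?n = "2 ^ Suc j"
      have sq: "z ^ (2 ^ Suc (Suc j)) = z ^ ?n * z ^ ?n" for z :: "'z::comm_monoid_mult"
        by (simp add: power_add[symmetric])
      have "norm (y + of_real e) * m ^ (2 ^ Suc (Suc j)) = (norm (y + of_real e) * m ^ ?n) * m ^ ?n"
        unfolding sq by simp
      also have "\<dots> \<le> (norm (y ^ ?n - of_real (e ^ ?n)) * m) * norm (y ^ ?n + of_real (e ^ ?n))"
        by (intro mult_mono Suc plus) (use m0 in simp_all)
      also have "\<dots> = norm ((y ^ ?n - of_real (e ^ ?n)) * (y ^ ?n + of_real (e ^ ?n))) * m"
        by (simp add: norm_mult)
      also have "(y ^ ?n - of_real (e ^ ?n)) * (y ^ ?n + of_real (e ^ ?n))
         = y ^ (2 ^ Suc (Suc j)) - of_real (e ^ (2 ^ Suc (Suc j)))"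
        unfolding sq by (simp only: of_real_mult) (simp add: algebra_simps)
      finally show ?case .
    qed
    have bd: "norm (y + of_real e) \<le> m * (1 + (e / m) ^ (2 ^ Suc j))" for j
    proof -
      have "norm (y ^ (2 ^ Suc j) - of_real (e ^ (2 ^ Suc j))) \<le> norm (y ^ (2 ^ Suc j)) + norm (of_real (e ^ (2 ^ Suc j)) :: 'k)"
        by (rule norm_triangle_ineq4)
      also have "\<dots> = m ^ (2 ^ Suc j) + e ^ (2 ^ Suc j)"
        using e ny by (simp only: norm_power norm_of_real) simp
      finally have "norm (y ^ (2 ^ Suc j) - of_real (e ^ (2 ^ Suc j))) * m \<le> (m ^ (2 ^ Suc j) + e ^ (2 ^ Suc j)) * m"
        using m0 by (intro mult_right_mono) auto
      then have "norm (y + of_real e) * m ^ (2 ^ Suc j) \<le> (m ^ (2 ^ Suc j) + e ^ (2 ^ Suc j)) * m"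
        using minus[of j] by linarith
      then have "norm (y + of_real e) \<le> (m ^ (2 ^ Suc j) + e ^ (2 ^ Suc j)) * m / m ^ (2 ^ Suc j)"
        using m0 by (subst pos_le_divide_eq) auto
      also have "\<dots> = m * (1 + (e / m) ^ (2 ^ Suc j))"
        using m0 by (simp add: field_simps power_divide)
      finally show ?thesis .
    qed
    have "(\<lambda>n. (e / m) ^ n) \<longlonglongrightarrow> 0" using e m0 by (intro LIMSEQ_power_zero) auto
    moreover have "strict_mono (\<lambda>j::nat. 2 ^ Suc j :: nat)"
      by (intro strict_monoI power_strict_increasing) auto
    ultimately have "(\<lambda>j. (e / m) ^ (2 ^ Suc j)) \<longlonglongrightarrow> 0"
      using LIMSEQ_subseq_LIMSEQ[of "\<lambda>n. (e / m) ^ n" 0 "\<lambda>j. 2 ^ Suc j"] by (simp add: o_def)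
    then have "(\<lambda>j. m * (1 + (e / m) ^ (2 ^ Suc j))) \<longlonglongrightarrow> m * (1 + 0)"
      by (intro tendsto_intros)
    then have "norm (y + of_real e) \<le> m * (1 + 0)"
      by (rule LIMSEQ_le_const) (use bd in blast)
    then show ?thesis unfolding y_def by (simp add: add.assoc)
  qed
  have iter: "norm (x\<^sup>2 + of_real s * x + of_real (p0 + real k * (m / 2))) = m" for k
  proof (induction k)
    case 0
    then show ?case unfolding m_def f_def sp by simp
  next
    case (Suc k)
    have "p0 + real (Suc k) * (m / 2) = (p0 + real k * (m / 2)) + m / 2" by (simp add: algebra_simps)
    then show ?case using shift[OF Suc, of "m / 2"] min[of s "p0 + real (Suc k) * (m / 2)"] m0
      by (simp only:) simp
  qed
  \<comment> \<open>Five shifts by m/2 move the constant term by 5m/2, whereas two elements of norm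
    m differ by at most 2m.\<close>
  have "norm (of_real (5 * (m / 2)) :: 'k) \<le> norm (x\<^sup>2 + of_real s * x + of_real (p0 + 5 * (m / 2))) + norm (x\<^sup>2 + of_real s * x + of_real p0)"
    using norm_triangle_ineq4[of "x\<^sup>2 + of_real s * x + of_real (p0 + 5 * (m / 2))" "x\<^sup>2 + of_real s * x + of_real p0"]
    by simp
  then show False using iter[of 5] iter[of 0] m0 by simp
qed

text \<open>Complete the square in a real quadratic that annihilates x: the shifted element squares
  to -r, so it is real when r \<le> 0 and becomes a square root of -1 after division by sqrt r
  otherwise.\<close>

lemma real_normed_field_imaginary_unit:
  fixes x :: "'k::real_normed_field"
  obtains (real) r where "x = of_real r"
    | (imag) a b i where "i * i = - 1" "x = of_real a + of_real b * i"
proof -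
  obtain s p :: real where q: "x\<^sup>2 + of_real s * x + of_real p = 0"
    using real_normed_field_quadratic by blast
  define X where "X = x + of_real (s / 2)"
  define r where "r = p - s\<^sup>2 / 4"
  have X: "X\<^sup>2 = - of_real r"
    proof -
    have "X\<^sup>2 + of_real r = x\<^sup>2 + of_real s * x + of_real p"
      unfolding X_def r_def by (simp add: power2_eq_square field_simps)
    then show ?thesis using q by (simp add: eq_neg_iff_add_eq_0)
  qed
  show thesis
  proof (cases "r \<le> 0")
    case True
    then have "X\<^sup>2 = (of_real (sqrt (- r)))\<^sup>2"
      unfolding X of_real_power[symmetric] by simp
    then have "X = of_real (sqrt (- r)) \<or> X = of_real (- sqrt (- r))"
      by (simp only: power2_eq_iff of_real_minus)
    then have "x = of_real (sqrt (- r) - s / 2) \<or> x = of_real (- sqrt (- r) - s / 2)"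
      unfolding X_def by (auto simp: algebra_simps)
    then show thesis using real by blast
  next
    case False
    define i where "i = X / of_real (sqrt r)"
    have sr: "of_real (sqrt r) * of_real (sqrt r) = (of_real r :: 'k)"
      using False by (simp flip: of_real_mult)
    have "i * i = (X\<^sup>2) / of_real r"
      unfolding i_def by (simp add: power2_eq_square sr)
    then have 1: "i * i = - 1" using False unfolding X by simp
    have "x = of_real (- s / 2) + of_real (sqrt r) * i"
      using False unfolding i_def X_def by simp
    then show thesis using imag 1 by blast
  qed
qed

text \<open>Without a square root of -1 every element is real; with one, every element is a + b i.
  The factor 2 is crude but sufficient: the upper bound is the triangle inequality with |a| + |b|
  \<le> 2 |a + b i|, the lower one comes from multiplying by the conjugate, whose norm is at most
  |a| + |b|.\<close>

lemma real_normed_field_to_complex: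
  obtains \<psi> :: "'k::real_normed_field \<Rightarrow> complex"
  where "\<And>x y. \<psi> (x + y) = \<psi> x + \<psi> y" "\<And>r x. \<psi> (of_real r * x) = r *\<^sub>R \<psi> x"
    "\<And>x. norm x \<le> 2 * norm (\<psi> x)" "\<And>x. norm (\<psi> x) \<le> 2 * norm x"
proof (cases "\<exists>i::'k. i * i = - 1")
  case False
  have "\<exists>r. x = of_real r" for x :: 'k
    by (rule real_normed_field_imaginary_unit[of x]) (use False in auto)
  then obtain g :: "'k \<Rightarrow> real" where g: "\<And>x. x = of_real (g x)" by metis
  have add: "g (x + y) = g x + g y" for x y
  proof -
    have "(of_real (g (x + y)) :: 'k) = of_real (g x + g y)"
      using g[of x] g[of y] g[of "x + y"] by simp
    then show ?thesis by (simp only: of_real_eq_iff)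
  qed
  have mul: "g (of_real r * x) = r * g x" for r x
  proof -
    have "(of_real (g (of_real r * x)) :: 'k) = of_real (r * g x)"
      using g[of x] g[of "of_real r * x"] by simp
    then show ?thesis by (simp only: of_real_eq_iff)
  qed
  have nrm: "norm x = \<bar>g x\<bar>" for x using g[of x] by (metis norm_of_real)
  show thesis by (rule that[of "\<lambda>x. of_real (g x)"]) (auto simp: add mul nrm scaleR_conv_of_real)
next
  case True
  then obtain i :: 'k where i: "i * i = - 1" by blast
  have "\<exists>a b. x = of_real a + of_real b * i" for x :: 'k
  proof (rule real_normed_field_imaginary_unit[of x])
    fix r assume "x = of_real r"
    then have "x = of_real r + of_real 0 * i" by simp
    then show ?thesis by blast
  next
    fix a b j assume j: "j * j = - 1" and x: "x = of_real a + of_real b * j"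
    \<comment> \<open>In a field two square roots of -1 differ only by a sign, so one fixed i serves
      every element.\<close>
    have "(j - i) * (j + i) = 0" using i j by (simp add: algebra_simps)
    then have "j = i \<or> j = - i" by (auto simp: eq_neg_iff_add_eq_0)
    then have "x = of_real a + of_real b * i \<or> x = of_real a + of_real (- b) * i" using x by auto
    then show ?thesis by blast
  qed
  then obtain g h where gh: "\<And>x. x = of_real (g x) + of_real (h x) * i" by metis
  have ni: "norm i = 1"
  proof -
    have "norm i * norm i = 1" using i by (metis norm_minus_cancel norm_mult norm_one)
    then show ?thesis by (metis abs_norm_cancel abs_square_eq_1 power2_eq_square)
  qed
  have prod: "(of_real a + of_real b * i) * (of_real a - of_real b * i) = of_real (a\<^sup>2 + b\<^sup>2)" for a b
  proof -
    have "(of_real a + of_real b * i) * (of_real a - of_real b * i) = of_real a * of_real a - of_real b * of_real b * (i * i)"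
      by (simp add: algebra_simps)
    then show ?thesis using i by (simp add: power2_eq_square)
  qed
  have up: "norm (of_real a + of_real b * i) \<le> \<bar>a\<bar> + \<bar>b\<bar>" for a b
    using norm_triangle_ineq[of "of_real a" "of_real b * i"] ni by (simp add: norm_mult)
  have cm: "\<bar>a\<bar> + \<bar>b\<bar> \<le> 2 * cmod (Complex a b)" for a b
    using abs_Re_le_cmod[of "Complex a b"] abs_Im_le_cmod[of "Complex a b"] by simp
  have low: "cmod (Complex a b) \<le> 2 * norm (of_real a + of_real b * i)" for a b
  proof (cases "Complex a b = 0")
    case False
    have "(cmod (Complex a b))\<^sup>2 = norm ((of_real a + of_real b * i) * (of_real a - of_real b * i))"
      unfolding prod cmod_def by (simp only: norm_of_real) simp
    also have "\<dots> \<le> norm (of_real a + of_real b * i) * (\<bar>a\<bar> + \<bar>b\<bar>)"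
      using up[of a "- b"] by (simp add: norm_mult mult_left_mono)
    also have "\<dots> \<le> norm (of_real a + of_real b * i) * (2 * cmod (Complex a b))"
      using cm by (intro mult_left_mono) auto
    finally show ?thesis using False by (simp add: power2_eq_square)
  qed simp
  have uniq: "a = a' \<and> b = b'" if "of_real a + of_real b * i = of_real a' + of_real b' * i" for a b a' b'
  proof -
    have "of_real (a - a') + of_real (b - b') * i = 0" using that by (simp add: algebra_simps)
    then have "Complex (a - a') (b - b') = 0" using low[of "a - a'" "b - b'"] by simp
    then show ?thesis by (simp add: complex_eq_iff)
  qed
  define \<psi> where "\<psi> x = Complex (g x) (h x)" for x
  show thesis
  proof (rule that[of \<psi>])
    fix x y
    have "of_real (g (x + y)) + of_real (h (x + y)) * i = of_real (g x + g y) + of_real (h x + h y) * i"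
      using gh[of x] gh[of y] gh[of "x + y"] by (simp add: algebra_simps)
    from uniq[OF this] show "\<psi> (x + y) = \<psi> x + \<psi> y" unfolding \<psi>_def by (simp add: complex_eq_iff)
  next
    fix r x
    have "of_real (g (of_real r * x)) + of_real (h (of_real r * x)) * i = of_real r * (of_real (g x) + of_real (h x) * i)"
      using gh[of x] gh[of "of_real r * x"] by simp
    also have "\<dots> = of_real (r * g x) + of_real (r * h x) * i" by (simp add: algebra_simps)
    finally show "\<psi> (of_real r * x) = r *\<^sub>R \<psi> x"
      using uniq[of "g (of_real r * x)" "h (of_real r * x)" "r * g x" "r * h x"]
      unfolding \<psi>_def by (simp add: complex_eq_iff)
  next
    fix x
    show "norm x \<le> 2 * norm (\<psi> x)" using up[of "g x" "h x"] cm[of "g x" "h x"] gh[of x] unfolding \<psi>_def by simp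
    show "norm (\<psi> x) \<le> 2 * norm x" using low[of "g x" "h x"] gh[of x] unfolding \<psi>_def by simp
  qed
qed

subsection \<open>Rademacher sums\<close>

text \<open>Subsets of \<open>{..<n}\<close> encode sign patterns: sums over
  \<open>Pow {..<n}\<close> are 2^n times expectations over independent Rademacher signs, which
  explains the factor 2^n in the moments.\<close>

definition rsign :: "nat set \<Rightarrow> nat \<Rightarrow> real" where
  "rsign S i = (if i \<in> S then 1 else - 1)"

lemma sum_Pow_lessThan_Suc:
  fixes F :: "nat set \<Rightarrow> 'b::comm_monoid_add"
  shows "(\<Sum>S\<in>Pow {..<Suc n}. F S) = (\<Sum>S\<in>Pow {..<n}. F S + F (insert n S))"
proof -
  have inj: "inj_on (insert n) (Pow {..<n})"
    by (rule inj_on_inverseI[where g = "\<lambda>S. S - {n}"]) auto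
  have disj: "Pow {..<n} \<inter> insert n ` Pow {..<n} = {}" by auto
  have "Pow {..<Suc n} = Pow {..<n} \<union> insert n ` Pow {..<n}"
    by (simp add: lessThan_Suc Pow_insert)
  then have "(\<Sum>S\<in>Pow {..<Suc n}. F S) = (\<Sum>S\<in>Pow {..<n}. F S) + (\<Sum>S\<in>insert n ` Pow {..<n}. F S)"
    using disj by (simp add: sum.union_disjoint)
  also have "(\<Sum>S\<in>insert n ` Pow {..<n}. F S) = (\<Sum>S\<in>Pow {..<n}. F (insert n S))"
    using inj by (simp add: sum.reindex)
  finally show ?thesis by (simp add: sum.distrib)
qed

lemma rsign_sum_step:
  fixes v :: "nat \<Rightarrow> 'b::real_vector"
  assumes "S \<in> Pow {..<n}"
  shows "(\<Sum>i<Suc n. rsign S i *\<^sub>R v i) = (\<Sum>i<n. rsign S i *\<^sub>R v i) - v n"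
    and "(\<Sum>i<Suc n. rsign (insert n S) i *\<^sub>R v i) = (\<Sum>i<n. rsign S i *\<^sub>R v i) + v n"
proof -
  have "n \<notin> S" using assms by auto
  then show "(\<Sum>i<Suc n. rsign S i *\<^sub>R v i) = (\<Sum>i<n. rsign S i *\<^sub>R v i) - v n"
    by (simp add: rsign_def)
  have "(\<Sum>i<n. rsign (insert n S) i *\<^sub>R v i) = (\<Sum>i<n. rsign S i *\<^sub>R v i)"
    by (rule sum.cong) (auto simp: rsign_def)
  then show "(\<Sum>i<Suc n. rsign (insert n S) i *\<^sub>R v i) = (\<Sum>i<n. rsign S i *\<^sub>R v i) + v n"
    by (simp add: rsign_def)
qed

lemma rademacher_second_moment:
  fixes v :: "nat \<Rightarrow> 'b::real_inner"
  shows "(\<Sum>S\<in>Pow {..<n}. (norm (\<Sum>i<n. rsign S i *\<^sub>R v i))\<^sup>2) = 2 ^ n * (\<Sum>i<n. (norm (v i))\<^sup>2)"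
proof (induction n)
  case 0
  then show ?case by simp
next
  case (Suc n)
  have "(\<Sum>S\<in>Pow {..<Suc n}. (norm (\<Sum>i<Suc n. rsign S i *\<^sub>R v i))\<^sup>2)
    = (\<Sum>S\<in>Pow {..<n}. 2 * (norm (\<Sum>i<n. rsign S i *\<^sub>R v i))\<^sup>2 + 2 * (norm (v n))\<^sup>2)"
    unfolding sum_Pow_lessThan_Suc
  proof (rule sum.cong[OF refl])
    fix S assume "S \<in> Pow {..<n}"
    note st = rsign_sum_step[OF this, of v]
    show "(norm (\<Sum>i<Suc n. rsign S i *\<^sub>R v i))\<^sup>2 + (norm (\<Sum>i<Suc n. rsign (insert n S) i *\<^sub>R v i))\<^sup>2
      = 2 * (norm (\<Sum>i<n. rsign S i *\<^sub>R v i))\<^sup>2 + 2 * (norm (v n))\<^sup>2"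
      unfolding st by (simp add: power2_norm_eq_inner algebra_simps)
  qed
  also have "\<dots> = 2 ^ Suc n * (\<Sum>i<Suc n. (norm (v i))\<^sup>2)"
    using Suc by (simp add: sum.distrib sum_distrib_left[symmetric] card_Pow algebra_simps)
  finally show ?case .
qed

text \<open>With A, B the squared norms and c the inner product, the sum equals 2 (A + B)^2 + 8 c^2,
  and c^2 \<le> A B by Cauchy-Schwarz.\<close>

lemma norm_parallelogram_4:
  fixes X v :: "'b::real_inner"
  shows "norm (X - v) ^ 4 + norm (X + v) ^ 4 \<le> 2 * norm X ^ 4 + 12 * (norm X)\<^sup>2 * (norm v)\<^sup>2 + 2 * norm v ^ 4"
proof -
  define A B c where "A = (norm X)\<^sup>2" and "B = (norm v)\<^sup>2" and "c = X \<bullet> v"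
  have 1: "(norm (X - v))\<^sup>2 = A + B - 2 * c" "(norm (X + v))\<^sup>2 = A + B + 2 * c"
    unfolding A_def B_def c_def by (simp_all add: power2_norm_eq_inner algebra_simps inner_commute)
  have "c\<^sup>2 \<le> A * B"
    using power_mono[OF Cauchy_Schwarz_ineq2[of X v], of 2] unfolding A_def B_def c_def
    by (simp add: power_mult_distrib)
  moreover have "norm (X - v) ^ 4 + norm (X + v) ^ 4 = (A + B - 2 * c)\<^sup>2 + (A + B + 2 * c)\<^sup>2"
    unfolding 1[symmetric] by simp
  moreover have "2 * norm X ^ 4 + 12 * (norm X)\<^sup>2 * (norm v)\<^sup>2 + 2 * norm v ^ 4 = 2 * A\<^sup>2 + 12 * A * B + 2 * B\<^sup>2"
    unfolding A_def B_def by simp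
  ultimately show ?thesis by (simp add: power2_eq_square algebra_simps)
qed

text \<open>The constant 3 survives the addition of one more sign because 6 s^2 + 12 s w + 2 w^2
  \<le> 6 (s + w)^2.\<close>

lemma rademacher_fourth_moment:
  fixes v :: "nat \<Rightarrow> 'b::real_inner"
  shows "(\<Sum>S\<in>Pow {..<n}. norm (\<Sum>i<n. rsign S i *\<^sub>R v i) ^ 4) \<le> 2 ^ n * (3 * (\<Sum>i<n. (norm (v i))\<^sup>2)\<^sup>2)"
proof (induction n)
  case 0
  then show ?case by simp
next
  case (Suc n)
  define X where "X S = (\<Sum>i<n. rsign S i *\<^sub>R v i)" for S
  define s where "s = (\<Sum>i<n. (norm (v i))\<^sup>2)"
  define w where "w = (norm (v n))\<^sup>2"
  have w4: "norm (v n) ^ 4 = w\<^sup>2" unfolding w_def by simp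
  have "(\<Sum>S\<in>Pow {..<Suc n}. norm (\<Sum>i<Suc n. rsign S i *\<^sub>R v i) ^ 4)
    \<le> (\<Sum>S\<in>Pow {..<n}. 2 * norm (X S) ^ 4 + 12 * w * (norm (X S))\<^sup>2 + 2 * w\<^sup>2)"
    unfolding sum_Pow_lessThan_Suc
  proof (rule sum_mono)
    fix S assume "S \<in> Pow {..<n}"
    note st = rsign_sum_step[OF this, of v]
    show "norm (\<Sum>i<Suc n. rsign S i *\<^sub>R v i) ^ 4 + norm (\<Sum>i<Suc n. rsign (insert n S) i *\<^sub>R v i) ^ 4
      \<le> 2 * norm (X S) ^ 4 + 12 * w * (norm (X S))\<^sup>2 + 2 * w\<^sup>2"
      using norm_parallelogram_4[of "X S" "v n"]
      unfolding st X_def[symmetric] w4 w_def[symmetric] by (simp add: algebra_simps)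
  qed
  also have "\<dots> = 2 * (\<Sum>S\<in>Pow {..<n}. norm (X S) ^ 4) + 12 * w * (2 ^ n * s) + 2 ^ n * (2 * w\<^sup>2)"
    using rademacher_second_moment[of v n, folded X_def s_def]
    by (simp add: sum.distrib sum_distrib_left[symmetric] card_Pow)
  also have "\<dots> \<le> 2 * (2 ^ n * (3 * s\<^sup>2)) + 12 * w * (2 ^ n * s) + 2 ^ n * (2 * w\<^sup>2)"
    using Suc unfolding X_def s_def by simp
  also have "\<dots> = 2 ^ Suc n * (3 * (s + w)\<^sup>2 - 2 * w\<^sup>2)"
    by (simp add: power2_eq_square algebra_simps)
  also have "\<dots> \<le> 2 ^ Suc n * (3 * (s + w)\<^sup>2)" by simp
  finally show ?case unfolding s_def w_def by simp
qed

text \<open>Sum the pointwise bound \<open>y \<ge> 3/2 y\<^sup>2 - 1/2 y\<^sup>4\<close> at \<open>y = |\<Sum> \<plusminus> v i| / (\<surd>3 |v|)\<close>.\<close>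

lemma khinchine_L1:
  fixes v :: "nat \<Rightarrow> 'b::real_inner"
  shows "2 ^ n * sqrt (\<Sum>i<n. (norm (v i))\<^sup>2) \<le> sqrt 3 * (\<Sum>S\<in>Pow {..<n}. norm (\<Sum>i<n. rsign S i *\<^sub>R v i))"
proof -
  define X where "X S = norm (\<Sum>i<n. rsign S i *\<^sub>R v i)" for S
  define q where "q = (\<Sum>i<n. (norm (v i))\<^sup>2)"
  have q0: "0 \<le> q" unfolding q_def by (simp add: sum_nonneg)
  show ?thesis
  proof (cases "q = 0")
    case True
    then show ?thesis unfolding q_def[symmetric] by (simp add: sum_nonneg)
  next
    case False
    then have q: "0 < q" using q0 by simp
    define l where "l = sqrt (3 * q)"
    have l: "0 < l" "l\<^sup>2 = 3 * q" using q unfolding l_def by simp_all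
    have pt: "3 / 2 * (y\<^sup>2) - 1 / 2 * y ^ 4 \<le> y" if "0 \<le> y" for y :: real
    proof -
      have "0 \<le> y * ((y - 1)\<^sup>2 * (y + 2))" using that by simp
      then show ?thesis by (simp add: power2_eq_square power4_eq_xxxx algebra_simps)
    qed
    have "(\<Sum>S\<in>Pow {..<n}. X S / l) \<ge> (\<Sum>S\<in>Pow {..<n}. 3 / 2 * (X S / l)\<^sup>2 - 1 / 2 * (X S / l) ^ 4)"
      using l by (intro sum_mono pt) (simp add: X_def)
    also have "(\<Sum>S\<in>Pow {..<n}. 3 / 2 * (X S / l)\<^sup>2 - 1 / 2 * (X S / l) ^ 4)
       = 3 / 2 / l\<^sup>2 * (\<Sum>S\<in>Pow {..<n}. (X S)\<^sup>2) - 1 / 2 / l ^ 4 * (\<Sum>S\<in>Pow {..<n}. X S ^ 4)"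
      by (simp add: sum_subtractf sum_distrib_left power_divide)
    finally have 1: "3 / 2 / l\<^sup>2 * (\<Sum>S\<in>Pow {..<n}. (X S)\<^sup>2) - 1 / 2 / l ^ 4 * (\<Sum>S\<in>Pow {..<n}. X S ^ 4)
       \<le> (\<Sum>S\<in>Pow {..<n}. X S) / l" by (simp add: sum_divide_distrib)
    have l4: "l ^ 4 = 9 * q\<^sup>2" using l(2) by (simp add: power4_eq_xxxx power2_eq_square)
    have "1 / 2 / l ^ 4 * (\<Sum>S\<in>Pow {..<n}. X S ^ 4) \<le> 1 / 2 / l ^ 4 * (2 ^ n * (3 * q\<^sup>2))"
      using rademacher_fourth_moment[of v n] l unfolding X_def q_def by (intro mult_left_mono) auto
    also have "\<dots> = 2 ^ n / 6" unfolding l4 using q by (simp add: field_simps)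
    finally have 2: "1 / 2 / l ^ 4 * (\<Sum>S\<in>Pow {..<n}. X S ^ 4) \<le> 2 ^ n / 6" .
    have 3: "3 / 2 / l\<^sup>2 * (\<Sum>S\<in>Pow {..<n}. (X S)\<^sup>2) = 2 ^ n / 2"
      using rademacher_second_moment[of v n] q unfolding X_def q_def[symmetric] l(2) by simp
    have "2 ^ n / 3 \<le> (\<Sum>S\<in>Pow {..<n}. X S) / l" using 1 2 3 by linarith
    then have "2 ^ n / 3 * l \<le> (\<Sum>S\<in>Pow {..<n}. X S)" using l by (simp add: pos_le_divide_eq)
    then have "sqrt 3 * (2 ^ n / 3 * l) \<le> sqrt 3 * (\<Sum>S\<in>Pow {..<n}. X S)" by (intro mult_left_mono) auto
    moreover have "sqrt 3 * (2 ^ n / 3 * l) = 2 ^ n * sqrt q"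
    proof -
      have "sqrt 3 * l = 3 * sqrt q" unfolding l_def by (simp add: real_sqrt_mult)
      then show ?thesis by (simp add: field_simps)
    qed
    ultimately have "2 ^ n * sqrt q \<le> sqrt 3 * (\<Sum>S\<in>Pow {..<n}. X S)" by linarith
    then show ?thesis unfolding X_def q_def .
  qed
qed

text \<open>Let b be the Rademacher coefficients of a and X the Rademacher sum with these
  coefficients. The average of a X is q, the squared l2 norm of b; it is at most the average of |X|
  \<le> (1 + X^2) / 2, that is (1 + q) / 2, so q \<le> 1.\<close>

lemma rademacher_bessel:
  assumes a: "\<And>S. S \<in> Pow {..<n} \<Longrightarrow> \<bar>a S\<bar> \<le> (1::real)"
  shows "L2_set (\<lambda>i. (\<Sum>S\<in>Pow {..<n}. a S * rsign S i) / 2 ^ n) {..<n} \<le> 1"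
proof -
  define b where "b i = (\<Sum>S\<in>Pow {..<n}. a S * rsign S i) / 2 ^ n" for i
  define X where "X S = (\<Sum>i<n. rsign S i *\<^sub>R b i)" for S
  define q where "q = (\<Sum>i<n. (b i)\<^sup>2)"
  have q0: "0 \<le> q" unfolding q_def by (simp add: sum_nonneg)
  have sm: "(\<Sum>S\<in>Pow {..<n}. (X S)\<^sup>2) = 2 ^ n * q"
    using rademacher_second_moment[of b n] unfolding X_def q_def by simp
  have "2 ^ n * q = (\<Sum>i<n. (\<Sum>S\<in>Pow {..<n}. a S * rsign S i) * b i)"
    unfolding q_def power2_eq_square sum_distrib_left by (simp add: b_def)
  also have "\<dots> = (\<Sum>S\<in>Pow {..<n}. a S * X S)"
    unfolding X_def sum_distrib_left sum_distrib_right by (subst sum.swap) (simp add: mult.assoc)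
  also have "\<dots> \<le> (\<Sum>S\<in>Pow {..<n}. \<bar>X S\<bar>)"
  proof (rule sum_mono)
    fix S assume "S \<in> Pow {..<n}"
    then have "\<bar>a S * X S\<bar> \<le> 1 * \<bar>X S\<bar>" using a unfolding abs_mult by (intro mult_right_mono) auto
    then show "a S * X S \<le> \<bar>X S\<bar>" by simp
  qed
  also have "\<dots> \<le> (\<Sum>S\<in>Pow {..<n}. (1 + (X S)\<^sup>2) / 2)"
  proof (rule sum_mono)
    fix S
    have "0 \<le> (\<bar>X S\<bar> - 1)\<^sup>2" by simp
    then show "\<bar>X S\<bar> \<le> (1 + (X S)\<^sup>2) / 2" by (simp add: power2_diff)
  qed
  also have "\<dots> = (2 ^ n + 2 ^ n * q) / 2"
    unfolding sum_divide_distrib[symmetric] sum.distrib sm by (simp add: card_Pow)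
  finally have "2 ^ n * q \<le> 2 ^ n" by simp
  then have "q \<le> 1" by simp
  then show ?thesis unfolding L2_set_def b_def[symmetric] q_def by simp
qed

subsection \<open>Gram-Schmidt for Gram matrices\<close>

text \<open>If \<open>A k l\<close> is the inner product of vectors h_k and h_l, this is the inner
  product of the combinations with coefficients b and c. Working with coefficients allows forms on
  function spaces that are only semidefinite and not tied to a type class.\<close>

definition gram_form :: "(nat \<Rightarrow> nat \<Rightarrow> real) \<Rightarrow> nat \<Rightarrow> (nat \<Rightarrow> real) \<Rightarrow> (nat \<Rightarrow> real) \<Rightarrow> real" where
  "gram_form A n b c = (\<Sum>k<n. \<Sum>l<n. b k * c l * A k l)"

lemma gram_form_add_left: "gram_form A n (\<lambda>k. b k + b' k) c = gram_form A n b c + gram_form A n b' c"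
  by (simp add: gram_form_def distrib_right sum.distrib)

lemma gram_form_add_right: "gram_form A n b (\<lambda>k. c k + c' k) = gram_form A n b c + gram_form A n b c'"
  by (simp add: gram_form_def distrib_left distrib_right sum.distrib)

lemma gram_form_scale_left: "gram_form A n (\<lambda>k. r * b k) c = r * gram_form A n b c"
  by (simp add: gram_form_def sum_distrib_left mult.assoc)

lemma gram_form_scale_right: "gram_form A n b (\<lambda>k. r * c k) = r * gram_form A n b c"
  by (simp add: gram_form_def sum_distrib_left mult_ac)

lemma gram_form_sum_left: "gram_form A n (\<lambda>k. \<Sum>j<(m::nat). f j k) c = (\<Sum>j<m. gram_form A n (f j) c)"
  by (induction m) (simp_all add: gram_form_add_left gram_form_def)

lemma gram_form_sum_right: "gram_form A n b (\<lambda>k. \<Sum>j<(m::nat). f j k) = (\<Sum>j<m. gram_form A n b (f j))"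
  by (induction m) (simp_all add: gram_form_add_right gram_form_def)

lemma gram_form_commute:
  assumes "\<And>k l. k < n \<Longrightarrow> l < n \<Longrightarrow> A k l = A l k"
  shows "gram_form A n b c = gram_form A n c b"
  unfolding gram_form_def by (subst sum.swap) (auto intro!: sum.cong simp: assms)

text \<open>The coefficient vectors are kept triangular: the new vector then has coefficient 1 at
  its own index, so it is nonzero and strict positivity permits its normalisation.\<close>

lemma gram_schmidt:
  assumes sym: "\<And>k l. k < n \<Longrightarrow> l < n \<Longrightarrow> A k l = A l k"
    and pos: "\<And>b. \<exists>k<n. b k \<noteq> 0 \<Longrightarrow> 0 < gram_form A n b b"
  obtains c where "\<And>i j. i < n \<Longrightarrow> j < n \<Longrightarrow> gram_form A n (c i) (c j) = (if i = j then 1 else 0)"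
proof -
  have comm: "gram_form A n b c = gram_form A n c b" for b c
    by (rule gram_form_commute) (rule sym)
  define P where "P m c \<longleftrightarrow> (\<forall>i<m. \<forall>k. i < k \<longrightarrow> c i k = 0) \<and>
        (\<forall>i<m. \<forall>j<m. gram_form A n (c i) (c j) = (if i = j then 1 else 0))" for m c
  have "\<exists>c. P m c" if "m \<le> n" for m
    using that
  proof (induction m)
    case 0
    then show ?case by (simp add: P_def)
  next
    case (Suc m)
    from Suc.IH[OF Suc_leD[OF Suc.prems]] obtain c where c: "P m c" by blast
    have tri: "c i k = 0" if "i < m" "i < k" for i k using c that by (simp add: P_def)
    have orth: "gram_form A n (c i) (c j) = (if i = j then 1 else 0)" if "i < m" "j < m" for i j
      using c that by (simp add: P_def)
    define e where "e k = (if k = m then 1 else 0 :: real)" for k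
    define u where "u k = e k + (\<Sum>j<m. - gram_form A n e (c j) * c j k)" for k
    have um: "u m = 1" unfolding u_def e_def using tri by simp
    have utri: "u k = 0" if "m < k" for k unfolding u_def e_def using tri that by simp
    have u0: "gram_form A n u (c i) = 0" if "i < m" for i
    proof -
      have "gram_form A n u (c i) = gram_form A n e (c i) + (\<Sum>j<m. - gram_form A n e (c j) * gram_form A n (c j) (c i))"
        unfolding u_def gram_form_add_left gram_form_sum_left gram_form_scale_left ..
      also have "(\<Sum>j<m. - gram_form A n e (c j) * gram_form A n (c j) (c i))
          = (\<Sum>j<m. if j = i then - gram_form A n e (c j) else 0)"
        using orth that by (intro sum.cong) auto
      also have "\<dots> = - gram_form A n e (c i)" using that by simp
      finally show ?thesis by simp
    qed
    have upos: "0 < gram_form A n u u" using um Suc.prems by (intro pos exI[of _ m]) auto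
    define v where "v k = (1 / sqrt (gram_form A n u u)) * u k" for k
    have vv: "gram_form A n v v = 1"
      unfolding v_def gram_form_scale_left gram_form_scale_right using upos by simp
    have vc: "gram_form A n v (c i) = 0" if "i < m" for i
      unfolding v_def gram_form_scale_left using u0[OF that] by simp
    define c' where "c' i = (if i < m then c i else v)" for i
    have "P (Suc m) c'"
      unfolding P_def
    proof (intro conjI allI impI)
      fix i k assume "i < Suc m" "i < k"
      then show "c' i k = 0" unfolding c'_def v_def using tri utri by (auto simp: less_Suc_eq)
    next
      fix i j assume ij: "i < Suc m" "j < Suc m"
      show "gram_form A n (c' i) (c' j) = (if i = j then 1 else 0)"
      proof (cases "i < m")
        case True
        then show ?thesis using ij orth[of i j] vc[of i] comm[of "c i" v] unfolding c'_def
          by (cases "j < m") (simp_all add: less_Suc_eq)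
      next
        case False
        then show ?thesis using ij vv vc[of j] unfolding c'_def
          by (cases "j < m") (simp_all add: less_Suc_eq)
      qed
    qed
    then show ?case by blast
  qed
  then obtain c where "P n c" by blast
  then show thesis using that[of c] by (simp add: P_def)
qed

subsection \<open>Square functions in subspaces of L1\<close>

lemma L2_set_scale: "L2_set (\<lambda>i. r * b i) A = \<bar>r\<bar> * L2_set b A"
  by (simp add: L2_set_def power_mult_distrib sum_distrib_left[symmetric] real_sqrt_mult)

lemma L2_set_Suc: "L2_set b {..<Suc n} = sqrt ((L2_set b {..<n})\<^sup>2 + (b n)\<^sup>2)"
  by (simp add: L2_set_def sum_nonneg)

lemma L2_set_eq_0D: "L2_set b {..<n::nat} = 0 \<Longrightarrow> i < n \<Longrightarrow> b i = 0"
  using member_le_L2_set[of "{..<n}" i "\<lambda>i. \<bar>b i\<bar>"] by (simp add: L2_set_def)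

definition L1_norm :: "'m measure \<Rightarrow> ('m \<Rightarrow> 'b::{banach,second_countable_topology}) \<Rightarrow> real" where
  "L1_norm M f = (\<integral>t. norm (f t) \<partial>M)"

definition comb :: "nat \<Rightarrow> (nat \<Rightarrow> real) \<Rightarrow> (nat \<Rightarrow> 'm \<Rightarrow> 'b::real_vector) \<Rightarrow> 'm \<Rightarrow> 'b" where
  "comb n b f = (\<lambda>t. \<Sum>i<n. b i *\<^sub>R f i t)"

definition square_fun :: "nat \<Rightarrow> (nat \<Rightarrow> 'm \<Rightarrow> 'b::real_normed_vector) \<Rightarrow> 'm \<Rightarrow> real" where
  "square_fun n f = (\<lambda>t. L2_set (\<lambda>i. norm (f i t)) {..<n})"

lemma square_fun_nonneg: "0 \<le> square_fun n f t"
  by (simp add: square_fun_def)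

lemma norm_le_square_fun: "i < n \<Longrightarrow> norm (f i t) \<le> square_fun n f t"
  unfolding square_fun_def by (rule member_le_L2_set[of _ _ "\<lambda>i. norm (f i t)"]) auto

lemma norm_comb_le: "norm (comb n b f t) \<le> L2_set b {..<n} * square_fun n f t"
proof -
  have "norm (comb n b f t) \<le> (\<Sum>i<n. \<bar>b i\<bar> * \<bar>norm (f i t)\<bar>)"
    unfolding comb_def by (rule order_trans[OF norm_sum]) simp
  also have "\<dots> \<le> L2_set b {..<n} * square_fun n f t"
    unfolding square_fun_def by (rule L2_set_mult_ineq)
  finally show ?thesis .
qed

lemma sum_norm_le_square_fun: "(\<Sum>i<n. norm (f i t)) \<le> sqrt (real n) * square_fun n f t"
  using L2_set_mult_ineq[of "\<lambda>i. 1" "\<lambda>i. norm (f i t)" "{..<n}"]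
  by (simp add: square_fun_def L2_set_def)

lemma comb_comb: "comb n b (\<lambda>i. comb m (c i) f) = comb m (\<lambda>k. \<Sum>i<n. b i * c i k) f"
  unfolding comb_def
  by (simp add: scaleR_sum_right scaleR_sum_left) (subst sum.swap, simp)

lemma comb_scale: "comb n b (\<lambda>i t. r *\<^sub>R f i t) = (\<lambda>t. r *\<^sub>R comb n b f t)"
  by (simp add: comb_def scaleR_sum_right mult.commute)

lemma square_fun_scale: "square_fun n (\<lambda>i t. r *\<^sub>R f i t) = (\<lambda>t. \<bar>r\<bar> * square_fun n f t)"
  by (simp add: square_fun_def L2_set_scale)

lemma L1_norm_scale:
  fixes f :: "'m \<Rightarrow> 'b::{banach,second_countable_topology}"
  shows "L1_norm M (\<lambda>t. r *\<^sub>R f t) = \<bar>r\<bar> * L1_norm M f"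
  by (simp add: L1_norm_def)

lemma L1_norm_nonneg: "0 \<le> L1_norm M f"
  by (simp add: L1_norm_def)

lemma L1_norm_add:
  assumes "integrable M f" "integrable M g"
  shows "L1_norm M (\<lambda>t. f t + g t) \<le> L1_norm M f + L1_norm M g"
proof -
  have "L1_norm M (\<lambda>t. f t + g t) \<le> (\<integral>t. norm (f t) + norm (g t) \<partial>M)"
    unfolding L1_norm_def using assms by (intro integral_mono norm_triangle_ineq) auto
  also have "\<dots> = L1_norm M f + L1_norm M g" unfolding L1_norm_def using assms by simp
  finally show ?thesis .
qed

lemma integrable_square_fun:
  fixes f :: "nat \<Rightarrow> 'm \<Rightarrow> 'b::{banach,second_countable_topology}"
  assumes "\<And>i. i < n \<Longrightarrow> integrable M (f i)"
  shows "integrable M (square_fun n f)"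
proof (rule Bochner_Integration.integrable_bound)
  show "integrable M (\<lambda>t. \<Sum>i<n. norm (f i t))" using assms by auto
  have [measurable]: "i < n \<Longrightarrow> f i \<in> borel_measurable M" for i using assms by auto
  show "square_fun n f \<in> borel_measurable M" unfolding square_fun_def L2_set_def by measurable
  show "AE t in M. norm (square_fun n f t) \<le> norm (\<Sum>i<n. norm (f i t))"
    using L2_set_le_sum[of "{..<n}" "\<lambda>i. norm (f i _)"] unfolding square_fun_def
    by (auto simp: sum_nonneg)
qed

text \<open>Only real scalars act, since the intended \<open>H\<close> is the image of E under a
  merely real-linear map into \<open>complex\<close>-valued functions. Elements are functions rather
  than classes, hence independence below is tested by \<open>L1_norm\<close>.\<close>

locale L1_subspace =
  fixes M :: "'m measure" and H :: "('m \<Rightarrow> 'b::{real_inner,banach,second_countable_topology}) set"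
  assumes H_integrable: "f \<in> H \<Longrightarrow> integrable M f"
    and H_zero: "(\<lambda>t. 0) \<in> H"
    and H_add: "f \<in> H \<Longrightarrow> g \<in> H \<Longrightarrow> (\<lambda>t. f t + g t) \<in> H"
    and H_scale: "f \<in> H \<Longrightarrow> (\<lambda>t. r *\<^sub>R f t) \<in> H"
begin

lemma comb_in_H: "(\<And>i. i < n \<Longrightarrow> f i \<in> H) \<Longrightarrow> comb n b f \<in> H"
  unfolding comb_def by (induction n) (auto intro!: H_zero H_add H_scale)

definition independent_system :: "nat \<Rightarrow> (nat \<Rightarrow> 'm \<Rightarrow> 'b) \<Rightarrow> bool" where
  "independent_system n h \<longleftrightarrow> (\<forall>i<n. h i \<in> H) \<and> (\<forall>b. L1_norm M (comb n b h) = 0 \<longrightarrow> (\<forall>i<n. b i = 0))"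

text \<open>Gram-Schmidt for the form with density 1 / W. The bound by W makes the integrands at
  most a multiple of one |h k|, hence integrable. It also forces every \<open>h i\<close> to vanish
  where W = 0, so the value 0 of a division by zero loses nothing and the form is definite by
  independence.\<close>

lemma orthonormalization:
  assumes h: "independent_system n h"
    and W: "W \<in> borel_measurable M" "\<And>t. 0 \<le> W t"
    and bound: "\<And>i t. i < n \<Longrightarrow> norm (h i t) \<le> C * W t"
  obtains c where "\<And>b. integrable M (\<lambda>t. (norm (comb n b (\<lambda>i. comb n (c i) h) t))\<^sup>2 / W t)"
    "\<And>b. (\<integral>t. (norm (comb n b (\<lambda>i. comb n (c i) h) t))\<^sup>2 / W t \<partial>M) = (L2_set b {..<n})\<^sup>2"
proof -
  have hH: "h i \<in> H" if "i < n" for i using h that by (simp add: independent_system_def)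
  have hint: "integrable M (h i)" if "i < n" for i using H_integrable hH that by blast
  have [measurable]: "h i \<in> borel_measurable M" if "i < n" for i using hint[OF that] by auto
  note W(1)[measurable]
  define A where "A k l = (\<integral>t. (h k t \<bullet> h l t) / W t \<partial>M)" for k l
  have Aint: "integrable M (\<lambda>t. (h k t \<bullet> h l t) / W t)" if kl: "k < n" "l < n" for k l
  proof (rule Bochner_Integration.integrable_bound)
    show "integrable M (\<lambda>t. \<bar>C\<bar> * norm (h k t))" using hint kl by auto
    show "(\<lambda>t. (h k t \<bullet> h l t) / W t) \<in> borel_measurable M" using kl by measurable
    have "norm ((h k t \<bullet> h l t) / W t) \<le> norm (\<bar>C\<bar> * norm (h k t))" for t
    proof (cases "W t = 0")
      case False
      then have Wt: "0 < W t" using W(2)[of t] by simp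
      have "\<bar>h k t \<bullet> h l t\<bar> \<le> norm (h k t) * norm (h l t)" by (rule Cauchy_Schwarz_ineq2)
      also have "\<dots> \<le> norm (h k t) * (\<bar>C\<bar> * W t)"
        using bound[OF kl(2), of t] Wt by (intro mult_left_mono order_trans[OF bound[OF kl(2), of t]] mult_right_mono) auto
      finally show ?thesis using Wt by (simp add: field_simps)
    qed simp
    then show "AE t in M. norm ((h k t \<bullet> h l t) / W t) \<le> norm (\<bar>C\<bar> * norm (h k t))" by simp
  qed
  have expand: "(norm (comb n b h t))\<^sup>2 / W t = (\<Sum>k<n. \<Sum>l<n. b k * b l * ((h k t \<bullet> h l t) / W t))" for b t
    unfolding comb_def power2_norm_eq_inner
    by (simp add: inner_sum_left inner_sum_right sum_divide_distrib mult.assoc sum_distrib_left)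
      (subst sum.swap, simp add: inner_commute mult.left_commute)
  have row: "integrable M (\<lambda>t. \<Sum>l<n. b k * b l * ((h k t \<bullet> h l t) / W t))" if "k < n" for b k
    by (rule Bochner_Integration.integrable_sum, rule integrable_mult_right, rule Aint) (simp_all add: that)
  have Qint: "integrable M (\<lambda>t. (norm (comb n b h t))\<^sup>2 / W t)" for b
    unfolding expand by (rule Bochner_Integration.integrable_sum, rule row) simp
  have Q: "(\<integral>t. (norm (comb n b h t))\<^sup>2 / W t \<partial>M) = gram_form A n b b" for b
  proof -
    have "(\<integral>t. (norm (comb n b h t))\<^sup>2 / W t \<partial>M) = (\<Sum>k<n. \<integral>t. (\<Sum>l<n. b k * b l * ((h k t \<bullet> h l t) / W t)) \<partial>M)"
      unfolding expand by (rule Bochner_Integration.integral_sum, rule row) simp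
    also have "\<dots> = (\<Sum>k<n. \<Sum>l<n. \<integral>t. b k * b l * ((h k t \<bullet> h l t) / W t) \<partial>M)"
      by (intro sum.cong refl Bochner_Integration.integral_sum integrable_mult_right Aint) simp_all
    finally show ?thesis unfolding gram_form_def A_def by (simp only: integral_mult_right_zero)
  qed
  have pos: "0 < gram_form A n b b" if b: "\<exists>k<n. b k \<noteq> 0" for b
  proof (rule ccontr)
    assume "\<not> ?thesis"
    moreover have "0 \<le> (\<integral>t. (norm (comb n b h t))\<^sup>2 / W t \<partial>M)" using W(2) by simp
    ultimately have "(\<integral>t. (norm (comb n b h t))\<^sup>2 / W t \<partial>M) = 0" unfolding Q by simp
    then have "AE t in M. (norm (comb n b h t))\<^sup>2 / W t = 0"
      using integral_nonneg_eq_0_iff_AE[OF Qint[of b]] W(2) by simp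
    then have "AE t in M. norm (comb n b h t) = 0"
    proof (rule AE_mp, intro AE_I2 impI)
      fix t assume z: "(norm (comb n b h t))\<^sup>2 / W t = 0"
      show "norm (comb n b h t) = 0"
      proof (cases "W t = 0")
        case True
        then have "h i t = 0" if "i < n" for i using bound[OF that, of t] by simp
        then show ?thesis by (simp add: comb_def)
      qed (use z in simp)
    qed
    then have "L1_norm M (comb n b h) = 0" unfolding L1_norm_def by (rule integral_eq_zero_AE)
    then show False using h b by (auto simp: independent_system_def)
  qed
  obtain c where c: "\<And>i j. i < n \<Longrightarrow> j < n \<Longrightarrow> gram_form A n (c i) (c j) = (if i = j then 1 else 0)"
    by (rule gram_schmidt[of n A]) (auto simp: A_def inner_commute pos)
  show thesis
  proof (rule that[of c])
    fix b
    show "integrable M (\<lambda>t. (norm (comb n b (\<lambda>i. comb n (c i) h) t))\<^sup>2 / W t)"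
      unfolding comb_comb by (rule Qint)
    have "(\<integral>t. (norm (comb n b (\<lambda>i. comb n (c i) h) t))\<^sup>2 / W t \<partial>M)
      = (\<Sum>i<n. b i * (\<Sum>j<n. b j * gram_form A n (c i) (c j)))"
      unfolding comb_comb Q gram_form_sum_left gram_form_sum_right gram_form_scale_left gram_form_scale_right
      by (simp add: sum_distrib_left)
    also have "\<dots> = (\<Sum>i<n. b i * (\<Sum>j<n. if j = i then b j else 0))"
      using c by (intro sum.cong arg_cong2[of _ _ _ _ "(*)"] refl) auto
    also have "\<dots> = (L2_set b {..<n})\<^sup>2"
      by (simp add: L2_set_def sum_nonneg power2_eq_square)
    finally show "(\<integral>t. (norm (comb n b (\<lambda>i. comb n (c i) h) t))\<^sup>2 / W t \<partial>M) = (L2_set b {..<n})\<^sup>2" .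
  qed
qed

text \<open>The system is orthonormal for the weight \<open>R = \<Sum> |h i|\<close>; then \<open>|g| \<le> C |b| R\<close> pointwise, hence
  \<open>|b|\<^sup>2 = \<integral> |g|\<^sup>2 / R \<le> C |b| \<integral> |g|\<close>.\<close>

lemma coefficient_bounded_system:
  assumes "independent_system n h0"
  obtains h C where "\<And>i. i < n \<Longrightarrow> h i \<in> H" "0 < C"
    "\<And>b. L2_set b {..<n} \<le> C * L1_norm M (comb n b h)"
proof -
  have h0H: "h0 i \<in> H" if "i < n" for i using assms that by (simp add: independent_system_def)
  have h0int: "integrable M (h0 i)" if "i < n" for i using H_integrable h0H that by blast
  define R where "R t = (\<Sum>i<n. norm (h0 i t))" for t
  have Rint: "integrable M R" unfolding R_def using h0int by auto
  have R0: "0 \<le> R t" for t unfolding R_def by (simp add: sum_nonneg)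
  have Rb: "norm (h0 i t) \<le> R t" if "i < n" for i t
    unfolding R_def using that by (intro member_le_sum) auto
  obtain c where cint: "\<And>b. integrable M (\<lambda>t. (norm (comb n b (\<lambda>i. comb n (c i) h0) t))\<^sup>2 / R t)"
    and c: "\<And>b. (\<integral>t. (norm (comb n b (\<lambda>i. comb n (c i) h0) t))\<^sup>2 / R t \<partial>M) = (L2_set b {..<n})\<^sup>2"
    by (rule orthonormalization[OF assms, of R 1]) (use Rint R0 Rb in auto)
  define h where "h i = comb n (c i) h0" for i
  have hH: "h i \<in> H" for i unfolding h_def by (rule comb_in_H) (rule h0H)
  define D where "D = (\<Sum>i<n. \<Sum>k<n. \<bar>c i k\<bar>)"
  have hb: "norm (h i t) \<le> (\<Sum>k<n. \<bar>c i k\<bar>) * R t" for i t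
  proof -
    have "norm (h i t) \<le> (\<Sum>k<n. \<bar>c i k\<bar> * norm (h0 k t))"
      unfolding h_def comb_def by (rule order_trans[OF norm_sum]) simp
    also have "\<dots> \<le> (\<Sum>k<n. \<bar>c i k\<bar> * R t)" using Rb by (intro sum_mono mult_left_mono) auto
    finally show ?thesis by (simp add: sum_distrib_right)
  qed
  have sb: "square_fun n h t \<le> D * R t" for t
  proof -
    have "square_fun n h t \<le> (\<Sum>i<n. norm (h i t))" unfolding square_fun_def by (rule L2_set_le_sum) auto
    also have "\<dots> \<le> D * R t" unfolding D_def sum_distrib_right[of _ _ "R t"] using hb
      by (intro sum_mono) (simp add: sum_distrib_right)
    finally show ?thesis .
  qed
  have D0: "0 \<le> D" unfolding D_def by (simp add: sum_nonneg)
  show thesis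
  proof (rule that[of h "D + 1"])
    fix b
    let ?q = "L2_set b {..<n}" and ?g = "comb n b h"
    have gint: "integrable M ?g" using H_integrable comb_in_H hH by blast
    have "?q\<^sup>2 = (\<integral>t. (norm (?g t))\<^sup>2 / R t \<partial>M)" using c[of b] unfolding h_def[symmetric] by simp
    also have "\<dots> \<le> (\<integral>t. (D + 1) * ?q * norm (?g t) \<partial>M)"
    proof (rule integral_mono)
      show "integrable M (\<lambda>t. (norm (?g t))\<^sup>2 / R t)" using cint[of b] unfolding h_def[symmetric] .
      show "integrable M (\<lambda>t. (D + 1) * ?q * norm (?g t))" using gint by auto
      fix t
      have "norm (?g t) \<le> ?q * square_fun n h t" by (rule norm_comb_le)
      also have "\<dots> \<le> ?q * (D * R t)" using sb by (intro mult_left_mono) auto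
      also have "\<dots> \<le> (D + 1) * ?q * R t" using R0[of t] by (simp add: algebra_simps)
      finally have g: "norm (?g t) \<le> (D + 1) * ?q * R t" .
      show "(norm (?g t))\<^sup>2 / R t \<le> (D + 1) * ?q * norm (?g t)"
      proof (cases "R t = 0")
        case False
        then have "0 < R t" using R0[of t] by simp
        then show ?thesis using mult_right_mono[OF g, of "norm (?g t)"]
          by (simp add: power2_eq_square divide_simps mult_ac)
      qed (use D0 in simp)
    qed
    also have "\<dots> = ?q * ((D + 1) * L1_norm M ?g)" unfolding L1_norm_def by simp
    finally have le: "?q * ?q \<le> ?q * ((D + 1) * L1_norm M ?g)" by (simp add: power2_eq_square)
    show "?q \<le> (D + 1) * L1_norm M ?g"
    proof (cases "?q = 0")
      case True
      then show ?thesis using D0 L1_norm_nonneg[of M ?g] by simp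
    next
      case False
      then have "0 < ?q" using L2_set_nonneg[of b "{..<n}"] by linarith
      then show ?thesis using le by (rule mult_left_le_imp_le[rotated])
    qed
  qed (use D0 hH in auto)
qed

text \<open>The map from n-dimensional l2 to L1 given by b \<mapsto> \<open>comb n b f\<close> is a
  contraction.\<close>

definition hilbertian :: "nat \<Rightarrow> (nat \<Rightarrow> 'm \<Rightarrow> 'b) \<Rightarrow> bool" where
  "hilbertian n f \<longleftrightarrow> (\<forall>i<n. f i \<in> H) \<and> (\<forall>b. L1_norm M (comb n b f) \<le> L2_set b {..<n})"

text \<open>Cauchy-Schwarz in the plane: l + |b m| t \<le> sqrt (l^2 + (b m)^2) sqrt (1 + t^2). The
  renormalisation differs from 1 only by order t^2.\<close>

lemma hilbertian_append:
  assumes f: "hilbertian m f" and g: "g \<in> H" "L1_norm M g \<le> t"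
  shows "hilbertian (Suc m) (\<lambda>i x. (1 / sqrt (1 + t\<^sup>2)) *\<^sub>R (if i < m then f i else g) x)"
proof -
  have fH: "f i \<in> H" if "i < m" for i using f that by (simp add: hilbertian_def)
  have t0: "0 \<le> t" using g(2) L1_norm_nonneg[of M g] by linarith
  define F where "F i = (if i < m then f i else g)" for i
  have FH: "F i \<in> H" for i using fH g unfolding F_def by simp
  have "L1_norm M (comb (Suc m) b (\<lambda>i x. (1 / sqrt (1 + t\<^sup>2)) *\<^sub>R F i x)) \<le> L2_set b {..<Suc m}" for b
  proof -
    let ?l = "L2_set b {..<m}"
    have "comb (Suc m) b F = (\<lambda>x. comb m b f x + b m *\<^sub>R g x)"
      unfolding comb_def F_def by (auto intro!: ext sum.cong)
    then have "L1_norm M (comb (Suc m) b F) \<le> L1_norm M (comb m b f) + L1_norm M (\<lambda>x. b m *\<^sub>R g x)"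
      using L1_norm_add[of M "comb m b f" "\<lambda>x. b m *\<^sub>R g x"] H_integrable comb_in_H[of m f b] fH H_scale[OF g(1)] by simp
    also have "\<dots> \<le> ?l + \<bar>b m\<bar> * t"
      using f g unfolding hilbertian_def L1_norm_scale by (intro add_mono mult_left_mono) auto
    also have "\<dots> \<le> sqrt ((?l\<^sup>2 + (b m)\<^sup>2) * (1 + t\<^sup>2))"
    proof (rule real_le_rsqrt)
      have "0 \<le> (?l * t - \<bar>b m\<bar>)\<^sup>2" by simp
      then show "(?l + \<bar>b m\<bar> * t)\<^sup>2 \<le> (?l\<^sup>2 + (b m)\<^sup>2) * (1 + t\<^sup>2)"
        by (simp add: power2_eq_square algebra_simps)
    qed
    also have "\<dots> = L2_set b {..<Suc m} * sqrt (1 + t\<^sup>2)" unfolding L2_set_Suc by (rule real_sqrt_mult)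
    finally have "L1_norm M (comb (Suc m) b F) \<le> L2_set b {..<Suc m} * sqrt (1 + t\<^sup>2)" .
    moreover have "0 < sqrt (1 + t\<^sup>2)" by (simp add: add_pos_nonneg)
    ultimately show ?thesis unfolding comb_scale L1_norm_scale by (simp add: divide_le_eq)
  qed
  then show ?thesis unfolding hilbertian_def F_def[symmetric] using FH H_scale by simp
qed

text \<open>If the integrals were bounded, a near-maximiser with square function \<open>S\<close> would make the weighted
  form \<open>\<integral> |g|\<^sup>2 / S\<close> (up to a small correction of the weight) comparable with \<open>(\<integral> |g|)\<^sup>2\<close>: the upper bound
  comes from appending a small multiple of \<open>g\<close> to the near-maximiser, the lower bound from Cauchy-Schwarz.
  Long orthonormal systems for this form then contradict the bound.\<close>

theorem square_fun_integral_unbounded: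
  assumes inf: "\<And>n. \<exists>h. independent_system n h"
  shows "\<exists>n f. hilbertian n f \<and> K < (\<integral>t. square_fun n f t \<partial>M)"
proof (rule ccontr)
  assume contra: "\<not> ?thesis"
  define A where "A = {\<integral>t. square_fun n f t \<partial>M | n f. hilbertian n f}"
  define \<sigma> where "\<sigma> = Sup A"
  have bdd: "bdd_above A" by (rule bdd_aboveI[of _ K]) (use contra in \<open>auto simp: A_def not_less\<close>)
  have le\<sigma>: "(\<integral>t. square_fun n f t \<partial>M) \<le> \<sigma>" if "hilbertian n f" for n f
    unfolding \<sigma>_def using that bdd by (intro cSup_upper) (auto simp: A_def)
  have \<sigma>1: "1 \<le> \<sigma>"
  proof -
    obtain h0 where "independent_system 1 h0" using inf by blast
    then obtain h :: "nat \<Rightarrow> 'm \<Rightarrow> 'b" and C where h: "\<And>i. i < 1 \<Longrightarrow> h i \<in> H" "0 < C"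
       "\<And>b. L2_set b {..<1} \<le> C * L1_norm M (comb 1 b h)" by (rule coefficient_bounded_system) blast
    let ?P = "L1_norm M (h 0)"
    have "1 \<le> C * ?P" using h(3)[of "\<lambda>_. 1"] by (simp add: comb_def L2_set_def)
    then have P: "0 < ?P" using h(2) L1_norm_nonneg[of M "h 0"] by (cases "?P = 0") auto
    define f where "f i = (\<lambda>t. (1 / ?P) *\<^sub>R h 0 t)" for i :: nat
    have "L1_norm M (comb 1 b f) = \<bar>b 0\<bar>" for b
      unfolding comb_def f_def using P by (simp add: L1_norm_scale[of M _ "h 0", simplified])
    then have hil: "hilbertian 1 f" unfolding hilbertian_def
      using H_scale[OF h(1)[of 0]] by (simp add: L2_set_def) (simp add: f_def)
    have "(\<integral>t. square_fun 1 f t \<partial>M) = L1_norm M (f 0)" unfolding square_fun_def L1_norm_def by (simp add: L2_set_def)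
    also have "\<dots> = 1" unfolding f_def L1_norm_scale using P by simp
    finally show ?thesis using le\<sigma>[OF hil] by simp
  qed
  \<comment> \<open>An orthonormal system of length n will give sqrt n \<le> 2 \<sigma>^2, which
    this n violates.\<close>
  obtain n :: nat where n: "4 * \<sigma> ^ 4 < real n" using reals_Archimedean2 by blast
  obtain h0 where "independent_system n h0" using inf by blast
  then obtain h C where hH: "\<And>i. i < n \<Longrightarrow> h i \<in> H" and C: "0 < C"
       and hC: "\<And>b. L2_set b {..<n} \<le> C * L1_norm M (comb n b h)" by (rule coefficient_bounded_system) blast
  have hint: "integrable M (h i)" if "i < n" for i using H_integrable hH that by blast
  define R where "R = square_fun n h"
  have Rint: "integrable M R" unfolding R_def by (rule integrable_square_fun) (rule hint)
  have R0: "0 \<le> R t" for t unfolding R_def by (rule square_fun_nonneg)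
  have IR0: "0 \<le> (\<integral>t. R t \<partial>M)" using R0 by simp
  \<comment> \<open>The L1 size of the perturbation, chosen so that the correction d C R of the
    weight has integral at most \<sigma>; the + 1 keeps the denominator positive. The system h comes
    before the near-maximiser because the admissible slack depends on d.\<close>
  define d where "d = \<sigma> / (C * (\<integral>t. R t \<partial>M) + 1)"
  have d0: "0 < d" unfolding d_def using \<sigma>1 C IR0 by (intro divide_pos_pos add_nonneg_pos) auto
  have dC: "d * (C * (\<integral>t. R t \<partial>M)) \<le> \<sigma>"
    unfolding d_def using \<sigma>1 C IR0 by (simp add: divide_le_eq add_nonneg_pos distrib_left)
  \<comment> \<open>The slack has the same order as the growth \<sigma> d^2 / 2 that appending a
    function of norm d can cause.\<close>
  have "\<sigma> - \<sigma> * d\<^sup>2 / 2 < \<sigma>" using d0 \<sigma>1 by simp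
  moreover have "A \<noteq> {}"
    unfolding A_def using L1_norm_scale[of M 0] by (auto simp: hilbertian_def comb_def L1_norm_def intro!: exI[of _ 0])
  ultimately obtain a where "a \<in> A" "\<sigma> - \<sigma> * d\<^sup>2 / 2 < a"
    unfolding \<sigma>_def by (blast elim: less_cSupE)
  then obtain m f where f: "hilbertian m f" and near: "\<sigma> - \<sigma> * d\<^sup>2 / 2 < (\<integral>t. square_fun m f t \<partial>M)"
    unfolding A_def by blast
  have fH: "f i \<in> H" if "i < m" for i using f that by (simp add: hilbertian_def)
  define S where "S = square_fun m f"
  have Sint: "integrable M S" unfolding S_def by (intro integrable_square_fun H_integrable fH)
  have S0: "0 \<le> S t" for t unfolding S_def by (rule square_fun_nonneg)
  \<comment> \<open>The square function S alone may vanish where some \<open>h i\<close> does not.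
    The term d C R dominates every function of L1 norm d in the span of h, which the pointwise
    inequality \<open>pt\<close> needs, and bounds each \<open>h i\<close> by a multiple of
    W.\<close>
  define W where "W t = S t + d * C * R t" for t
  have Wint: "integrable M W" unfolding W_def using Sint Rint by auto
  have W0: "0 \<le> W t" for t unfolding W_def using S0 R0 d0 C by simp
  have IW: "(\<integral>t. W t \<partial>M) \<le> 2 * \<sigma>"
    unfolding W_def using Sint Rint le\<sigma>[OF f] dC unfolding S_def by (simp add: mult.assoc)
  have hW: "norm (h i t) \<le> 1 / (d * C) * W t" if "i < n" for i t
  proof -
    have "norm (h i t) \<le> R t" unfolding R_def using that by (rule norm_le_square_fun)
    also have "\<dots> \<le> 1 / (d * C) * W t" unfolding W_def using d0 C S0[of t] by (simp add: field_simps)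
    finally show ?thesis .
  qed
  have ind: "independent_system n h"
    unfolding independent_system_def
  proof (intro conjI allI impI)
    fix b i assume "L1_norm M (comb n b h) = 0" "i < n"
    then show "b i = 0" using hC[of b] by (intro L2_set_eq_0D[of b n]) (auto intro: antisym)
  qed (rule hH)
  obtain c where cint: "\<And>b. integrable M (\<lambda>t. (norm (comb n b (\<lambda>i. comb n (c i) h) t))\<^sup>2 / W t)"
    and c: "\<And>b. (\<integral>t. (norm (comb n b (\<lambda>i. comb n (c i) h) t))\<^sup>2 / W t \<partial>M) = (L2_set b {..<n})\<^sup>2"
    by (rule orthonormalization[OF ind, of W "1 / (d * C)"]) (use Wint W0 hW in auto)
  define g where "g i = comb n (c i) h" for i
  have gH: "g i \<in> H" for i unfolding g_def using comb_in_H hH by blast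
  have upper: "(\<integral>t. (norm (comb n b g t))\<^sup>2 / W t \<partial>M) \<le> 2 * \<sigma> * (L1_norm M (comb n b g))\<^sup>2" for b
  proof -
    define b' where "b' k = (\<Sum>i<n. b i * c i k)" for k
    define v where "v = comb n b g"
    define P where "P = L1_norm M v"
    have v: "v = comb n b' h" unfolding v_def g_def b'_def by (rule comb_comb)
    have vH: "v \<in> H" unfolding v using comb_in_H hH by blast
    have bP: "L2_set b' {..<n} \<le> C * P" unfolding P_def v by (rule hC)
    have vint: "integrable M (\<lambda>t. (norm (v t))\<^sup>2 / W t)" unfolding v_def g_def by (rule cint)
    show ?thesis
    proof (cases "P = 0")
      case True
      then have "L2_set b' {..<n} = 0" using bP by (intro antisym) auto
      then have "v t = 0" for t using norm_comb_le[of n b' h t] unfolding v by simp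
      then show ?thesis unfolding v_def[symmetric] using \<sigma>1 by simp
    next
      case False
      then have P: "0 < P" using L1_norm_nonneg[of M v] unfolding P_def by simp
      \<comment> \<open>The function v is rescaled to L1 norm d, the size for which both slack and
        weight were prepared.\<close>
      define s where "s = d / P"
      have s0: "0 < s" unfolding s_def using d0 P by simp
      have nsv: "L1_norm M (\<lambda>t. s *\<^sub>R v t) \<le> d"
        unfolding L1_norm_scale P_def[symmetric] s_def using d0 P by simp
      define F where "F i = (if i < m then f i else (\<lambda>t. s *\<^sub>R v t))" for i
      have "hilbertian (Suc m) (\<lambda>i x. (1 / sqrt (1 + d\<^sup>2)) *\<^sub>R F i x)"
        unfolding F_def by (rule hilbertian_append[OF f H_scale[OF vH] nsv])
      from le\<sigma>[OF this] have "(\<integral>t. square_fun (Suc m) F t \<partial>M) / sqrt (1 + d\<^sup>2) \<le> \<sigma>"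
        unfolding square_fun_scale by simp
      moreover have sq0: "0 < sqrt (1 + d\<^sup>2)" by (simp add: add_pos_nonneg)
      ultimately have "(\<integral>t. square_fun (Suc m) F t \<partial>M) \<le> \<sigma> * sqrt (1 + d\<^sup>2)"
        by (simp add: divide_le_eq)
      also have "\<dots> \<le> \<sigma> * (1 + d\<^sup>2 / 2)"
      proof (intro mult_left_mono real_le_lsqrt)
        have "(1 + d\<^sup>2 / 2)\<^sup>2 = 1 + d\<^sup>2 + (d\<^sup>2 / 2)\<^sup>2" by (simp add: power2_eq_square algebra_simps)
        then show "1 + d\<^sup>2 \<le> (1 + d\<^sup>2 / 2)\<^sup>2" by simp
      qed (use \<sigma>1 in auto)
      finally have up: "(\<integral>t. square_fun (Suc m) F t \<partial>M) \<le> \<sigma> * (1 + d\<^sup>2 / 2)" .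
      have FH: "F i \<in> H" if "i < Suc m" for i using fH H_scale[OF vH] that unfolding F_def by simp
      \<comment> \<open>This is S + y^2 / (2 W) \<le> sqrt (S^2 + y^2) for 0 \<le> y \<le> W - S.
        After squaring, with z = y / W, it follows from S / W \<le> 1 - z and z^2 / 4 \<le>
        z.\<close>
      have pt: "S t + s\<^sup>2 / 2 * ((norm (v t))\<^sup>2 / W t) \<le> square_fun (Suc m) F t" for t
      proof -
        define y where "y = s * norm (v t)"
        have y0: "0 \<le> y" unfolding y_def using s0 by simp
        have "norm (v t) \<le> L2_set b' {..<n} * R t" unfolding v R_def by (rule norm_comb_le)
        also have "\<dots> \<le> C * P * R t" using bP R0 by (intro mult_right_mono) auto
        finally have "y \<le> s * (C * P * R t)" unfolding y_def using s0 by simp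
        also have "\<dots> = d * C * R t" unfolding s_def using P by simp
        finally have yW: "y \<le> W t - S t" unfolding W_def by simp
        have SF: "square_fun (Suc m) F t = sqrt ((S t)\<^sup>2 + y\<^sup>2)"
        proof -
          have "L2_set (\<lambda>i. norm (F i t)) {..<m} = S t"
            unfolding S_def square_fun_def by (rule L2_set_cong) (auto simp: F_def)
          then show ?thesis unfolding square_fun_def L2_set_Suc y_def using s0 by (simp add: F_def)
        qed
        have "S t + y\<^sup>2 / (2 * W t) \<le> sqrt ((S t)\<^sup>2 + y\<^sup>2)"
        proof (cases "W t = 0")
          case True
          then show ?thesis by (simp add: real_le_rsqrt)
        next
          case False
          then have Wt: "0 < W t" using W0[of t] by simp
          define z where "z = y / W t"
          have z: "y = z * W t" "0 \<le> z" unfolding z_def using Wt y0 by auto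
          have "z * W t \<le> W t - S t" using yW z by simp
          then have Sz: "S t \<le> (1 - z) * W t" by (simp add: algebra_simps)
          have eq: "(S t + y\<^sup>2 / (2 * W t)) = S t + z\<^sup>2 * W t / 2"
            unfolding z using Wt by (simp add: power2_eq_square)
          have "(S t + z\<^sup>2 * W t / 2)\<^sup>2 \<le> (S t)\<^sup>2 + y\<^sup>2"
          proof -
            have z1: "z \<le> 1"
            proof -
              have "0 \<le> (1 - z) * W t" using Sz S0[of t] by linarith
              then show ?thesis using Wt by (simp add: zero_le_mult_iff)
            qed
            have "(S t + z\<^sup>2 * W t / 2)\<^sup>2 = (S t)\<^sup>2 + (S t * z\<^sup>2) * W t + z\<^sup>2 * z\<^sup>2 * (W t)\<^sup>2 / 4"
              by (simp add: power2_eq_square algebra_simps)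
            also have "\<dots> \<le> (S t)\<^sup>2 + ((1 - z) * W t * z\<^sup>2) * W t + z\<^sup>2 * z * (W t)\<^sup>2"
            proof -
              have "z\<^sup>2 * z\<^sup>2 * (W t)\<^sup>2 / 4 \<le> z\<^sup>2 * z * (W t)\<^sup>2"
              proof -
                have "z\<^sup>2 * z\<^sup>2 * (W t)\<^sup>2 / 4 \<le> z\<^sup>2 * z\<^sup>2 * (W t)\<^sup>2" by simp
                also have "\<dots> \<le> z\<^sup>2 * z * (W t)\<^sup>2"
                  using z(2) z1 by (intro mult_right_mono mult_left_mono) (auto simp: power2_eq_square mult_left_le)
                finally show ?thesis .
              qed
              moreover have "(S t * z\<^sup>2) * W t \<le> ((1 - z) * W t * z\<^sup>2) * W t"
                using Sz Wt by (intro mult_right_mono) auto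
              ultimately show ?thesis by linarith
            qed
            also have "\<dots> = (S t)\<^sup>2 + y\<^sup>2" unfolding z by (simp add: power2_eq_square algebra_simps)
            finally show ?thesis .
          qed
          then show ?thesis unfolding eq by (rule real_le_rsqrt)
        qed
        moreover have "s\<^sup>2 / 2 * ((norm (v t))\<^sup>2 / W t) = y\<^sup>2 / (2 * W t)"
          unfolding y_def by (simp add: power_mult_distrib)
        ultimately show ?thesis unfolding SF by (simp only:)
      qed
      have "(\<integral>t. S t \<partial>M) + s\<^sup>2 / 2 * (\<integral>t. (norm (v t))\<^sup>2 / W t \<partial>M)
        = (\<integral>t. S t + s\<^sup>2 / 2 * ((norm (v t))\<^sup>2 / W t) \<partial>M)"
        by (subst Bochner_Integration.integral_add[OF Sint integrable_mult_right[OF vint]])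
          (simp only: integral_mult_right_zero)
      also have "\<dots> \<le> (\<integral>t. square_fun (Suc m) F t \<partial>M)"
        by (intro integral_mono pt integrable_square_fun H_integrable FH
            Bochner_Integration.integrable_add Sint integrable_mult_right vint)
      \<comment> \<open>The right side is the sum of two halves: the slack of the near-maximiser and
        the growth allowed by \<open>up\<close>.\<close>
      finally have "s\<^sup>2 / 2 * (\<integral>t. (norm (v t))\<^sup>2 / W t \<partial>M) \<le> \<sigma> * d\<^sup>2"
        using up near unfolding S_def[symmetric] by (simp add: distrib_left)
      then have "d\<^sup>2 * (\<integral>t. (norm (v t))\<^sup>2 / W t \<partial>M) \<le> d\<^sup>2 * (2 * \<sigma> * P\<^sup>2)"
        unfolding s_def using P by (simp add: power_divide field_simps)
      then show ?thesis using d0 unfolding v_def P_def by simp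
    qed
  qed
  define r where "r = sqrt (2 * \<sigma>)"
  have r: "0 < r" "r\<^sup>2 = 2 * \<sigma>" unfolding r_def using \<sigma>1 by auto
  have lower: "L1_norm M (comb n b g) \<le> r * L2_set b {..<n}" for b
  proof (cases "L2_set b {..<n} = 0")
    case True
    then have "comb n b g t = 0" for t using norm_comb_le[of n b g t] by simp
    then show ?thesis unfolding L1_norm_def using True by simp
  next
    case False
    define q where "q = L2_set b {..<n}"
    have q: "0 < q" using False unfolding q_def using L2_set_nonneg[of b "{..<n}"] by linarith
    \<comment> \<open>Weighted Cauchy-Schwarz by the pointwise bound |v| \<le> l/2 |v|^2 / W + W /
      (2 l). This l balances the weighted norm q^2 against the bound r^2 for the integral of
      W.\<close>
    define l where "l = r / q"
    have l: "0 < l" unfolding l_def using q r by simp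
    let ?v = "comb n b g"
    have vint: "integrable M (\<lambda>t. (norm (?v t))\<^sup>2 / W t)" unfolding g_def by (rule cint)
    have "L1_norm M ?v \<le> (\<integral>t. l / 2 * ((norm (?v t))\<^sup>2 / W t) + 1 / (2 * l) * W t \<partial>M)"
      unfolding L1_norm_def
    proof (rule integral_mono)
      show "integrable M (\<lambda>t. norm (?v t))" using H_integrable[OF comb_in_H] gH by auto
      show "integrable M (\<lambda>t. l / 2 * ((norm (?v t))\<^sup>2 / W t) + 1 / (2 * l) * W t)"
        by (intro Bochner_Integration.integrable_add integrable_mult_right vint Wint)
      fix t
      show "norm (?v t) \<le> l / 2 * ((norm (?v t))\<^sup>2 / W t) + 1 / (2 * l) * W t"
      proof (cases "W t = 0")
        case True
        have "h i t = 0" if "i < n" for i using hW[OF that, of t] True by simp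
        then show ?thesis using True by (simp add: comb_def g_def)
      next
        case False
        then have Wt: "0 < W t" using W0[of t] by simp
        have "0 \<le> (l * norm (?v t) - W t)\<^sup>2" by simp
        then have "2 * l * norm (?v t) * W t \<le> l\<^sup>2 * (norm (?v t))\<^sup>2 + (W t)\<^sup>2"
          by (simp add: power2_eq_square algebra_simps)
        then show ?thesis using Wt l by (simp add: field_simps power2_eq_square)
      qed
    qed
    also have "\<dots> = l / 2 * q\<^sup>2 + 1 / (2 * l) * (\<integral>t. W t \<partial>M)"
      using c[of b] unfolding q_def g_def[symmetric]
      by (subst Bochner_Integration.integral_add[OF integrable_mult_right[OF vint] integrable_mult_right[OF Wint]])
        (simp only: integral_mult_right_zero)
    also have "\<dots> \<le> l / 2 * q\<^sup>2 + 1 / (2 * l) * r\<^sup>2"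
      using IW l unfolding r(2) by (intro add_left_mono mult_left_mono) auto
    also have "\<dots> = r * q" unfolding l_def using r(1) q by (simp add: power2_eq_square field_simps)
    finally show ?thesis unfolding q_def .
  qed
  have "hilbertian n (\<lambda>i t. (1 / r) *\<^sub>R g i t)"
    unfolding hilbertian_def comb_scale L1_norm_scale
    using lower r gH H_scale by (simp add: field_simps)
  from le\<sigma>[OF this] have "(\<integral>t. square_fun n g t \<partial>M) / r \<le> \<sigma>" unfolding square_fun_scale using r by simp
  then have Sg: "(\<integral>t. square_fun n g t \<partial>M) \<le> \<sigma> * r" using r by (simp add: divide_le_eq)
  \<comment> \<open>The bound \<open>upper\<close> at a unit coefficient vector, where the weighted
    form equals 1.\<close>
  have each: "1 \<le> r * L1_norm M (g i)" if i: "i < n" for i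
  proof -
    define e where "e j = (if j = i then 1 else 0 :: real)" for j
    have e: "comb n e g = g i" unfolding comb_def e_def using i by (simp add: if_distrib[of "\<lambda>x. x *\<^sub>R _"] cong: if_cong)
    have "L2_set e {..<n} = 1" unfolding L2_set_def e_def using i by (simp add: if_distrib[of "\<lambda>x. x\<^sup>2"] cong: if_cong)
    then have "1 \<le> r\<^sup>2 * (L1_norm M (g i))\<^sup>2" using upper[of e] c[of e] unfolding g_def[symmetric] e r by simp
    then have "1\<^sup>2 \<le> (r * L1_norm M (g i))\<^sup>2" by (simp add: power_mult_distrib)
    then show ?thesis using r L1_norm_nonneg[of M "g i"] by (intro power2_le_imp_le[of 1]) auto
  qed
  have "real n = (\<Sum>i<n. 1)" by simp
  also have "\<dots> \<le> (\<Sum>i<n. r * L1_norm M (g i))" by (intro sum_mono each) auto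
  also have "\<dots> = r * (\<integral>t. (\<Sum>i<n. norm (g i t)) \<partial>M)"
    unfolding L1_norm_def using H_integrable[OF gH]
    by (subst Bochner_Integration.integral_sum) (auto simp: sum_distrib_left)
  also have "\<dots> \<le> r * (\<integral>t. sqrt n * square_fun n g t \<partial>M)"
    using r H_integrable[OF gH] by (intro mult_left_mono integral_mono sum_norm_le_square_fun)
      (auto intro!: integrable_square_fun)
  also have "\<dots> = r * (sqrt n * (\<integral>t. square_fun n g t \<partial>M))" by simp
  also have "\<dots> \<le> r * (sqrt n * (\<sigma> * r))" using Sg r by (intro mult_left_mono) auto
  also have "\<dots> = sqrt n * (2 * \<sigma>\<^sup>2)" using r(2) by (simp add: power2_eq_square)
  finally have "sqrt n * sqrt n \<le> sqrt n * (2 * \<sigma>\<^sup>2)" by simp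
  moreover have "0 < sqrt n" using n \<sigma>1 by (cases n) auto
  ultimately have "sqrt n \<le> 2 * \<sigma>\<^sup>2" by (rule mult_left_le_imp_le)
  then have "(sqrt n)\<^sup>2 \<le> (2 * \<sigma>\<^sup>2)\<^sup>2" by (intro power_mono) auto
  then show False using n by (simp add: power_mult_distrib)
qed

end

subsection \<open>Weakly summable families\<close>

context L1_subspace
begin

text \<open>The averages \<open>2\<^sup>-\<^sup>n \<Sum>\<^sub>i \<plusminus> f i\<close> over all sign patterns: Khinchine's inequality bounds the sum of their
  norms from below by the square function, Bessel's inequality for the Rademacher functions bounds
  their signed sums.\<close>

lemma weakly_summable_family:
  assumes inf: "\<And>n. \<exists>h. independent_system n h"
  obtains m x where "\<And>j. j < m \<Longrightarrow> x j \<in> H"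
    "\<And>a. (\<And>j. j < m \<Longrightarrow> \<bar>a j\<bar> \<le> 1) \<Longrightarrow> L1_norm M (comb m a x) \<le> 1"
    "N \<le> (\<Sum>j<m. L1_norm M (x j))"
proof -
  obtain n f where f: "hilbertian n f" and N: "sqrt 3 * N < (\<integral>t. square_fun n f t \<partial>M)"
    using square_fun_integral_unbounded[OF inf] by blast
  have fH: "f i \<in> H" if "i < n" for i using f that by (simp add: hilbertian_def)
  define X where "X S = comb n (\<lambda>i. rsign S i / 2 ^ n) f" for S
  have XH: "X S \<in> H" for S unfolding X_def using fH by (rule comb_in_H)
  have Xt: "X S t = (1 / 2 ^ n) *\<^sub>R (\<Sum>i<n. rsign S i *\<^sub>R f i t)" for S t
    unfolding X_def comb_def by (simp add: scaleR_sum_right)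
  obtain h where h: "bij_betw h {..<card (Pow {..<n})} (Pow {..<n})"
    using ex_bij_betw_nat_finite[of "Pow {..<n}"] by (auto simp: atLeast0LessThan)
  have "(\<integral>t. square_fun n f t \<partial>M) \<le> (\<integral>t. sqrt 3 * (\<Sum>S\<in>Pow {..<n}. norm (X S t)) \<partial>M)"
  proof (rule integral_mono)
    show "integrable M (square_fun n f)" by (intro integrable_square_fun H_integrable fH)
    show "integrable M (\<lambda>t. sqrt 3 * (\<Sum>S\<in>Pow {..<n}. norm (X S t)))"
      using H_integrable[OF XH] by auto
    show "square_fun n f t \<le> sqrt 3 * (\<Sum>S\<in>Pow {..<n}. norm (X S t))" for t
      using khinchine_L1[of n "\<lambda>i. f i t"] unfolding Xt square_fun_def L2_set_def
      by (simp add: sum_divide_distrib[symmetric] field_simps)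
  qed
  also have "\<dots> = sqrt 3 * (\<Sum>S\<in>Pow {..<n}. L1_norm M (X S))"
    unfolding L1_norm_def using H_integrable[OF XH]
    by (subst integral_mult_right_zero, subst Bochner_Integration.integral_sum) auto
  finally have N2: "sqrt 3 * N \<le> sqrt 3 * (\<Sum>S\<in>Pow {..<n}. L1_norm M (X S))" using N by linarith
  show thesis
  proof (rule that[of "card (Pow {..<n})" "\<lambda>j. X (h j)"])
    show "X (h j) \<in> H" for j by (rule XH)
    show "N \<le> (\<Sum>j<card (Pow {..<n}). L1_norm M (X (h j)))"
      unfolding sum.reindex_bij_betw[OF h, of "\<lambda>S. L1_norm M (X S)"] using N2 by simp
    fix a :: "nat \<Rightarrow> real" assume a: "\<And>j. j < card (Pow {..<n}) \<Longrightarrow> \<bar>a j\<bar> \<le> 1"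
    define a' where "a' S = a (inv_into {..<card (Pow {..<n})} h S)" for S
    have a': "\<bar>a' S\<bar> \<le> 1" if "S \<in> Pow {..<n}" for S
      unfolding a'_def using bij_betw_inv_into[OF h] that by (intro a) (auto simp: bij_betw_def)
    have "comb (card (Pow {..<n})) a (\<lambda>j. X (h j)) t = (\<Sum>S\<in>Pow {..<n}. a' S *\<^sub>R X S t)" for t
    proof -
      have "comb (card (Pow {..<n})) a (\<lambda>j. X (h j)) t = (\<Sum>j<card (Pow {..<n}). a' (h j) *\<^sub>R X (h j) t)"
        unfolding comb_def a'_def using h by (intro sum.cong) (auto simp: bij_betw_def)
      then show ?thesis unfolding sum.reindex_bij_betw[OF h, of "\<lambda>S. a' S *\<^sub>R X S t"] .
    qed
    moreover have "(\<Sum>S\<in>Pow {..<n}. a' S *\<^sub>R X S t) = comb n (\<lambda>i. (\<Sum>S\<in>Pow {..<n}. a' S * rsign S i) / 2 ^ n) f t" for t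
      unfolding X_def comb_def scaleR_sum_right sum_divide_distrib scaleR_sum_left
      by (subst sum.swap) simp
    ultimately have "comb (card (Pow {..<n})) a (\<lambda>j. X (h j)) = comb n (\<lambda>i. (\<Sum>S\<in>Pow {..<n}. a' S * rsign S i) / 2 ^ n) f"
      by (intro ext) simp
    then show "L1_norm M (comb (card (Pow {..<n})) a (\<lambda>j. X (h j))) \<le> 1"
      using f by (auto simp: hilbertian_def intro: order_trans[OF _ rademacher_bessel] a')
  qed
qed

end

section \<open>Linear algebra on explicit carriers\<close>

context
  fixes X :: "('k::real_normed_field, 'u, 'z) nspace_scheme"
  assumes X: "vector_sp X"
begin

lemmas vector_sp_conjs = X[unfolded vector_sp_def]
lemmas vzero_mem [simp] = vector_sp_conjs[THEN conjunct1, rule_format]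
lemmas vadd_mem [simp] = vector_sp_conjs[THEN conjunct2, THEN conjunct1, rule_format]
lemmas vsmul_mem [simp] = vector_sp_conjs[THEN conjunct2, THEN conjunct2, THEN conjunct1, rule_format]
lemmas vadd_assoc = vector_sp_conjs[THEN conjunct2, THEN conjunct2, THEN conjunct2, THEN conjunct1, rule_format]
lemmas vadd_commute = vector_sp_conjs[THEN conjunct2, THEN conjunct2, THEN conjunct2, THEN conjunct2, THEN conjunct1, rule_format]
lemmas vadd_zero_right [simp] = vector_sp_conjs[THEN conjunct2, THEN conjunct2, THEN conjunct2, THEN conjunct2, THEN conjunct2, THEN conjunct1, rule_format]
lemmas vadd_inverse = vector_sp_conjs[THEN conjunct2, THEN conjunct2, THEN conjunct2, THEN conjunct2, THEN conjunct2, THEN conjunct2, THEN conjunct1, rule_format]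
lemmas vsmul_vadd = vector_sp_conjs[THEN conjunct2, THEN conjunct2, THEN conjunct2, THEN conjunct2, THEN conjunct2, THEN conjunct2, THEN conjunct2, THEN conjunct1, rule_format]
lemmas vsmul_add = vector_sp_conjs[THEN conjunct2, THEN conjunct2, THEN conjunct2, THEN conjunct2, THEN conjunct2, THEN conjunct2, THEN conjunct2, THEN conjunct2, THEN conjunct1, rule_format]
lemmas vsmul_mult = vector_sp_conjs[THEN conjunct2, THEN conjunct2, THEN conjunct2, THEN conjunct2, THEN conjunct2, THEN conjunct2, THEN conjunct2, THEN conjunct2, THEN conjunct2, THEN conjunct1, rule_format]
lemmas vsmul_one [simp] = vector_sp_conjs[THEN conjunct2, THEN conjunct2, THEN conjunct2, THEN conjunct2, THEN conjunct2, THEN conjunct2, THEN conjunct2, THEN conjunct2, THEN conjunct2, THEN conjunct2, rule_format]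

lemma vadd_zero_left [simp]: "x \<in> spc X \<Longrightarrow> vadd X (vzero X) x = x"
  by (simp add: vadd_commute[of "vzero X"])

lemma vadd_idem_imp_zero:
  assumes "x \<in> spc X" "vadd X x x = x"
  shows "x = vzero X"
proof -
  obtain y where y: "y \<in> spc X" "vadd X x y = vzero X" using vadd_inverse assms(1) by blast
  have "vadd X (vadd X x x) y = vzero X" using assms y by simp
  then show ?thesis using assms(1) y by (simp add: vadd_assoc)
qed

lemma vsmul_zero_left [simp]: "x \<in> spc X \<Longrightarrow> vsmul X 0 x = vzero X"
  by (rule vadd_idem_imp_zero) (simp_all add: vsmul_add[symmetric])

lemma vsmul_zero_right [simp]: "vsmul X a (vzero X) = vzero X"
  by (rule vadd_idem_imp_zero) (simp_all add: vsmul_vadd[symmetric])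

lemma vadd_uminus_right [simp]: "x \<in> spc X \<Longrightarrow> vadd X x (vsmul X (- 1) x) = vzero X"
  using vsmul_add[of x 1 "- 1"] by simp

lemma vsub_mem [simp]: "x \<in> spc X \<Longrightarrow> y \<in> spc X \<Longrightarrow> vsub X x y \<in> spc X"
  by (simp add: vsub_def)

lemma lincomb_mem: "snd ` set cs \<subseteq> spc X \<Longrightarrow> lincomb X cs \<in> spc X"
  by (induction cs) auto

lemma vsmul_lincomb:
  "snd ` set cs \<subseteq> spc X \<Longrightarrow> vsmul X a (lincomb X cs) = lincomb X (map (\<lambda>(c, b). (a * c, b)) cs)"
  by (induction cs) (auto simp: vsmul_vadd vsmul_mult lincomb_mem)

text \<open>Scalars are left inside the argument, so the rule serves both linear functionals and the
  value at a point of a map that commutes only with real scalars.\<close>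

lemma additive_lincomb:
  fixes \<phi> :: "'u \<Rightarrow> 'v::comm_monoid_add" and s :: "'k \<Rightarrow> 'v \<Rightarrow> 'v"
  assumes "\<And>x y. x \<in> spc X \<Longrightarrow> y \<in> spc X \<Longrightarrow> \<phi> (vadd X x y) = \<phi> x + \<phi> y" "\<phi> (vzero X) = 0"
    and "\<And>i. i \<in> set js \<Longrightarrow> z i \<in> spc X"
  shows "\<phi> (lincomb X (map (\<lambda>i. (a i, z i)) js)) = (\<Sum>i\<leftarrow>js. \<phi> (vsmul X (a i) (z i)))"
  using assms(3)
proof (induction js)
  case (Cons j js)
  have "lincomb X (map (\<lambda>i. (a i, z i)) js) \<in> spc X" using Cons.prems by (intro lincomb_mem) auto
  then show ?case using Cons assms(1) by simp
qed (simp add: assms(2))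

end

text \<open>The span condition has the shape used in \<open>infinite_dim\<close>, one coefficient
  per list entry, so a failing spanning list directly yields the next independent element.\<close>

fun indep_list :: "('k::real_normed_field, 'u, 'z) nspace_scheme \<Rightarrow> 'u list \<Rightarrow> bool" where
  "indep_list X [] = True"
| "indep_list X (b # B) = (b \<in> spc X \<and> indep_list X B \<and>
     (\<forall>cs. length cs = length B \<longrightarrow> b \<noteq> lincomb X (zip cs B)))"

lemma indep_list_mem: "indep_list X B \<Longrightarrow> set B \<subseteq> spc X"
  by (induction B) auto

lemma infinite_dim_indep_list:
  assumes "infinite_dim X"
  shows "\<exists>B. length B = n \<and> indep_list X B"
proof (induction n)
  case (Suc n)
  then obtain B where B: "length B = n" "indep_list X B" by blast
  obtain x where "x \<in> spc X" "\<forall>cs. length cs = length B \<longrightarrow> x \<noteq> lincomb X (zip cs B)"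
    using assms indep_list_mem[OF B(2)] unfolding infinite_dim_def by blast
  then have "length (x # B) = Suc n \<and> indep_list X (x # B)" using B by simp
  then show ?case by blast
qed simp

lemma indep_list_coeffs_zero:
  assumes X: "vector_sp X"
  shows "indep_list X B \<Longrightarrow> length cs = length B \<Longrightarrow> lincomb X (zip cs B) = vzero X \<Longrightarrow> c \<in> set cs \<Longrightarrow> c = 0"
proof (induction B arbitrary: cs c)
  case (Cons b B)
  then obtain d ds where cs: "cs = d # ds" "length ds = length B" by (cases cs) auto
  have b: "b \<in> spc X" and B: "indep_list X B" using Cons.prems by auto
  define L where "L = lincomb X (zip ds B)"
  have zB: "snd ` set (zip ds B) \<subseteq> spc X" using indep_list_mem[OF B] by (auto dest: set_zip_rightD)
  have L: "L \<in> spc X" unfolding L_def using zB by (rule lincomb_mem[OF X])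
  have 0: "vadd X (vsmul X d b) L = vzero X" using Cons.prems(3) unfolding cs L_def by simp
  have "d = 0"
  proof (rule ccontr)
    assume d: "d \<noteq> 0"
    have "vadd X b (vsmul X (1 / d) L) = vsmul X (1 / d) (vadd X (vsmul X d b) L)"
      using d b L by (simp add: vsmul_vadd[OF X] X vsmul_mult[OF X, symmetric])
    also have "\<dots> = vzero X" unfolding 0 using X by simp
    finally have e: "vadd X b (vsmul X (1 / d) L) = vzero X" .
    have "vadd X (vsmul X (1 / d) L) (vsmul X (- (1 / d)) L) = vzero X"
      using L by (simp add: vsmul_add[OF X, symmetric] X)
    then have "b = vadd X (vadd X b (vsmul X (1 / d) L)) (vsmul X (- (1 / d)) L)"
      using b L by (simp add: vadd_assoc[OF X] X)
    then have "b = vsmul X (- (1 / d)) L" unfolding e using L X by simp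
    also have "\<dots> = lincomb X (zip (map ((*) (- (1 / d))) ds) B)"
      unfolding L_def vsmul_lincomb[OF X zB] by (simp add: zip_map1)
    finally show False using Cons.prems(1) cs(2) by (metis indep_list.simps(2) length_map)
  qed
  moreover have "lincomb X (zip ds B) = vzero X" using 0 b L X unfolding \<open>d = 0\<close> L_def by simp
  ultimately show ?case using Cons.IH[OF B cs(2)] Cons.prems(4) unfolding cs by auto
qed simp

text \<open>Through U = \<psi> after T, E becomes a real-linear space of complex functions. Since
  only real coefficients are available, the real and imaginary parts of \<psi> (\<phi> (z j)) are
  summed separately: their signs, used as coefficients, turn each sum into a part of \<psi> (\<phi>
  Z) for one combination Z of bounded norm.\<close>

lemma weakly_summable_family_in_subspace_of_L1:
  fixes E :: "('k::{real_normed_field, banach, second_countable_topology}, 'u, 'z) nspace_scheme"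
  assumes E: "normed_sp E" "infinite_dim E" and M: "embeds_in_L1 E M"
  obtains m :: nat and x where "\<And>j. j < m \<Longrightarrow> x j \<in> spc E"
    "\<And>\<phi>. \<phi> \<in> dual_ball E \<Longrightarrow> (\<Sum>j<m. norm (\<phi> (x j))) \<le> 1"
    "N \<le> (\<Sum>j<m. vnorm E (x j))"
proof -
  have V: "vector_sp E" using E(1) by (simp add: normed_sp_def)
  obtain T c C0 where c: "0 < c"
    and T: "\<forall>x\<in>spc E. \<forall>y\<in>spc E. T (vadd E x y) = (\<lambda>t. T x t + T y t)"
      "\<forall>a. \<forall>x\<in>spc E. T (vsmul E a x) = (\<lambda>t. a * T x t)"
      "\<forall>x\<in>spc E. integrable M (T x) \<and> c * vnorm E x \<le> (\<integral>t. norm (T x t) \<partial>M) \<and>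
        (\<integral>t. norm (T x t) \<partial>M) \<le> C0 * vnorm E x"
    using M unfolding embeds_in_L1_def by (elim exE conjE)
  have Tadd: "T (vadd E x y) = (\<lambda>t. T x t + T y t)" if "x \<in> spc E" "y \<in> spc E" for x y
    using T(1) that by blast
  have Tsmul: "T (vsmul E a x) = (\<lambda>t. a * T x t)" if "x \<in> spc E" for a x
    using T(2) that by blast
  have Tint: "integrable M (T x)" and low: "c * vnorm E x \<le> (\<integral>t. norm (T x t) \<partial>M)"
    and up0: "(\<integral>t. norm (T x t) \<partial>M) \<le> C0 * vnorm E x" if "x \<in> spc E" for x
    using T(3) that by blast+
  have nn: "0 \<le> vnorm E x" if "x \<in> spc E" for x using E(1) that by (simp add: normed_sp_def)
  define C where "C = max C0 1"
  have C: "0 < C" unfolding C_def by simp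
  have up: "(\<integral>t. norm (T x t) \<partial>M) \<le> C * vnorm E x" if "x \<in> spc E" for x
    using up0[OF that] mult_right_mono[of C0 C "vnorm E x"] nn[OF that] unfolding C_def by simp
  obtain \<psi> :: "'k \<Rightarrow> complex" where \<psi>add: "\<And>x y. \<psi> (x + y) = \<psi> x + \<psi> y"
    and \<psi>smul: "\<And>r x. \<psi> (of_real r * x) = r *\<^sub>R \<psi> x"
    and \<psi>low: "\<And>x. norm x \<le> 2 * norm (\<psi> x)" and \<psi>up: "\<And>x. norm (\<psi> x) \<le> 2 * norm x"
    using real_normed_field_to_complex by blast
  interpret \<psi>: bounded_linear \<psi>
    by (rule bounded_linear_intro[of _ 2]) (simp_all add: \<psi>add \<psi>smul \<psi>up scaleR_conv_of_real[where 'a = 'k] mult.commute[of _ 2])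
  define U where "U x t = \<psi> (T x t)" for x t
  have Uadd: "U (vadd E x y) = (\<lambda>t. U x t + U y t)" if "x \<in> spc E" "y \<in> spc E" for x y
    unfolding U_def Tadd[OF that] \<psi>add ..
  have Usmul: "U (vsmul E (of_real r) x) = (\<lambda>t. r *\<^sub>R U x t)" if "x \<in> spc E" for r x
    unfolding U_def Tsmul[OF that] \<psi>smul ..
  have Uint: "integrable M (U x)" if "x \<in> spc E" for x
    unfolding U_def using Tint[OF that] by (intro integrable_bounded_linear[OF \<psi>.bounded_linear_axioms])
  have Uzero: "U (vzero E) = (\<lambda>t. 0)" using Usmul[of "vzero E" 0] V by simp
  have U_low: "(\<integral>t. norm (T x t) \<partial>M) \<le> 2 * L1_norm M (U x)" if "x \<in> spc E" for x
  proof -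
    have "(\<integral>t. norm (T x t) \<partial>M) \<le> (\<integral>t. 2 * norm (U x t) \<partial>M)"
      using Tint[OF that] Uint[OF that, unfolded U_def] \<psi>low by (intro integral_mono) (auto simp: U_def)
    then show ?thesis by (simp add: L1_norm_def)
  qed
  have U_up: "L1_norm M (U x) \<le> 2 * (\<integral>t. norm (T x t) \<partial>M)" if "x \<in> spc E" for x
  proof -
    have "L1_norm M (U x) \<le> (\<integral>t. 2 * norm (T x t) \<partial>M)"
      unfolding L1_norm_def using Tint[OF that] Uint[OF that, unfolded U_def] \<psi>up by (intro integral_mono) (auto simp: U_def)
    then show ?thesis by simp
  qed
  have Ucomb: "U (lincomb E (map (\<lambda>i. (of_real (b i), z i)) [0..<n])) = comb n b (\<lambda>i. U (z i))"
    if "\<And>i. i < n \<Longrightarrow> z i \<in> spc E" for n b z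
  proof
    fix t
    have "U (lincomb E (map (\<lambda>i. (of_real (b i), z i)) [0..<n])) t = (\<Sum>i\<leftarrow>[0..<n]. U (vsmul E (of_real (b i)) (z i)) t)"
      by (rule additive_lincomb[OF V, of "\<lambda>x. U x t"]) (use Uadd Uzero that in auto)
    also have "\<dots> = comb n b (\<lambda>i. U (z i)) t"
      unfolding comb_def interv_sum_list_conv_sum_set_nat using that Usmul
      by (intro sum.cong) auto
    finally show "U (lincomb E (map (\<lambda>i. (of_real (b i), z i)) [0..<n])) t = comb n b (\<lambda>i. U (z i)) t" .
  qed
  interpret L1_subspace M "U ` spc E"
  proof
    show "integrable M f" if "f \<in> U ` spc E" for f using that Uint by blast
    show "(\<lambda>t. 0) \<in> U ` spc E" using Uzero V by (metis image_eqI vzero_mem)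
    show "(\<lambda>t. f t + g t) \<in> U ` spc E" if "f \<in> U ` spc E" "g \<in> U ` spc E" for f g
      using that Uadd V by (auto simp flip: Uadd)
    show "(\<lambda>t. r *\<^sub>R f t) \<in> U ` spc E" if "f \<in> U ` spc E" for f r
      using that V by (auto simp flip: Usmul)
  qed
  have inf: "\<exists>h. independent_system n h" for n
  proof -
    obtain B where B: "length B = n" "indep_list E B" using infinite_dim_indep_list[OF E(2)] by blast
    have Bm: "B ! i \<in> spc E" if "i < n" for i using indep_list_mem[OF B(2)] B(1) that by auto
    have "b i = 0" if 0: "L1_norm M (comb n b (\<lambda>i. U (B ! i))) = 0" and i: "i < n" for b i
    proof -
      define x where "x = lincomb E (map (\<lambda>i. (of_real (b i), B ! i)) [0..<n])"
      have x: "x \<in> spc E" unfolding x_def using Bm by (intro lincomb_mem[OF V]) auto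
      have "L1_norm M (U x) = 0" using 0 unfolding x_def by (subst Ucomb) (use Bm in auto)
      then have "c * vnorm E x \<le> 0" using low[OF x] U_low[OF x] by simp
      then have "vnorm E x = 0" using c nn[OF x] by (simp add: mult_le_0_iff)
      then have "x = vzero E" using E(1) x by (simp add: normed_sp_def)
      moreover have "x = lincomb E (zip (map (\<lambda>i. of_real (b i)) [0..<n]) B)"
      proof -
        have "map (\<lambda>i. (of_real (b i), B ! i)) [0..<n] = zip (map (\<lambda>i. of_real (b i) :: 'k) [0..<n]) B"
          by (rule nth_equalityI) (use B(1) in auto)
        then show ?thesis unfolding x_def by simp
      qed
      ultimately have "(of_real (b i) :: 'k) = 0"
        by (intro indep_list_coeffs_zero[OF V B(2)]) (use B(1) i in auto)
      then show ?thesis by simp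
    qed
    then have "independent_system n (\<lambda>i. U (B ! i))" unfolding independent_system_def using Bm by blast
    then show ?thesis by blast
  qed
  \<comment> \<open>A factor 2 C is lost in passing from L1 norms of U to norms in E, and 16 / c in
    the final rescaling.\<close>
  obtain m y where y: "\<And>j. j < m \<Longrightarrow> y j \<in> U ` spc E"
    and y1: "\<And>a. (\<And>j. j < m \<Longrightarrow> \<bar>a j\<bar> \<le> 1) \<Longrightarrow> L1_norm M (comb m a y) \<le> 1"
    and yN: "32 * C / c * N \<le> (\<Sum>j<m. L1_norm M (y j))"
    using weakly_summable_family[OF inf] by blast
  from y have "\<exists>z\<in>spc E. y j = U z" if "j < m" for j using that by blast
  then obtain z where z: "\<And>j. j < m \<Longrightarrow> z j \<in> spc E" and yz: "\<And>j. j < m \<Longrightarrow> y j = U (z j)" by metis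
  \<comment> \<open>Here 16 / c = 2 (4 / c + 4 / c): the combination Z has norm at most 2 / c,
    \<psi> doubles it, both parts contribute, and returning from \<open>complex\<close> to the
    scalars doubles again.\<close>
  have weak: "(\<Sum>j<m. norm (\<phi> (z j))) \<le> 16 / c" if \<phi>: "\<phi> \<in> dual_ball E" for \<phi>
  proof -
    have \<phi>add: "\<phi> (vadd E x y) = \<phi> x + \<phi> y" if "x \<in> spc E" "y \<in> spc E" for x y
      using \<phi> that by (simp add: dual_ball_def dual_def)
    have \<phi>smul: "\<phi> (vsmul E a x) = a * \<phi> x" if "x \<in> spc E" for a x
      using \<phi> that by (simp add: dual_ball_def dual_def)
    have \<phi>0: "\<phi> (vzero E) = 0" using \<phi>smul[of "vzero E" 0] V by simp
    have \<phi>le: "norm (\<phi> x) \<le> vnorm E x" if "x \<in> spc E" for x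
      using \<phi> that by (simp add: dual_ball_def)
    have key: "norm (\<Sum>j<m. a j *\<^sub>R \<psi> (\<phi> (z j))) \<le> 4 / c" if a: "\<And>j. j < m \<Longrightarrow> \<bar>a j\<bar> \<le> 1" for a
    proof -
      define Z where "Z = lincomb E (map (\<lambda>i. (of_real (a i), z i)) [0..<m])"
      have Z: "Z \<in> spc E" unfolding Z_def using z by (intro lincomb_mem[OF V]) auto
      have "\<phi> Z = (\<Sum>i\<leftarrow>[0..<m]. \<phi> (vsmul E (of_real (a i)) (z i)))"
        unfolding Z_def by (rule additive_lincomb[OF V]) (use \<phi>add \<phi>0 z in auto)
      also have "\<dots> = (\<Sum>j<m. of_real (a j) * \<phi> (z j))"
        unfolding interv_sum_list_conv_sum_set_nat using z \<phi>smul by (intro sum.cong) auto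
      finally have "\<psi> (\<phi> Z) = (\<Sum>j<m. a j *\<^sub>R \<psi> (\<phi> (z j)))"
        by (simp add: \<psi>.sum \<psi>smul)
      moreover have "norm (\<psi> (\<phi> Z)) \<le> 2 * vnorm E Z" using \<psi>up[of "\<phi> Z"] \<phi>le[OF Z] by simp
      moreover have "U Z = comb m a y"
      proof -
        have "U Z = comb m a (\<lambda>i. U (z i))" unfolding Z_def by (rule Ucomb) (rule z)
        then show ?thesis unfolding comb_def using yz by (auto intro!: ext sum.cong)
      qed
      then have "c * vnorm E Z \<le> 2" using low[OF Z] U_low[OF Z] y1[of a] a by simp
      then have "2 * vnorm E Z \<le> 4 / c" using c by (simp add: field_simps)
      ultimately show ?thesis by simp
    qed
    have Re: "(\<Sum>j<m. \<bar>Re (\<psi> (\<phi> (z j)))\<bar>) \<le> 4 / c"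
    proof -
      have "(\<Sum>j<m. \<bar>Re (\<psi> (\<phi> (z j)))\<bar>) = Re (\<Sum>j<m. sgn (Re (\<psi> (\<phi> (z j)))) *\<^sub>R \<psi> (\<phi> (z j)))"
        by (simp add: abs_sgn mult.commute)
      also have "\<dots> \<le> 4 / c" by (rule order_trans[OF complex_Re_le_cmod key]) (simp add: abs_sgn_eq)
      finally show ?thesis .
    qed
    have Im: "(\<Sum>j<m. \<bar>Im (\<psi> (\<phi> (z j)))\<bar>) \<le> 4 / c"
    proof -
      have "(\<Sum>j<m. \<bar>Im (\<psi> (\<phi> (z j)))\<bar>) = Im (\<Sum>j<m. sgn (Im (\<psi> (\<phi> (z j)))) *\<^sub>R \<psi> (\<phi> (z j)))"
        by (simp add: abs_sgn mult.commute)
      also have "\<dots> \<le> norm (\<Sum>j<m. sgn (Im (\<psi> (\<phi> (z j)))) *\<^sub>R \<psi> (\<phi> (z j)))"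
        using abs_Im_le_cmod abs_le_D1 by blast
      also have "\<dots> \<le> 4 / c" by (rule key) (simp add: abs_sgn_eq)
      finally show ?thesis .
    qed
    have "(\<Sum>j<m. norm (\<phi> (z j))) \<le> (\<Sum>j<m. 2 * (\<bar>Re (\<psi> (\<phi> (z j)))\<bar> + \<bar>Im (\<psi> (\<phi> (z j)))\<bar>))"
      by (intro sum_mono order_trans[OF \<psi>low] mult_left_mono cmod_le) auto
    also have "\<dots> \<le> 16 / c" using Re Im unfolding sum_distrib_left[symmetric] sum.distrib by simp
    finally show ?thesis .
  qed
  have big: "32 * C / c * N \<le> (2 * C) * (\<Sum>j<m. vnorm E (z j))"
  proof -
    have "(\<Sum>j<m. L1_norm M (y j)) \<le> (\<Sum>j<m. 2 * C * vnorm E (z j))"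
    proof (rule sum_mono)
      fix j assume "j \<in> {..<m}"
      then show "L1_norm M (y j) \<le> 2 * C * vnorm E (z j)"
        using U_up[of "z j"] up[of "z j"] z[of j] yz[of j] by simp
    qed
    then show ?thesis using yN by (simp add: sum_distrib_left)
  qed
  have hom: "vnorm E (vsmul E a x) = norm a * vnorm E x" if "x \<in> spc E" for a x
    using E(1) that by (simp add: normed_sp_def)
  show thesis
  proof (rule that[of m "\<lambda>j. vsmul E (of_real (c / 16)) (z j)"])
    show "vsmul E (of_real (c / 16)) (z j) \<in> spc E" if "j < m" for j using z[OF that] V by simp
    have n: "norm (of_real (c / 16) :: 'k) = c / 16" unfolding norm_of_real using c by simp
    show "(\<Sum>j<m. norm (\<phi> (vsmul E (of_real (c / 16)) (z j)))) \<le> 1" if \<phi>: "\<phi> \<in> dual_ball E" for \<phi>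
    proof -
      have "(\<Sum>j<m. norm (\<phi> (vsmul E (of_real (c / 16)) (z j)))) = (\<Sum>j<m. c / 16 * norm (\<phi> (z j)))"
        using z \<phi> c by (intro sum.cong refl) (simp add: dual_ball_def dual_def norm_mult n del: of_real_divide)
      also have "\<dots> = c / 16 * (\<Sum>j<m. norm (\<phi> (z j)))" by (simp add: sum_distrib_left)
      also have "\<dots> \<le> c / 16 * (16 / c)" using weak[OF \<phi>] c by (intro mult_left_mono) auto
      finally show ?thesis using c by simp
    qed
    have "(\<Sum>j<m. vnorm E (vsmul E (of_real (c / 16)) (z j))) = (\<Sum>j<m. c / 16 * vnorm E (z j))"
      using z c by (intro sum.cong refl) (simp add: hom n del: of_real_divide)
    also have "\<dots> = c / 16 * (\<Sum>j<m. vnorm E (z j))" by (simp add: sum_distrib_left)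
    also have "\<dots> \<ge> N" using big c C by (simp add: field_simps)
    finally show "N \<le> (\<Sum>j<m. vnorm E (vsmul E (of_real (c / 16)) (z j)))" .
  qed
qed

subsection \<open>Discretization of L1 functions\<close>

lemma integrable_simple_approx:
  fixes f :: "'m \<Rightarrow> 'b::{banach,second_countable_topology}"
  assumes f: "integrable M f" and e: "0 < e"
  obtains g where "simple_function M g" "integrable M g" "(\<integral>t. norm (f t - g t) \<partial>M) < e"
proof -
  obtain x where "has_bochner_integral M f x" using f by (auto simp: integrable.simps)
  then obtain s where s: "\<And>i. Bochner_Integration.simple_bochner_integrable M (s i)"
    and lim: "(\<lambda>i. \<integral>\<^sup>+t. norm (f t - s i t) \<partial>M) \<longlonglongrightarrow> 0"
    by (cases rule: has_bochner_integral.cases) blast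
  obtain i where i: "(\<integral>\<^sup>+t. norm (f t - s i t) \<partial>M) < ennreal e"
    using order_tendstoD(2)[OF lim, of "ennreal e"] e by (auto simp: eventually_sequentially)
  have int: "integrable M (s i)" using s by (auto intro: has_bochner_integral_simple_bochner_integrable integrable.intros)
  have "ennreal (\<integral>t. norm (f t - s i t) \<partial>M) = (\<integral>\<^sup>+t. norm (f t - s i t) \<partial>M)"
    using f int by (intro nn_integral_eq_integral[symmetric]) auto
  then have "ennreal (\<integral>t. norm (f t - s i t) \<partial>M) < ennreal e" using i by (rule ord_eq_less_trans)
  then have "(\<integral>t. norm (f t - s i t) \<partial>M) < e" by (subst (asm) ennreal_less_iff) auto
  moreover have "simple_function M (s i)" using s by (auto elim: Bochner_Integration.simple_bochner_integrable.cases)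
  ultimately show thesis using that int by blast
qed

text \<open>If v is nonzero, integrability of g forces A to have finite measure; if v = 0, both
  sides vanish even on a set of infinite measure, which may occur as a cell of a partition.\<close>

lemma norm_integral_of_constant_on:
  fixes g :: "'m \<Rightarrow> 'b::{banach,second_countable_topology}"
  assumes A: "A \<in> sets M" and g: "integrable M g" and const: "\<And>t. t \<in> A \<Longrightarrow> g t = v"
  shows "norm (\<integral>t\<in>A. g t \<partial>M) = (\<integral>t\<in>A. norm (g t) \<partial>M)"
proof -
  have eq: "indicat_real A t *\<^sub>R g t = indicat_real A t *\<^sub>R v"
    "indicat_real A t *\<^sub>R norm (g t) = indicat_real A t * norm v" for t
    using const by (auto simp: indicator_def)
  show ?thesis
  proof (cases "v = 0")
    case False
    have "integrable M (\<lambda>t. indicat_real A t *\<^sub>R g t)"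
      using A g by (intro integrable_mult_indicator)
    then have "integrable M (\<lambda>t. norm (indicat_real A t *\<^sub>R v) / norm v)"
      unfolding eq by (intro Bochner_Integration.integrable_divide integrable_norm)
    then have "integrable M (indicat_real A)" using False by simp
    then show ?thesis unfolding set_lebesgue_integral_def eq by simp
  next
    case True
    then show ?thesis unfolding set_lebesgue_integral_def eq by simp
  qed
qed

lemma sum_set_integral_partition:
  fixes f :: "'m \<Rightarrow> real"
  assumes fin: "finite V" and V: "G ` space M = V"
    and meas: "\<And>v. v \<in> V \<Longrightarrow> G -` {v} \<inter> space M \<in> sets M" and f: "integrable M f"
  shows "(\<Sum>v\<in>V. \<integral>t\<in>G -` {v} \<inter> space M. f t \<partial>M) = (\<integral>t. f t \<partial>M)"
proof -
  have "(\<Sum>v\<in>V. \<integral>t\<in>G -` {v} \<inter> space M. f t \<partial>M)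
    = (\<integral>t. (\<Sum>v\<in>V. indicat_real (G -` {v} \<inter> space M) t *\<^sub>R f t) \<partial>M)"
    unfolding set_lebesgue_integral_def
    by (intro Bochner_Integration.integral_sum[symmetric] integrable_mult_indicator meas f)
  also have "\<dots> = (\<integral>t. f t \<partial>M)"
  proof (rule Bochner_Integration.integral_cong[OF refl])
    fix t assume t: "t \<in> space M"
    have "(\<Sum>v\<in>V. indicat_real (G -` {v} \<inter> space M) t *\<^sub>R f t) = (\<Sum>v\<in>V. if v = G t then f t else 0)"
      using t by (intro sum.cong) (auto simp: indicator_def)
    then show "(\<Sum>v\<in>V. indicat_real (G -` {v} \<inter> space M) t *\<^sub>R f t) = f t"
      using fin V t by auto
  qed
  finally show ?thesis .
qed

text \<open>Approximate each f j by a simple function g j and take the fibres of the joint map t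
  \<mapsto> (g j t) as cells. On a cell every g j is constant, so norm and integral commute. The
  error e / 2 is paid twice: once for replacing f j by g j, once for returning on the cells.\<close>

lemma finite_partition_approx:
  fixes f :: "nat \<Rightarrow> 'm \<Rightarrow> 'b::{banach,second_countable_topology}"
  assumes f: "\<And>j. j < n \<Longrightarrow> integrable M (f j)" and e: "0 < e"
  obtains A k where "\<And>i. i < k \<Longrightarrow> A i \<in> sets M" "disjoint_family_on A {..<k::nat}"
    "\<And>j. j < n \<Longrightarrow> (\<integral>t. norm (f j t) \<partial>M) - e \<le> (\<Sum>i<k. norm (\<integral>t\<in>A i. f j t \<partial>M))"
proof -
  have "\<exists>g. simple_function M g \<and> integrable M g \<and> (\<integral>t. norm (f j t - g t) \<partial>M) < e / 2" if "j < n" for j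
    using integrable_simple_approx[OF f[OF that], of "e / 2"] e by (metis half_gt_zero)
  then obtain g where sg: "\<And>j. j < n \<Longrightarrow> simple_function M (g j)" and g: "\<And>j. j < n \<Longrightarrow> integrable M (g j)"
    and fg: "\<And>j. j < n \<Longrightarrow> (\<integral>t. norm (f j t - g j t) \<partial>M) < e / 2" by metis
  define G where "G t = (\<lambda>j\<in>{..<n}. g j t)" for t
  define V where "V = G ` space M"
  define A where "A v = G -` {v} \<inter> space M" for v
  have "V \<subseteq> Pi\<^sub>E {..<n} (\<lambda>j. g j ` space M)"
    unfolding V_def G_def by (intro image_subsetI restrict_PiE_iff[THEN iffD2]) blast
  moreover have "finite (Pi\<^sub>E {..<n} (\<lambda>j. g j ` space M))"
    using sg by (intro finite_PiE) (auto dest: simple_functionD(1))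
  ultimately have fin: "finite V" by (rule finite_subset)
  have meas: "A v \<in> sets M" if "v \<in> V" for v
  proof -
    obtain t0 where v: "v = G t0" using \<open>v \<in> V\<close> unfolding V_def by blast
    have "A v = {t \<in> space M. \<forall>j\<in>{..<n}. g j t = v j}"
      unfolding A_def v G_def by (auto simp: fun_eq_iff restrict_def split: if_splits)
    also have "\<dots> \<in> sets M"
    proof (intro sets.sets_Collect_finite_All)
      fix j assume "j \<in> {..<n}"
      then have "g j -` {v j} \<inter> space M \<in> sets M" using sg by (intro simple_functionD(2)) auto
      also have "g j -` {v j} \<inter> space M = {t \<in> space M. g j t = v j}" by auto
      finally show "{t \<in> space M. g j t = v j} \<in> sets M" .
    qed simp
    finally show ?thesis .
  qed
  obtain h where h: "bij_betw h {..<card V} V"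
    using ex_bij_betw_nat_finite[OF fin] by (auto simp: atLeast0LessThan)
  have sumV: "(\<Sum>i<card V. F (h i)) = (\<Sum>v\<in>V. F v)" for F :: "_ \<Rightarrow> real"
    by (rule sum.reindex_bij_betw[OF h])
  show thesis
  proof (rule that[of "card V" "\<lambda>i. A (h i)"])
    show "A (h i) \<in> sets M" if "i < card V" for i
      using meas h that by (auto simp: bij_betw_def)
    show "disjoint_family_on (\<lambda>i. A (h i)) {..<card V}"
      using h by (auto simp: disjoint_family_on_def A_def bij_betw_def dest: inj_onD)
    fix j assume j: "j < n"
    let ?d = "\<lambda>t. norm (f j t - g j t)"
    have d: "integrable M ?d" using f[OF j] g[OF j] by auto
    have "(\<integral>t. norm (f j t) \<partial>M) \<le> (\<integral>t. norm (g j t) + ?d t \<partial>M)"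
      using f[OF j] g[OF j] by (intro integral_mono) (auto intro: norm_triangle_sub)
    also have "\<dots> = (\<integral>t. norm (g j t) \<partial>M) + (\<integral>t. ?d t \<partial>M)" using g[OF j] d by simp
    also have "(\<integral>t. norm (g j t) \<partial>M) = (\<Sum>v\<in>V. \<integral>t\<in>A v. norm (g j t) \<partial>M)"
      unfolding A_def using meas[unfolded A_def] g[OF j]
      by (intro sum_set_integral_partition[symmetric] fin) (auto simp: V_def)
    also have "\<dots> \<le> (\<Sum>v\<in>V. norm (\<integral>t\<in>A v. f j t \<partial>M) + (\<integral>t\<in>A v. ?d t \<partial>M))"
    proof (rule sum_mono)
      fix v assume v: "v \<in> V"
      note int = integrable_mult_indicator[OF meas[OF v]]
      have "(\<integral>t\<in>A v. norm (g j t) \<partial>M) = norm (\<integral>t\<in>A v. g j t \<partial>M)"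
        by (rule norm_integral_of_constant_on[OF meas[OF v] g[OF j], symmetric, of "v j"])
          (use j in \<open>auto simp: A_def G_def\<close>)
      also have "\<dots> = norm ((\<integral>t\<in>A v. f j t \<partial>M) - (\<integral>t\<in>A v. f j t - g j t \<partial>M))"
        unfolding set_lebesgue_integral_def using int[OF f[OF j]] int[OF g[OF j]]
        by (simp add: scaleR_diff_right)
      also have "\<dots> \<le> norm (\<integral>t\<in>A v. f j t \<partial>M) + norm (\<integral>t\<in>A v. f j t - g j t \<partial>M)"
        by (rule norm_triangle_ineq4)
      also have "norm (\<integral>t\<in>A v. f j t - g j t \<partial>M) \<le> (\<integral>t\<in>A v. ?d t \<partial>M)"
        unfolding set_lebesgue_integral_def by (rule order_trans[OF integral_norm_bound]) simp
      finally show "(\<integral>t\<in>A v. norm (g j t) \<partial>M) \<le> norm (\<integral>t\<in>A v. f j t \<partial>M) + (\<integral>t\<in>A v. ?d t \<partial>M)" by simp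
    qed
    also have "\<dots> = (\<Sum>v\<in>V. norm (\<integral>t\<in>A v. f j t \<partial>M)) + (\<integral>t. ?d t \<partial>M)"
      unfolding sum.distrib A_def using meas[unfolded A_def] d
      by (subst sum_set_integral_partition[OF fin]) (auto simp: V_def)
    finally show "(\<integral>t. norm (f j t) \<partial>M) - e \<le> (\<Sum>i<card V. norm (\<integral>t\<in>A (h i). f j t \<partial>M))"
      using fg[OF j] unfolding sumV[of "\<lambda>v. norm (\<integral>t\<in>A v. f j t \<partial>M)"] by simp
  qed
qed

lemma sum_norm_set_integral_le:
  fixes f :: "'m \<Rightarrow> 'b::{banach,second_countable_topology}"
  assumes A: "\<And>i. i < k \<Longrightarrow> A i \<in> sets M" and disj: "disjoint_family_on A {..<k::nat}" and f: "integrable M f"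
  shows "(\<Sum>i<k. norm (\<integral>t\<in>A i. f t \<partial>M)) \<le> (\<integral>t. norm (f t) \<partial>M)"
proof -
  have int: "integrable M (\<lambda>t. indicat_real (A i) t *\<^sub>R norm (f t))" if "i < k" for i
    using A[OF that] f by (intro integrable_mult_indicator integrable_norm)
  have "(\<Sum>i<k. norm (\<integral>t\<in>A i. f t \<partial>M)) \<le> (\<Sum>i<k. \<integral>t. indicat_real (A i) t *\<^sub>R norm (f t) \<partial>M)"
    unfolding set_lebesgue_integral_def
    by (intro sum_mono order_trans[OF integral_norm_bound]) simp
  also have "\<dots> = (\<integral>t. (\<Sum>i<k. indicat_real (A i) t *\<^sub>R norm (f t)) \<partial>M)"
    using int by (intro Bochner_Integration.integral_sum[symmetric]) auto
  also have "\<dots> \<le> (\<integral>t. norm (f t) \<partial>M)"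
  proof (rule integral_mono)
    show "integrable M (\<lambda>t. \<Sum>i<k. indicat_real (A i) t *\<^sub>R norm (f t))"
      using int by (intro Bochner_Integration.integrable_sum) auto
    show "integrable M (\<lambda>t. norm (f t))" using f by auto
    fix t
    have "(\<Sum>i<k. indicat_real (A i) t) = indicat_real (\<Union>i<k. A i) t"
      using disj by (intro indicator_UN_disjoint[symmetric]) auto
    also have "\<dots> \<le> 1" by (simp add: indicator_def)
    finally show "(\<Sum>i<k. indicat_real (A i) t *\<^sub>R norm (f t)) \<le> norm (f t)"
      unfolding real_scaleR_def sum_distrib_right[symmetric] by (intro mult_left_le_one_le) (auto simp: sum_nonneg)
  qed
  finally show ?thesis .
qed

subsection \<open>A non-summing operator into l1\<close>

text \<open>Neither coordinate of a pair exceeds its code, so initial segments of codes can be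
  compared with squares of indices.\<close>

lemma prod_decode_image_subset:
  "prod_decode ` {..<n} \<subseteq> {..<n} \<times> {..<n}"
proof
  fix z assume "z \<in> prod_decode ` {..<n}"
  then obtain p where p: "p < n" "z = prod_decode p" by auto
  have "prod_encode z = p" using p by simp
  then show "z \<in> {..<n} \<times> {..<n}"
    using le_prod_encode_1[of "fst z" "snd z"] le_prod_encode_2[of "snd z" "fst z"] p(1) by (cases z) auto
qed

lemma sum_prod_decode_le:
  fixes a :: "nat \<Rightarrow> nat \<Rightarrow> real"
  assumes "\<And>k i. 0 \<le> a k i"
  shows "(\<Sum>p<n. case prod_decode p of (k, i) \<Rightarrow> a k i) \<le> (\<Sum>k<n. \<Sum>i<n. a k i)"
proof -
  have "(\<Sum>p<n. case prod_decode p of (k, i) \<Rightarrow> a k i) = (\<Sum>z\<in>prod_decode ` {..<n}. case z of (k, i) \<Rightarrow> a k i)"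
    by (subst sum.reindex) (auto intro: inj_prod_decode)
  also have "\<dots> \<le> (\<Sum>z\<in>{..<n} \<times> {..<n}. case z of (k, i) \<Rightarrow> a k i)"
    using assms by (intro sum_mono2 prod_decode_image_subset) auto
  also have "\<dots> = (\<Sum>k<n. \<Sum>i<n. a k i)" by (simp add: sum.cartesian_product)
  finally show ?thesis .
qed

lemma sum_row_le_suminf_prod_decode:
  fixes a :: "nat \<Rightarrow> nat \<Rightarrow> real"
  assumes "summable (\<lambda>p. case prod_decode p of (k, i) \<Rightarrow> a k i)" "\<And>k i. 0 \<le> a k i"
  shows "(\<Sum>i<m. a k i) \<le> (\<Sum>p. case prod_decode p of (k, i) \<Rightarrow> a k i)"
proof -
  have "(\<Sum>i<m. a k i) = (\<Sum>p\<in>(\<lambda>i. prod_encode (k, i)) ` {..<m}. case prod_decode p of (k, i) \<Rightarrow> a k i)"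
    by (subst sum.reindex) (auto simp: inj_on_def)
  also have "\<dots> \<le> (\<Sum>p. case prod_decode p of (k, i) \<Rightarrow> a k i)"
    using assms by (intro sum_le_suminf) (auto split: prod.split)
  finally show ?thesis .
qed

lemma summable_prod_decode:
  fixes a :: "nat \<Rightarrow> nat \<Rightarrow> real"
  assumes nn: "\<And>k i. 0 \<le> a k i" and row: "\<And>k n. (\<Sum>i<n. a k i) \<le> (1 / 2) ^ k * B"
  shows "summable (\<lambda>p. case prod_decode p of (k, i) \<Rightarrow> a k i)"
    and "(\<Sum>p. case prod_decode p of (k, i) \<Rightarrow> a k i) \<le> 2 * B"
    and "(\<Sum>p<n. case prod_decode p of (k, i) \<Rightarrow> a k i) \<le> 2 * B"
proof -
  have B: "0 \<le> B" using row[of 0 0] by simp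
  have part: "(\<Sum>p<n. case prod_decode p of (k, i) \<Rightarrow> a k i) \<le> 2 * B" for n
  proof -
    have "(\<Sum>p<n. case prod_decode p of (k, i) \<Rightarrow> a k i) \<le> (\<Sum>k<n. (1 / 2) ^ k * B)"
      by (rule order_trans[OF sum_prod_decode_le[OF nn]]) (intro sum_mono row)
    also have "\<dots> = (\<Sum>k<n. (1 / 2) ^ k) * B" by (simp add: sum_distrib_right)
    also have "\<dots> \<le> 2 * B" using B by (intro mult_right_mono) (simp_all add: sum_gp_strict)
    finally show ?thesis .
  qed
  show "(\<Sum>p<n. case prod_decode p of (k, i) \<Rightarrow> a k i) \<le> 2 * B" by (rule part)
  show s: "summable (\<lambda>p. case prod_decode p of (k, i) \<Rightarrow> a k i)"
    using nn part by (intro summableI_nonneg_bounded[where x = "2 * B"]) (auto split: prod.split)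
  show "(\<Sum>p. case prod_decode p of (k, i) \<Rightarrow> a k i) \<le> 2 * B"
    using s part by (intro suminf_le_const) auto
qed

text \<open>The operator is \<open>\<Oplus>\<^sub>k 2\<^sup>-\<^sup>k u\<^sub>k\<close> into \<open>l\<^sub>1(\<nat> \<times> \<nat>)\<close>, where \<open>u\<^sub>k\<close> integrates over the cells of a partition
  adapted to the \<open>k\<close>-th of a sequence of finite families; the weakly summable sequence consists of
  these families, scaled by \<open>2\<^sup>-\<^sup>k\<close>.\<close>

proposition non_summing_operator_into_l1:
  fixes E :: "('k::{real_normed_field, banach, second_countable_topology}, 'u, 'z) nspace_scheme"
  assumes E: "normed_sp E" "infinite_dim E" and M: "embeds_in_L1 E M"
  obtains u :: "'u \<Rightarrow> nat \<Rightarrow> 'k" and D :: real and xs :: "nat \<Rightarrow> 'u" and B :: real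
  where "\<And>x y. x \<in> spc E \<Longrightarrow> y \<in> spc E \<Longrightarrow> u (vadd E x y) = (\<lambda>p. u x p + u y p)"
    "\<And>a x. x \<in> spc E \<Longrightarrow> u (vsmul E a x) = (\<lambda>p. a * u x p)"
    "\<And>x. x \<in> spc E \<Longrightarrow> summable (\<lambda>p. norm (u x p))"
    "\<And>x. x \<in> spc E \<Longrightarrow> (\<Sum>p. norm (u x p)) \<le> D * vnorm E x"
    "\<And>j. xs j \<in> spc E"
    "\<And>\<phi> n. \<phi> \<in> dual_ball E \<Longrightarrow> (\<Sum>j<n. norm (\<phi> (xs j))) \<le> B"
    "\<not> summable (\<lambda>j. \<Sum>p. norm (u (xs j) p))"
proof -
  have V: "vector_sp E" using E(1) by (simp add: normed_sp_def)
  obtain T c C where c: "0 < c"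
    and T: "\<forall>x\<in>spc E. \<forall>y\<in>spc E. T (vadd E x y) = (\<lambda>t. T x t + T y t)"
      "\<forall>a. \<forall>x\<in>spc E. T (vsmul E a x) = (\<lambda>t. a * T x t)"
      "\<forall>x\<in>spc E. integrable M (T x) \<and> c * vnorm E x \<le> (\<integral>t. norm (T x t) \<partial>M) \<and>
        (\<integral>t. norm (T x t) \<partial>M) \<le> C * vnorm E x"
    using M unfolding embeds_in_L1_def by (elim exE conjE)
  have Tadd: "T (vadd E x y) = (\<lambda>t. T x t + T y t)" if "x \<in> spc E" "y \<in> spc E" for x y
    using T(1) that by blast
  have Tsmul: "T (vsmul E a x) = (\<lambda>t. a * T x t)" if "x \<in> spc E" for a x
    using T(2) that by blast
  have Tint: "integrable M (T x)" and low: "c * vnorm E x \<le> (\<integral>t. norm (T x t) \<partial>M)"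
    and up: "(\<integral>t. norm (T x t) \<partial>M) \<le> C * vnorm E x" if "x \<in> spc E" for x
    using T(3) that by blast+
  \<comment> \<open>Both the operator and the vectors will be scaled by 2^-k, and 8^k / 4^k = 2^k
    still tends to infinity. The loss of 1 is the total discretization error.\<close>
  define good where "good k m x A K \<longleftrightarrow> (\<forall>j<m. x j \<in> spc E)
      \<and> (\<forall>\<phi>\<in>dual_ball E. (\<Sum>j<m. norm (\<phi> (x j))) \<le> 1)
      \<and> (\<forall>i<K. A i \<in> sets M) \<and> disjoint_family_on A {..<K}
      \<and> c * 8 ^ k - 1 \<le> (\<Sum>j<m. \<Sum>i<K. norm (\<integral>t\<in>A i. T (x j) t \<partial>M))"
    for k m K :: nat and x A
  have "\<exists>m x A K. good k m x A K" for k
  proof -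
    obtain m :: nat and x where x: "\<And>j. j < m \<Longrightarrow> x j \<in> spc E"
      and w: "\<And>\<phi>. \<phi> \<in> dual_ball E \<Longrightarrow> (\<Sum>j<m. norm (\<phi> (x j))) \<le> 1"
      and big: "8 ^ k \<le> (\<Sum>j<m. vnorm E (x j))"
      using weakly_summable_family_in_subspace_of_L1[OF E M, of "8 ^ k"] by blast
    \<comment> \<open>With tolerance 1 / (m + 1) per vector the m errors sum to less than 1, and m =
      0 needs no separate case.\<close>
    obtain A K where A: "\<And>i. i < K \<Longrightarrow> A i \<in> sets M" "disjoint_family_on A {..<K::nat}"
      and Ae: "\<And>j. j < m \<Longrightarrow> (\<integral>t. norm (T (x j) t) \<partial>M) - 1 / (real m + 1) \<le> (\<Sum>i<K. norm (\<integral>t\<in>A i. T (x j) t \<partial>M))"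
      by (rule finite_partition_approx[of m M "\<lambda>j. T (x j)" "1 / (real m + 1)"]) (use Tint x in auto)
    have "c * 8 ^ k - 1 \<le> c * (\<Sum>j<m. vnorm E (x j)) - real m * (1 / (real m + 1))"
      using big c by (intro diff_mono mult_left_mono) auto
    also have "\<dots> = (\<Sum>j<m. c * vnorm E (x j) - 1 / (real m + 1))"
      by (simp add: sum_subtractf sum_distrib_left)
    also have "\<dots> \<le> (\<Sum>j<m. \<Sum>i<K. norm (\<integral>t\<in>A i. T (x j) t \<partial>M))"
    proof (rule sum_mono)
      fix j assume "j \<in> {..<m}"
      then have j: "j < m" by simp
      show "c * vnorm E (x j) - 1 / (real m + 1) \<le> (\<Sum>i<K. norm (\<integral>t\<in>A i. T (x j) t \<partial>M))"
        using low[OF x[OF j]] Ae[OF j] by linarith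
    qed
    finally have "good k m x A K" unfolding good_def using x w A by simp
    then show ?thesis by blast
  qed
  then obtain m x A K where "\<And>k. good k (m k) (x k) (A k) (K k)" by metis
  note good = this[unfolded good_def]
  have x: "x k j \<in> spc E" if "j < m k" for k j using good that by blast
  have w: "(\<Sum>j<m k. norm (\<phi> (x k j))) \<le> 1" if "\<phi> \<in> dual_ball E" for k \<phi> using good that by blast
  have A: "A k i \<in> sets M" if "i < K k" for k i using good that by blast
  have disj: "disjoint_family_on (A k) {..<K k}" for k using good by blast
  have big: "c * 8 ^ k - 1 \<le> (\<Sum>j<m k. \<Sum>i<K k. norm (\<integral>t\<in>A k i. T (x k j) t \<partial>M))" for k
    using good by blast
  \<comment> \<open>Zero padding places finitely many cells in an infinite row; the finite families
    of vectors are padded in the same way by X.\<close>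
  define U where "U z k i = (if i < K k then (1 / 2) ^ k *\<^sub>R (\<integral>t\<in>A k i. T z t \<partial>M) else 0)" for z k i
  define u where "u z p = (case prod_decode p of (k, i) \<Rightarrow> U z k i)" for z p
  have nu: "norm (u z p) = (case prod_decode p of (k, i) \<Rightarrow> norm (U z k i))" for z p
    unfolding u_def by (simp split: prod.split)
  have rowle: "(\<Sum>i<n. norm (U z k i)) \<le> (1 / 2) ^ k * (\<integral>t. norm (T z t) \<partial>M)" if z: "z \<in> spc E" for n k z
  proof -
    have "(\<Sum>i<n. norm (U z k i)) \<le> (\<Sum>i<max n (K k). norm (U z k i))" by (rule sum_mono2) auto
    also have "\<dots> = (\<Sum>i<K k. norm (U z k i))" by (rule sum.mono_neutral_right) (auto simp: U_def)
    also have "\<dots> = (1 / 2) ^ k * (\<Sum>i<K k. norm (\<integral>t\<in>A k i. T z t \<partial>M))"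
      by (simp add: U_def sum_distrib_left)
    also have "\<dots> \<le> (1 / 2) ^ k * (\<integral>t. norm (T z t) \<partial>M)"
      using A disj Tint[OF z] by (intro mult_left_mono sum_norm_set_integral_le) auto
    finally show ?thesis .
  qed
  have sumu: "summable (\<lambda>p. norm (u z p))" "(\<Sum>p. norm (u z p)) \<le> 2 * (\<integral>t. norm (T z t) \<partial>M)" if z: "z \<in> spc E" for z
    unfolding nu
    by (rule summable_prod_decode[where a = "\<lambda>k i. norm (U z k i)", OF norm_ge_zero rowle[OF z]])+
  define X where "X k j = (if j < m k then vsmul E (of_real ((1 / 2) ^ k)) (x k j) else vzero E)" for k j
  define xs where "xs p = (case prod_decode p of (k, j) \<Rightarrow> X k j)" for p
  have XE: "X k j \<in> spc E" for k j unfolding X_def using x V by simp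
  have half: "norm (of_real ((1 / 2) ^ k) :: 'k) = (1 / 2) ^ k" for k unfolding norm_of_real by simp
  have weak: "(\<Sum>p<n. norm (\<phi> (xs p))) \<le> 2" if \<phi>: "\<phi> \<in> dual_ball E" for \<phi> n
  proof -
    have \<phi>smul: "\<phi> (vsmul E a y) = a * \<phi> y" if "y \<in> spc E" for a y
      using \<phi> that by (simp add: dual_ball_def dual_def)
    have \<phi>0: "\<phi> (vzero E) = 0" using \<phi>smul[of "vzero E" 0] V by simp
    have row: "(\<Sum>j<n. norm (\<phi> (X k j))) \<le> (1 / 2) ^ k * 1" for k n
    proof -
      have "(\<Sum>j<n. norm (\<phi> (X k j))) \<le> (\<Sum>j<max n (m k). norm (\<phi> (X k j)))" by (rule sum_mono2) auto
      also have "\<dots> = (\<Sum>j<m k. norm (\<phi> (X k j)))" by (rule sum.mono_neutral_right) (auto simp: X_def \<phi>0)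
      also have "\<dots> = (\<Sum>j<m k. (1 / 2) ^ k * norm (\<phi> (x k j)))"
        unfolding X_def using x by (intro sum.cong refl) (simp only: lessThan_iff if_True \<phi>smul norm_mult half)
      also have "\<dots> = (1 / 2) ^ k * (\<Sum>j<m k. norm (\<phi> (x k j)))" by (simp add: sum_distrib_left)
      also have "\<dots> \<le> (1 / 2) ^ k * 1" using w[OF \<phi>] by (intro mult_left_mono) auto
      finally show ?thesis .
    qed
    have "norm (\<phi> (xs p)) = (case prod_decode p of (k, j) \<Rightarrow> norm (\<phi> (X k j)))" for p
      unfolding xs_def by (simp split: prod.split)
    then show ?thesis
      using summable_prod_decode(3)[where a = "\<lambda>k j. norm (\<phi> (X k j))", OF norm_ge_zero row, of n] by simp
  qed
  have Uhom: "U (vsmul E a z) k i = a * U z k i" if "z \<in> spc E" for a z k i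
    unfolding U_def Tsmul[OF that] set_lebesgue_integral_def by (simp flip: mult_scaleR_right)
  have Uadd: "U (vadd E y z) k i = U y k i + U z k i" if "y \<in> spc E" "z \<in> spc E" for y z k i
  proof (cases "i < K k")
    case True
    have "integrable M (\<lambda>t. indicat_real (A k i) t *\<^sub>R T y t)" "integrable M (\<lambda>t. indicat_real (A k i) t *\<^sub>R T z t)"
      using A[OF True] Tint that by (auto intro: integrable_mult_indicator)
    then show ?thesis unfolding U_def Tadd[OF that] set_lebesgue_integral_def
      by (simp add: scaleR_add_right)
  qed (simp add: U_def)
  have diverge: "\<not> summable (\<lambda>j. \<Sum>p. norm (u (xs j) p))"
  proof
    assume s: "summable (\<lambda>j. \<Sum>p. norm (u (xs j) p))"
    define S where "S = (\<Sum>j. \<Sum>p. norm (u (xs j) p))"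
    have eq: "(\<Sum>p. norm (u (xs q) p)) = (case prod_decode q of (k, j) \<Rightarrow> \<Sum>p. norm (u (X k j) p))" for q
      unfolding xs_def by (simp split: prod.split)
    have nn: "0 \<le> (\<Sum>p. norm (u (X k j) p))" for k j using sumu(1)[OF XE] by (rule suminf_nonneg) simp
    have "c * 2 ^ k - 1 \<le> S" for k
    proof -
      have "(1 / 4) ^ k * (c * 8 ^ k - 1) \<le> (1 / 4) ^ k * (\<Sum>j<m k. \<Sum>i<K k. norm (\<integral>t\<in>A k i. T (x k j) t \<partial>M))"
        using big by (intro mult_left_mono) auto
      also have "\<dots> = (\<Sum>j<m k. \<Sum>i<K k. norm (U (X k j) k i))"
      proof -
        have q: "((1 / 4 :: real)) ^ k = (1 / 2) ^ k * (1 / 2) ^ k" by (simp flip: power_mult_distrib)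
        have "norm (U (X k j) k i) = (1 / 4) ^ k * norm (\<integral>t\<in>A k i. T (x k j) t \<partial>M)" if "j < m k" "i < K k" for j i
        proof -
          have "U (X k j) k i = of_real ((1 / 2) ^ k) * U (x k j) k i"
            unfolding X_def using that x by (simp only: if_True Uhom)
          then have "norm (U (X k j) k i) = (1 / 2) ^ k * norm (U (x k j) k i)" by (simp only: norm_mult half)
          then show ?thesis unfolding q using that by (simp add: U_def)
        qed
        then show ?thesis by (simp add: sum_distrib_left)
      qed
      \<comment> \<open>Only the k-th block of the operator is kept here, and next only the k-th row
        of the sequence \<open>xs\<close>.\<close>
      also have "\<dots> \<le> (\<Sum>j<m k. \<Sum>p. norm (u (X k j) p))"
        unfolding nu by (intro sum_mono sum_row_le_suminf_prod_decode) (use sumu(1)[OF XE] in \<open>simp_all add: nu\<close>)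
      also have "\<dots> \<le> S"
        unfolding S_def eq by (rule sum_row_le_suminf_prod_decode) (use s nn in \<open>simp_all add: eq\<close>)
      finally have "(1 / 4) ^ k * (c * 8 ^ k - 1) \<le> S" .
      moreover have "(1 / 4) ^ k * (c * 8 ^ k) = c * 2 ^ k" by (simp add: power_one_over field_simps flip: power_mult_distrib)
      moreover have "(1 / 4 :: real) ^ k \<le> 1" by (intro power_le_one) auto
      ultimately show ?thesis by (simp add: right_diff_distrib)
    qed
    moreover obtain k where "(S + 1) / c < 2 ^ k" using real_arch_pow[of 2 "(S + 1) / c"] by auto
    ultimately show False using c by (smt (verit) mult.commute pos_divide_less_eq)
  qed
  show thesis
  proof (rule that[of u "2 * C" xs 2])
    show "u (vadd E y z) = (\<lambda>p. u y p + u z p)" if "y \<in> spc E" "z \<in> spc E" for y z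
      unfolding u_def by (auto simp: Uadd[OF that] split: prod.split)
    show "u (vsmul E a z) = (\<lambda>p. a * u z p)" if "z \<in> spc E" for a z
      unfolding u_def by (auto simp: Uhom[OF that] split: prod.split)
    show "(\<Sum>p. norm (u z p)) \<le> 2 * C * vnorm E z" if "z \<in> spc E" for z
      using sumu(2)[OF that] up[OF that] by simp
    show "xs j \<in> spc E" for j unfolding xs_def using XE by (simp split: prod.split)
  qed (use sumu(1) weak diverge in auto)
qed

subsection \<open>Normed spaces and sequences\<close>

context
  fixes X :: "('k::real_normed_field, 'u, 'z) nspace_scheme"
  assumes X: "normed_sp X"
begin

lemma normed_sp_vector_sp: "vector_sp X"
  and vnorm_nonneg: "x \<in> spc X \<Longrightarrow> 0 \<le> vnorm X x"
  and vnorm_eq_0_iff: "x \<in> spc X \<Longrightarrow> vnorm X x = 0 \<longleftrightarrow> x = vzero X"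
  and vnorm_vsmul: "x \<in> spc X \<Longrightarrow> vnorm X (vsmul X a x) = norm a * vnorm X x"
  and vnorm_triangle: "x \<in> spc X \<Longrightarrow> y \<in> spc X \<Longrightarrow> vnorm X (vadd X x y) \<le> vnorm X x + vnorm X y"
  using X by (simp_all add: normed_sp_def)

lemma vsub_chain:
  assumes "x \<in> spc X" "y \<in> spc X" "z \<in> spc X"
  shows "vadd X (vsub X x y) (vsub X y z) = vsub X x z"
proof -
  note V = normed_sp_vector_sp
  have "vadd X (vsub X x y) (vsub X y z) = vadd X x (vadd X (vadd X (vsmul X (- 1) y) y) (vsmul X (- 1) z))"
    using assms V by (simp add: vsub_def vadd_assoc[OF V] vsmul_mem)
  also have "vadd X (vsmul X (- 1) y) y = vzero X"
    using assms V vadd_commute[OF V, of "vsmul X (- 1) y" y] by simp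
  finally show ?thesis using assms V by (simp add: vsub_def)
qed

lemma vsub_self: "x \<in> spc X \<Longrightarrow> vsub X x x = vzero X"
  using normed_sp_vector_sp by (simp add: vsub_def)

lemma vsub_eq_zeroD:
  assumes "x \<in> spc X" "y \<in> spc X" "vsub X x y = vzero X"
  shows "x = y"
proof -
  note V = normed_sp_vector_sp
  have "vadd X (vsub X x y) (vsub X y (vzero X)) = vsub X x (vzero X)"
    using assms V by (intro vsub_chain) auto
  then show ?thesis using assms V by (simp add: vsub_def)
qed

lemma vnorm_vsub_commute:
  assumes "x \<in> spc X" "y \<in> spc X"
  shows "vnorm X (vsub X x y) = vnorm X (vsub X y x)"
proof -
  note V = normed_sp_vector_sp
  have "vsub X y x = vsmul X (- 1) (vsub X x y)"
    using assms V by (simp add: vsub_def vsmul_vadd[OF V] vsmul_mult[OF V, symmetric] vadd_commute[OF V])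
  then show ?thesis using assms V by (simp add: vnorm_vsmul)
qed

lemma vnorm_vsub_triangle:
  assumes "x \<in> spc X" "y \<in> spc X" "z \<in> spc X"
  shows "vnorm X (vsub X x z) \<le> vnorm X (vsub X x y) + vnorm X (vsub X y z)"
  using vnorm_triangle[of "vsub X x y" "vsub X y z"] assms normed_sp_vector_sp
  by (simp add: vsub_chain)

lemma limit_unique:
  assumes s: "\<And>n. s n \<in> spc X" and x: "x \<in> spc X" "(\<lambda>n. vnorm X (vsub X (s n) x)) \<longlonglongrightarrow> 0"
    and y: "y \<in> spc X" "(\<lambda>n. vnorm X (vsub X (s n) y)) \<longlonglongrightarrow> 0"
  shows "x = y"
proof -
  have "(\<lambda>n. vnorm X (vsub X (s n) x) + vnorm X (vsub X (s n) y)) \<longlonglongrightarrow> 0 + 0"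
    by (intro tendsto_add x y)
  moreover have "vnorm X (vsub X x y) \<le> vnorm X (vsub X (s n) x) + vnorm X (vsub X (s n) y)" for n
    using vnorm_vsub_triangle[of x "s n" y] vnorm_vsub_commute[of x "s n"] s x y by simp
  ultimately have "vnorm X (vsub X x y) \<le> 0 + 0" by (intro LIMSEQ_le_const) auto
  then have "vsub X x y = vzero X"
    using vnorm_eq_0_iff[of "vsub X x y"] vnorm_nonneg[of "vsub X x y"] x y normed_sp_vector_sp by simp
  then show ?thesis using vsub_eq_zeroD x y by blast
qed

end

section \<open>Completeness of l1, tensor products of sequences, operator norms\<close>

lemma l1_complete:
  fixes a :: "nat \<Rightarrow> nat \<Rightarrow> 'k::banach"
  assumes a: "\<And>n. summable (\<lambda>p. norm (a n p))"
    and cauchy: "\<And>e. 0 < e \<Longrightarrow> \<exists>N. \<forall>m\<ge>N. \<forall>n\<ge>N. (\<Sum>p. norm (a m p - a n p)) < e"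
  obtains b where "summable (\<lambda>p. norm (b p))" "(\<lambda>n. \<Sum>p. norm (a n p - b p)) \<longlonglongrightarrow> 0"
proof -
  have sd: "summable (\<lambda>p. norm (a m p - a n p))" for m n
    by (rule summable_comparison_test'[OF summable_add[OF a[of m] a[of n]], of 0]) (simp add: norm_triangle_ineq4)
  have part: "(\<Sum>p<P. norm (a m p - a n p)) \<le> (\<Sum>p. norm (a m p - a n p))" for m n P
    using sd by (intro sum_le_suminf) auto
  have "Cauchy (\<lambda>n. a n p)" for p
  proof (rule metric_CauchyI)
    fix e :: real assume "0 < e"
    then obtain N where N: "\<And>m n. m \<ge> N \<Longrightarrow> n \<ge> N \<Longrightarrow> (\<Sum>p. norm (a m p - a n p)) < e" using cauchy by blast
    have "norm (a m p - a n p) \<le> (\<Sum>p. norm (a m p - a n p))" for m n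
      using sum_le_suminf[OF sd[of m n], of "{p}"] by simp
    then show "\<exists>N. \<forall>m\<ge>N. \<forall>n\<ge>N. dist (a m p) (a n p) < e"
      using N unfolding dist_norm by (meson le_less_trans)
  qed
  then have "\<exists>l. (\<lambda>n. a n p) \<longlonglongrightarrow> l" for p by (simp add: Cauchy_convergent_iff convergent_def)
  then obtain b where b: "\<And>p. (\<lambda>n. a n p) \<longlonglongrightarrow> b p" by metis
  have tail: "\<exists>N. \<forall>m\<ge>N. \<forall>P. (\<Sum>p<P. norm (a m p - b p)) \<le> e" if "0 < e" for e
  proof -
    obtain N where N: "\<And>m n. m \<ge> N \<Longrightarrow> n \<ge> N \<Longrightarrow> (\<Sum>p. norm (a m p - a n p)) < e" using cauchy[OF \<open>0 < e\<close>] by blast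
    have "(\<Sum>p<P. norm (a m p - b p)) \<le> e" if m: "m \<ge> N" for m P
    proof (rule LIMSEQ_le_const2)
      show "(\<lambda>n. \<Sum>p<P. norm (a m p - a n p)) \<longlonglongrightarrow> (\<Sum>p<P. norm (a m p - b p))"
        by (intro tendsto_intros b)
      show "\<exists>N. \<forall>n\<ge>N. (\<Sum>p<P. norm (a m p - a n p)) \<le> e"
        using N[OF m] part[of m _ P] by (meson le_less_trans less_imp_le)
    qed
    then show ?thesis by blast
  qed
  obtain N where N: "\<And>m P. m \<ge> N \<Longrightarrow> (\<Sum>p<P. norm (a m p - b p)) \<le> 1" using tail[of 1] by auto
  have "summable (\<lambda>p. norm (a N p - b p))"
    by (rule summableI_nonneg_bounded[of _ 1]) (use N in auto)
  from summable_add[OF this a[of N]] have sb: "summable (\<lambda>p. norm (b p))"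
    by (rule summable_comparison_test'[of _ 0]) (simp add: norm_minus_commute norm_triangle_sub add.commute)
  have sab: "summable (\<lambda>p. norm (a n p - b p))" for n
    by (rule summable_comparison_test'[OF summable_add[OF a[of n] sb], of 0]) (simp add: norm_triangle_ineq4)
  have "(\<lambda>n. \<Sum>p. norm (a n p - b p)) \<longlonglongrightarrow> 0"
  proof (rule LIMSEQ_I)
    fix r :: real assume "0 < r"
    then obtain N where N: "\<And>m P. m \<ge> N \<Longrightarrow> (\<Sum>p<P. norm (a m p - b p)) \<le> r / 2"
      using tail[of "r / 2"] by auto
    have "norm ((\<Sum>p. norm (a n p - b p)) - 0) < r" if "n \<ge> N" for n
      using suminf_le_const[OF sab[of n] N[OF that]] suminf_nonneg[OF sab[of n]] \<open>0 < r\<close> by simp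
    then show "\<exists>N. \<forall>n\<ge>N. norm ((\<Sum>p. norm (a n p - b p)) - 0) < r" by blast
  qed
  then show thesis using that sb by blast
qed

text \<open>The codes with first coordinate i form the i-th copy of the index set, and that copy
  carries a i times y.\<close>

definition tensor :: "(nat \<Rightarrow> 'k) \<Rightarrow> (nat \<Rightarrow> 'k) \<Rightarrow> nat \<Rightarrow> 'k::times" where
  "tensor a y p = (case prod_decode p of (i, j) \<Rightarrow> a i * y j)"

lemma tensor_add_left: "tensor (\<lambda>i. a i + b i) y = (\<lambda>p. tensor a y p + tensor b y p :: 'k::semiring)"
  and tensor_add_right: "tensor a (\<lambda>j. y j + z j) = (\<lambda>p. tensor a y p + tensor a z p)"
  by (auto simp: tensor_def algebra_simps split: prod.split)

lemma tensor_scale_left: "tensor (\<lambda>i. r * a i) y = (\<lambda>p. r * tensor a y p :: 'k::comm_semiring)"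
  and tensor_scale_right: "tensor a (\<lambda>j. r * y j) = (\<lambda>p. r * tensor a y p)"
  by (auto simp: tensor_def algebra_simps split: prod.split)

lemma tensor_diff_left: "tensor (\<lambda>i. a i - b i) y = (\<lambda>p. tensor a y p - tensor b y p :: 'k::ring)"
  by (auto simp: tensor_def algebra_simps split: prod.split)

text \<open>Initial segments of codes lie in squares, which gives \<le>; squares are finite sets of
  codes and their sums are products of partial sums, which gives \<ge>. The product formula makes
  the tensor map bounded below as well as above.\<close>

lemma
  fixes a y :: "nat \<Rightarrow> 'k::real_normed_field"
  assumes a: "summable (\<lambda>i. norm (a i))" and y: "summable (\<lambda>j. norm (y j))"
  shows summable_tensor: "summable (\<lambda>p. norm (tensor a y p))"
    and suminf_tensor: "(\<Sum>p. norm (tensor a y p)) = (\<Sum>i. norm (a i)) * (\<Sum>j. norm (y j))"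
proof -
  let ?A = "\<Sum>i. norm (a i)" and ?Y = "\<Sum>j. norm (y j)"
  have eq: "norm (tensor a y p) = (case prod_decode p of (i, j) \<Rightarrow> norm (a i) * norm (y j))" for p
    by (simp add: tensor_def norm_mult split: prod.split)
  have A0: "0 \<le> ?A" using a by (rule suminf_nonneg) simp
  have part: "(\<Sum>p<n. norm (tensor a y p)) \<le> ?A * ?Y" for n
  proof -
    have "(\<Sum>p<n. norm (tensor a y p)) \<le> (\<Sum>i<n. \<Sum>j<n. norm (a i) * norm (y j))"
      unfolding eq by (rule sum_prod_decode_le) simp
    also have "\<dots> = (\<Sum>i<n. norm (a i)) * (\<Sum>j<n. norm (y j))" by (simp add: sum_product)
    also have "\<dots> \<le> ?A * ?Y"
      using a y A0 by (intro mult_mono sum_le_suminf) (auto simp: sum_nonneg)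
    finally show ?thesis .
  qed
  show s: "summable (\<lambda>p. norm (tensor a y p))"
    by (rule summableI_nonneg_bounded[OF _ part]) simp
  have "(\<lambda>n. (\<Sum>i<n. norm (a i)) * (\<Sum>j<n. norm (y j))) \<longlonglongrightarrow> ?A * ?Y"
    using a y by (intro tendsto_mult summable_LIMSEQ)
  moreover have "(\<Sum>i<n. norm (a i)) * (\<Sum>j<n. norm (y j)) \<le> (\<Sum>p. norm (tensor a y p))" for n
  proof -
    have "(\<Sum>i<n. norm (a i)) * (\<Sum>j<n. norm (y j)) = (\<Sum>z\<in>{..<n} \<times> {..<n}. norm (tensor a y (prod_encode z)))"
      by (simp add: sum_product sum.cartesian_product eq split_beta)
    also have "\<dots> = (\<Sum>p\<in>prod_encode ` ({..<n} \<times> {..<n}). norm (tensor a y p))"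
      by (subst sum.reindex) (auto intro: inj_prod_encode)
    also have "\<dots> \<le> (\<Sum>p. norm (tensor a y p))"
      using s by (intro sum_le_suminf) auto
    finally show ?thesis .
  qed
  ultimately have "?A * ?Y \<le> (\<Sum>p. norm (tensor a y p))" by (intro LIMSEQ_le_const2) auto
  moreover have "(\<Sum>p. norm (tensor a y p)) \<le> ?A * ?Y" using s part by (rule suminf_le_const)
  ultimately show "(\<Sum>p. norm (tensor a y p)) = ?A * ?Y" by simp
qed

text \<open>The infimum is itself admissible: for x of nonzero norm, the quotient of the norms of f
  x and x is a lower bound of all admissible constants.\<close>

lemma vnorm_le_opnorm:
  assumes X: "normed_sp X" and f: "f \<in> ops X Y" and x: "x \<in> spc X"
  shows "vnorm Y (f x) \<le> opnorm X Y f * vnorm X x"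
proof -
  obtain C where C: "\<And>x. x \<in> spc X \<Longrightarrow> vnorm Y (f x) \<le> C * vnorm X x" using f by (auto simp: ops_def)
  show ?thesis
  proof (cases "vnorm X x = 0")
    case True
    then show ?thesis using C[OF x] by simp
  next
    case False
    then have v: "0 < vnorm X x" using vnorm_nonneg[OF X x] by simp
    have "vnorm Y (f x) / vnorm X x \<le> opnorm X Y f"
      unfolding opnorm_def
    proof (rule cInf_greatest)
      have "vnorm Y (f z) \<le> max C 0 * vnorm X z" if "z \<in> spc X" for z
        using C[OF that] mult_right_mono[of C "max C 0" "vnorm X z"] vnorm_nonneg[OF X that] by simp
      then show "{C. 0 \<le> C \<and> (\<forall>x\<in>spc X. vnorm Y (f x) \<le> C * vnorm X x)} \<noteq> {}"
        by (auto intro!: exI[of _ "max C 0"])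
    qed (use x v in \<open>auto simp: divide_le_eq\<close>)
    then show ?thesis using v by (simp add: divide_le_eq)
  qed
qed

text \<open>The N + 1 unit sequences with index at most N are independent, so by the exchange
  theorem they cannot all lie in the span of N sequences.\<close>

lemma unit_sequences_not_in_finite_span:
  fixes \<beta> :: "nat \<Rightarrow> nat \<Rightarrow> 'k::field"
  shows "\<exists>k\<le>N. \<forall>c. (\<lambda>n. if n = k then 1 else 0) \<noteq> (\<lambda>n. \<Sum>i<N. c i * \<beta> i n)"
proof (rule ccontr)
  assume contra: "\<not> ?thesis"
  interpret vs: vector_space "\<lambda>(c::'k) (f::nat \<Rightarrow> 'k) n. c * f n"
    by unfold_locales (auto simp: plus_fun_def algebra_simps)
  have app: "(\<Sum>v\<in>A. g v) n = (\<Sum>v\<in>A. g v n)" for g :: "'z \<Rightarrow> nat \<Rightarrow> 'k" and A n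
    by (induction A rule: infinite_finite_induct) auto
  define e where "e k = (\<lambda>n. if n = k then 1 else 0 :: 'k)" for k :: nat
  have inj: "inj e" by (rule injI) (metis e_def zero_neq_one)
  have "e k \<in> vs.span (\<beta> ` {..<N})" if "k \<le> N" for k
  proof -
    obtain c where "e k = (\<lambda>n. \<Sum>i<N. c i * \<beta> i n)" using contra \<open>k \<le> N\<close> unfolding e_def by blast
    then have "e k = (\<Sum>i<N. (\<lambda>n. c i * \<beta> i n))" by (auto simp: app)
    also have "\<dots> \<in> vs.span (\<beta> ` {..<N})"
      by (intro vs.span_sum vs.span_scale vs.span_base) auto
    finally show ?thesis .
  qed
  then have sub: "e ` {..N} \<subseteq> vs.span (\<beta> ` {..<N})" by auto
  have "vs.independent (e ` {..N})"
  proof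
    assume "vs.dependent (e ` {..N})"
    then obtain u k where k: "k \<le> N" "u (e k) \<noteq> 0" and 0: "(\<Sum>v\<in>e ` {..N}. (\<lambda>n. u v * v n)) = 0"
      by (auto simp: vs.dependent_finite)
    have "0 = (\<Sum>v\<in>e ` {..N}. (\<lambda>n. u v * v n)) k" unfolding 0 by simp
    also have "\<dots> = (\<Sum>i\<le>N. u (e i) * e i k)"
      unfolding app using inj by (subst sum.reindex) (auto intro: inj_on_subset)
    also have "\<dots> = u (e k)" using k(1) by (simp add: e_def if_distrib[of "\<lambda>z. _ * z"] cong: if_cong)
    finally show False using k(2) by simp
  qed
  then have "card (e ` {..N}) \<le> card (\<beta> ` {..<N})"
    using vs.independent_span_bound[of "\<beta> ` {..<N}" "e ` {..N}"] sub by simp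
  moreover have "card (e ` {..N}) = Suc N" using inj by (subst card_image) (auto intro: inj_on_subset)
  moreover have "card (\<beta> ` {..<N}) \<le> N" using card_image_le[of "{..<N}" \<beta>] by simp
  ultimately show False by simp
qed

subsection \<open>The subspace of the operator ideal\<close>

text \<open>\<open>J\<close>, \<open>c\<close>, \<open>C\<close> unpack an embedding of l1 into F,
  and \<open>u\<close> is a bounded nonzero operator from E into l1. Non-summability of
  \<open>u\<close> is kept out and enters only in \<open>not_abs_1_summing\<close>.\<close>

locale l1_factorization =
  fixes E F :: "('k::{real_normed_field, banach}, 'u) nspace"
    and I :: "('k, 'u) nspace \<Rightarrow> ('k, 'u) nspace \<Rightarrow> ('u \<Rightarrow> 'u) set"
    and nI :: "('k, 'u) nspace \<Rightarrow> ('k, 'u) nspace \<Rightarrow> ('u \<Rightarrow> 'u) \<Rightarrow> real"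
    and J :: "(nat \<Rightarrow> 'k) \<Rightarrow> 'u" and c C :: real
    and u :: "'u \<Rightarrow> nat \<Rightarrow> 'k" and D :: real
  assumes E: "banach_sp E" and F: "banach_sp F" and ideal: "banach_op_ideal I nI"
    and id_l1: "\<And>L. banach_sp L \<Longrightarrow> isomorphic_to_l1 L \<Longrightarrow> idop L \<in> I L L"
    and c: "0 < c"
    and J_add: "\<And>a b. summable (\<lambda>n. norm (a n)) \<Longrightarrow> summable (\<lambda>n. norm (b n)) \<Longrightarrow>
      J (\<lambda>n. a n + b n) = vadd F (J a) (J b)"
    and J_smul: "\<And>s a. summable (\<lambda>n. norm (a n)) \<Longrightarrow> J (\<lambda>n. s * a n) = vsmul F s (J a)"
    and J_mem: "\<And>a. summable (\<lambda>n. norm (a n)) \<Longrightarrow> J a \<in> spc F"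
    and J_low: "\<And>a. summable (\<lambda>n. norm (a n)) \<Longrightarrow> c * (\<Sum>n. norm (a n)) \<le> vnorm F (J a)"
    and J_up: "\<And>a. summable (\<lambda>n. norm (a n)) \<Longrightarrow> vnorm F (J a) \<le> C * (\<Sum>n. norm (a n))"
    and u_add: "\<And>x y. x \<in> spc E \<Longrightarrow> y \<in> spc E \<Longrightarrow> u (vadd E x y) = (\<lambda>p. u x p + u y p)"
    and u_smul: "\<And>s x. x \<in> spc E \<Longrightarrow> u (vsmul E s x) = (\<lambda>p. s * u x p)"
    and u_l1: "\<And>x. x \<in> spc E \<Longrightarrow> summable (\<lambda>p. norm (u x p))"
    and u_bound: "\<And>x. x \<in> spc E \<Longrightarrow> (\<Sum>p. norm (u x p)) \<le> D * vnorm E x"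
    and u_nonzero: "\<exists>x\<in>spc E. (\<Sum>p. norm (u x p)) \<noteq> 0"
begin

abbreviation l1 :: "(nat \<Rightarrow> 'k) \<Rightarrow> bool" where "l1 a \<equiv> summable (\<lambda>n. norm (a n))"
abbreviation l1_norm :: "(nat \<Rightarrow> 'k) \<Rightarrow> real" where "l1_norm a \<equiv> (\<Sum>n. norm (a n))"

lemma NE: "normed_sp E" and NF: "normed_sp F"
  using E F by (simp_all add: banach_sp_def)

lemma VE: "vector_sp E" and VF: "vector_sp F"
  using NE NF by (simp_all add: normed_sp_def)

lemma l1_add: "l1 a \<Longrightarrow> l1 b \<Longrightarrow> l1 (\<lambda>n. a n + b n)"
  by (rule summable_comparison_test'[OF summable_add, of "\<lambda>n. norm (a n)" "\<lambda>n. norm (b n)" 0])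
    (auto simp: norm_triangle_ineq)

lemma l1_smul: "l1 a \<Longrightarrow> l1 (\<lambda>n. s * a n)"
  by (simp add: norm_mult summable_mult)

lemma l1_diff: "l1 a \<Longrightarrow> l1 b \<Longrightarrow> l1 (\<lambda>n. a n - b n)"
  using l1_add[OF _ l1_smul[of b "- 1"], of a] by simp

lemma l1_norm_nonneg: "l1 a \<Longrightarrow> 0 \<le> l1_norm a"
  by (rule suminf_nonneg) simp_all

lemma J_diff: "l1 a \<Longrightarrow> l1 b \<Longrightarrow> J (\<lambda>n. a n - b n) = vsub F (J a) (J b)"
  using J_add[OF _ l1_smul[of b "- 1"], of a] J_smul[of b "- 1"] by (simp add: vsub_def)

lemma J_zero: "J (\<lambda>n. 0) = vzero F"
  using J_smul[of "\<lambda>n. 0" 0] J_mem[of "\<lambda>n. 0"] VF by simp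

text \<open>A copy of l1 with carrier in the universe \<open>'u\<close>, so that the hypothesis on
  the identity of l1 applies to it.\<close>

definition L :: "('k, 'u) nspace" where "L = F\<lparr>spc := J ` Collect l1\<rparr>"

lemma L_simps [simp]: "spc L = J ` Collect l1" "vadd L = vadd F" "vzero L = vzero F"
    "vsmul L = vsmul F" "vnorm L = vnorm F"
  by (simp_all add: L_def)

lemma vsub_L [simp]: "vsub L = vsub F"
  by (intro ext) (simp add: vsub_def)

lemma normed_sp_L: "normed_sp L"
proof -
  have mem: "x \<in> spc F" if "x \<in> J ` Collect l1" for x using that J_mem by auto
  have "vector_sp L"
    unfolding vector_sp_def L_simps
  proof (intro conjI ballI allI)
    show "vzero F \<in> J ` Collect l1" using J_zero by (intro image_eqI[of _ _ "\<lambda>n. 0"]) auto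
    show "vadd F x y \<in> J ` Collect l1" if "x \<in> J ` Collect l1" "y \<in> J ` Collect l1" for x y
      using that l1_add by (auto simp flip: J_add)
    show s: "vsmul F a x \<in> J ` Collect l1" if "x \<in> J ` Collect l1" for a x
      using that l1_smul by (auto simp flip: J_smul)
    show "\<exists>y\<in>J ` Collect l1. vadd F x y = vzero F" if x: "x \<in> J ` Collect l1" for x
      using s[OF x, of "- 1"] mem[OF x] VF by (intro bexI[of _ "vsmul F (- 1) x"]) auto
  qed (use mem VF in \<open>auto simp: vadd_assoc vsmul_vadd vsmul_add vsmul_mult intro: vadd_commute\<close>)
  then show ?thesis unfolding normed_sp_def L_simps using mem NF by (auto simp: normed_sp_def)
qed

text \<open>\<open>J\<close> is bounded below, so Cauchy sequences pull back to l1, converge there,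
  and are mapped back by the bounded \<open>J\<close>.\<close>

lemma banach_sp_L: "banach_sp L"
  unfolding banach_sp_def
proof (intro conjI allI impI normed_sp_L, elim conjE)
  fix s :: "nat \<Rightarrow> 'u"
  assume s: "\<forall>n. s n \<in> spc L"
    and cauchy: "\<forall>e>0. \<exists>N. \<forall>m\<ge>N. \<forall>n\<ge>N. vnorm L (vsub L (s m) (s n)) < e"
  from s have "\<exists>a. l1 a \<and> s n = J a" for n by auto
  then obtain a where a: "\<And>n. l1 (a n)" and sa: "\<And>n. s n = J (a n)" by metis
  have le: "c * (\<Sum>p. norm (a m p - a n p)) \<le> vnorm L (vsub L (s m) (s n))" for m n
    using J_low[OF l1_diff[OF a a], of m n] J_diff[OF a a, of m n] by (simp add: sa)
  have cau: "\<exists>N. \<forall>m\<ge>N. \<forall>n\<ge>N. (\<Sum>p. norm (a m p - a n p)) < e" if "0 < e" for e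
  proof -
    obtain N where "\<forall>m\<ge>N. \<forall>n\<ge>N. vnorm L (vsub L (s m) (s n)) < c * e"
      using cauchy c \<open>0 < e\<close> by (meson mult_pos_pos)
    then have "c * (\<Sum>p. norm (a m p - a n p)) < c * e" if "m \<ge> N" "n \<ge> N" for m n
      using le[of m n] that by (meson le_less_trans)
    then show ?thesis using c by auto
  qed
  obtain b where b: "l1 b" and lim: "(\<lambda>n. \<Sum>p. norm (a n p - b p)) \<longlonglongrightarrow> 0"
    by (rule l1_complete[OF a cau])
  have "(\<lambda>n. vnorm L (vsub L (s n) (J b))) \<longlonglongrightarrow> 0"
  proof (rule tendsto_sandwich)
    show "\<forall>\<^sub>F n in sequentially. 0 \<le> vnorm L (vsub L (s n) (J b))"
      using vnorm_nonneg[OF NF] VF J_mem a b by (simp add: sa)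
    show "\<forall>\<^sub>F n in sequentially. vnorm L (vsub L (s n) (J b)) \<le> C * (\<Sum>p. norm (a n p - b p))"
      using J_up[OF l1_diff[OF a b]] J_diff[OF a b] by (simp add: sa)
    show "(\<lambda>n. C * (\<Sum>p. norm (a n p - b p))) \<longlonglongrightarrow> 0"
      using tendsto_mult_left[OF lim, of C] by simp
  qed simp
  then show "\<exists>x\<in>spc L. (\<lambda>n. vnorm L (vsub L (s n) x)) \<longlonglongrightarrow> 0" using b by auto
qed

lemma isomorphic_to_l1_L: "isomorphic_to_l1 L"
  unfolding isomorphic_to_l1_def l1_embedding_def
  using c J_add J_smul J_low J_up by (intro exI[of _ J] conjI exI[of _ c] exI[of _ C]) auto

definition \<Phi> :: "(nat \<Rightarrow> 'k) \<Rightarrow> 'u \<Rightarrow> 'u" where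
  "\<Phi> a = restrict (\<lambda>x. J (tensor a (u x))) (spc E)"

lemma \<Phi>_apply: "x \<in> spc E \<Longrightarrow> \<Phi> a x = J (tensor a (u x))"
  by (simp add: \<Phi>_def)

lemma \<Phi>_mem: "l1 a \<Longrightarrow> x \<in> spc E \<Longrightarrow> \<Phi> a x \<in> spc F"
  by (simp add: \<Phi>_apply J_mem summable_tensor u_l1)

lemma \<Phi>_low: "l1 a \<Longrightarrow> x \<in> spc E \<Longrightarrow> c * (l1_norm a * l1_norm (u x)) \<le> vnorm F (\<Phi> a x)"
  using J_low[OF summable_tensor[of a "u x"]] by (simp add: \<Phi>_apply u_l1 suminf_tensor)

lemma \<Phi>_up: "l1 a \<Longrightarrow> x \<in> spc E \<Longrightarrow> vnorm F (\<Phi> a x) \<le> C * (l1_norm a * l1_norm (u x))"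
  using J_up[OF summable_tensor[of a "u x"]] by (simp add: \<Phi>_apply u_l1 suminf_tensor)

lemma \<Phi>_add: "l1 a \<Longrightarrow> l1 b \<Longrightarrow> opadd E F (\<Phi> a) (\<Phi> b) = \<Phi> (\<lambda>n. a n + b n)"
  by (rule ext) (simp add: opadd_def \<Phi>_def tensor_add_left J_add summable_tensor u_l1)

lemma \<Phi>_smul: "l1 a \<Longrightarrow> opsmul E F s (\<Phi> a) = \<Phi> (\<lambda>n. s * a n)"
  by (rule ext) (simp add: opsmul_def \<Phi>_def tensor_scale_left J_smul summable_tensor u_l1)

lemma \<Phi>_zero: "\<Phi> (\<lambda>n. 0) = opzero E F"
proof -
  have "tensor (\<lambda>n. 0) y = (\<lambda>n. 0 :: 'k)" for y by (auto simp: tensor_def split: prod.split)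
  then show ?thesis by (simp add: \<Phi>_def opzero_def J_zero)
qed

lemma vsub_\<Phi>: "l1 a \<Longrightarrow> l1 b \<Longrightarrow> x \<in> spc E \<Longrightarrow> vsub F (\<Phi> a x) (\<Phi> b x) = \<Phi> (\<lambda>n. a n - b n) x"
  by (simp add: \<Phi>_apply tensor_diff_left J_diff summable_tensor u_l1)

text \<open>Its sign is not part of the embedding data; a sequence of nonzero norm between the two
  estimates of \<open>J\<close> forces it.\<close>

lemma C_nonneg: "0 \<le> C"
proof -
  obtain x where x: "x \<in> spc E" "l1_norm (u x) \<noteq> 0" using u_nonzero by blast
  then have p: "0 < l1_norm (u x)" using l1_norm_nonneg[OF u_l1[OF x(1)]] by simp
  have "c * l1_norm (u x) \<le> C * l1_norm (u x)"
    using J_low[OF u_l1[OF x(1)]] J_up[OF u_l1[OF x(1)]] by simp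
  then show ?thesis using p c by (simp add: mult_le_cancel_right)
qed

text \<open>\<open>\<Phi> a\<close> takes its values in L, so it factors as a bounded operator from
  E to L, the identity of L and the inclusion of L in F; the ideal property applies to the middle
  factor.\<close>

lemma \<Phi>_in_I:
  assumes a: "l1 a"
  shows "\<Phi> a \<in> I E F"
proof -
  define incl where "incl = restrict (\<lambda>x. x) (spc L)"
  have w: "\<Phi> a \<in> ops E L"
  proof -
    have "lin_map E L (\<Phi> a)"
      unfolding lin_map_def L_simps
    proof (intro conjI ballI allI funcsetI)
      show "\<Phi> a x \<in> J ` Collect l1" if "x \<in> spc E" for x
        using that a by (simp add: \<Phi>_apply summable_tensor u_l1)
      show "\<Phi> a (vadd E x y) = vadd F (\<Phi> a x) (\<Phi> a y)" if "x \<in> spc E" "y \<in> spc E" for x y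
        using that a VE by (simp add: \<Phi>_apply u_add tensor_add_right J_add summable_tensor u_l1)
      show "\<Phi> a (vsmul E s x) = vsmul F s (\<Phi> a x)" if "x \<in> spc E" for s x
        using that a VE by (simp add: \<Phi>_apply u_smul tensor_scale_right J_smul summable_tensor u_l1)
    qed
    moreover have "vnorm F (\<Phi> a x) \<le> C * (l1_norm a * D) * vnorm E x" if x: "x \<in> spc E" for x
    proof -
      have "vnorm F (\<Phi> a x) \<le> C * (l1_norm a * l1_norm (u x))" using a x by (rule \<Phi>_up)
      also have "\<dots> \<le> C * (l1_norm a * (D * vnorm E x))"
        using u_bound[OF x] C_nonneg l1_norm_nonneg[OF a] by (intro mult_left_mono)
      finally show ?thesis by (simp add: mult.assoc)
    qed
    ultimately show ?thesis unfolding ops_def by (auto simp: \<Phi>_def)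
  qed
  have v: "incl \<in> ops L F"
  proof -
    have "lin_map L F incl"
      unfolding lin_map_def incl_def using J_mem vadd_mem[OF normed_sp_vector_sp[OF normed_sp_L]]
        vsmul_mem[OF normed_sp_vector_sp[OF normed_sp_L]] by auto
    moreover have "\<forall>x\<in>spc L. vnorm F (incl x) \<le> 1 * vnorm L x" unfolding incl_def by auto
    ultimately show ?thesis unfolding ops_def incl_def by blast
  qed
  have "opcomp E incl (opcomp E (idop L) (\<Phi> a)) \<in> I E F"
    using ideal E F banach_sp_L id_l1[OF banach_sp_L isomorphic_to_l1_L] w v
    unfolding banach_op_ideal_def by blast
  also have "opcomp E incl (opcomp E (idop L) (\<Phi> a)) = \<Phi> a"
  proof
    fix x
    show "opcomp E incl (opcomp E (idop L) (\<Phi> a)) x = \<Phi> a x"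
    proof (cases "x \<in> spc E")
      case True
      then have "\<Phi> a x \<in> spc L" using a by (simp add: \<Phi>_apply summable_tensor u_l1)
      then show ?thesis using True by (simp add: opcomp_def idop_def incl_def)
    qed (simp add: opcomp_def \<Phi>_def)
  qed
  finally show ?thesis .
qed

lemma I_sub: "I E F \<subseteq> ops E F"
    and nI_nonneg: "f \<in> I E F \<Longrightarrow> 0 \<le> nI E F f"
    and nI_zero: "f \<in> I E F \<Longrightarrow> nI E F f = 0 \<longleftrightarrow> f = opzero E F"
    and I_add: "f \<in> I E F \<Longrightarrow> g \<in> I E F \<Longrightarrow> opadd E F f g \<in> I E F"
    and I_smul: "f \<in> I E F \<Longrightarrow> opsmul E F s f \<in> I E F"
    and nI_smul: "f \<in> I E F \<Longrightarrow> nI E F (opsmul E F s f) = norm s * nI E F f"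
    and nI_add: "f \<in> I E F \<Longrightarrow> g \<in> I E F \<Longrightarrow> nI E F (opadd E F f g) \<le> nI E F f + nI E F g"
    and opnorm_le: "f \<in> I E F \<Longrightarrow> opnorm E F f \<le> nI E F f"
    and I_complete: "(\<And>n. s' n \<in> I E F) \<Longrightarrow>
      (\<And>e. 0 < e \<Longrightarrow> \<exists>N. \<forall>m\<ge>N. \<forall>n\<ge>N. nI E F (opsub E F (s' m) (s' n)) < e) \<Longrightarrow>
      \<exists>f\<in>I E F. (\<lambda>n. nI E F (opsub E F (s' n) f)) \<longlonglongrightarrow> 0"
proof -
  note id = ideal[unfolded banach_op_ideal_def, THEN conjunct1, rule_format, OF conjI[OF E F]]
  show "I E F \<subseteq> ops E F"
    and "f \<in> I E F \<Longrightarrow> 0 \<le> nI E F f"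
    and "f \<in> I E F \<Longrightarrow> nI E F f = 0 \<longleftrightarrow> f = opzero E F"
    and "f \<in> I E F \<Longrightarrow> g \<in> I E F \<Longrightarrow> opadd E F f g \<in> I E F"
    and "f \<in> I E F \<Longrightarrow> opsmul E F s f \<in> I E F"
    and "f \<in> I E F \<Longrightarrow> nI E F (opsmul E F s f) = norm s * nI E F f"
    and "f \<in> I E F \<Longrightarrow> g \<in> I E F \<Longrightarrow> nI E F (opadd E F f g) \<le> nI E F f + nI E F g"
    and "f \<in> I E F \<Longrightarrow> opnorm E F f \<le> nI E F f"
    using id by simp_all
  show "\<exists>f\<in>I E F. (\<lambda>n. nI E F (opsub E F (s' n) f)) \<longlonglongrightarrow> 0"
    if "\<And>n. s' n \<in> I E F" "\<And>e. 0 < e \<Longrightarrow> \<exists>N. \<forall>m\<ge>N. \<forall>n\<ge>N. nI E F (opsub E F (s' m) (s' n)) < e"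
    using id that by blast
qed

lemma I_mem: "f \<in> I E F \<Longrightarrow> x \<in> spc E \<Longrightarrow> f x \<in> spc F"
  using I_sub by (auto simp: ops_def lin_map_def)

lemma I_extensional: "f \<in> I E F \<Longrightarrow> f \<in> extensional (spc E)"
  using I_sub by (auto simp: ops_def)

lemma I_sub_closed: "f \<in> I E F \<Longrightarrow> g \<in> I E F \<Longrightarrow> opsub E F f g \<in> I E F"
  by (simp add: opsub_def I_add I_smul)

lemma vnorm_vsub_le_nI:
  assumes f: "f \<in> I E F" and g: "g \<in> I E F" and x: "x \<in> spc E"
  shows "vnorm F (vsub F (f x) (g x)) \<le> nI E F (opsub E F f g) * vnorm E x"
proof -
  have m: "opsub E F f g \<in> I E F" using f g by (rule I_sub_closed)
  have "vsub F (f x) (g x) = opsub E F f g x"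
    using x by (simp add: opsub_def opadd_def opsmul_def vsub_def)
  then have "vnorm F (vsub F (f x) (g x)) \<le> opnorm E F (opsub E F f g) * vnorm E x"
    using vnorm_le_opnorm[OF NE subsetD[OF I_sub m] x] by simp
  also have "\<dots> \<le> nI E F (opsub E F f g) * vnorm E x"
    using opnorm_le[OF m] vnorm_nonneg[OF NE x] by (rule mult_right_mono)
  finally show ?thesis .
qed

definition V :: "('u \<Rightarrow> 'u) set" where "V = \<Phi> ` Collect l1"

lemma V_sub_I: "V \<subseteq> I E F"
  using \<Phi>_in_I by (auto simp: V_def)

text \<open>Convergence in the ideal norm implies pointwise convergence. At a point x0 with
  \<open>u x0\<close> nonzero, \<open>\<Phi>_low\<close> makes the coefficient sequences Cauchy in
  l1; by \<open>\<Phi>_up\<close> their limit b gives an operator with the same pointwise limits as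
  f.\<close>

lemma V_closed:
  assumes s: "\<And>n. s n \<in> V" and f: "f \<in> I E F" and lim: "(\<lambda>n. nI E F (opsub E F (s n) f)) \<longlonglongrightarrow> 0"
  shows "f \<in> V"
proof -
  from s have "\<exists>a. l1 a \<and> s n = \<Phi> a" for n by (auto simp: V_def)
  then obtain a where a: "\<And>n. l1 (a n)" and sa: "\<And>n. s n = \<Phi> (a n)" by metis
  have sI: "s n \<in> I E F" for n using s V_sub_I by blast
  have ptlim: "(\<lambda>n. vnorm F (vsub F (s n x) (f x))) \<longlonglongrightarrow> 0" if x: "x \<in> spc E" for x
  proof (rule tendsto_sandwich)
    show "\<forall>\<^sub>F n in sequentially. 0 \<le> vnorm F (vsub F (s n x) (f x))"
      using vnorm_nonneg[OF NF] VF I_mem[OF sI x] I_mem[OF f x] by simp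
    show "\<forall>\<^sub>F n in sequentially. vnorm F (vsub F (s n x) (f x)) \<le> nI E F (opsub E F (s n) f) * vnorm E x"
      using vnorm_vsub_le_nI[OF sI f x] by simp
    show "(\<lambda>n. nI E F (opsub E F (s n) f) * vnorm E x) \<longlonglongrightarrow> 0"
      using tendsto_mult_right[OF lim, of "vnorm E x"] by simp
  qed simp
  obtain x0 where x0: "x0 \<in> spc E" "l1_norm (u x0) \<noteq> 0" using u_nonzero by blast
  define K where "K = c * l1_norm (u x0)"
  have K: "0 < K" unfolding K_def using c x0 l1_norm_nonneg[OF u_l1[OF x0(1)]] by simp
  have cau: "\<exists>N. \<forall>m\<ge>N. \<forall>n\<ge>N. (\<Sum>p. norm (a m p - a n p)) < e" if "0 < e" for e
  proof -
    have "0 < K * e / 2" using K \<open>0 < e\<close> by simp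
    from order_tendstoD(2)[OF ptlim[OF x0(1)] this]
    obtain N where N: "\<And>n. n \<ge> N \<Longrightarrow> vnorm F (vsub F (s n x0) (f x0)) < K * e / 2"
      by (auto simp: eventually_sequentially)
    have "(\<Sum>p. norm (a m p - a n p)) < e" if mn: "m \<ge> N" "n \<ge> N" for m n
    proof -
      have "K * (\<Sum>p. norm (a m p - a n p)) \<le> vnorm F (vsub F (s m x0) (s n x0))"
        using \<Phi>_low[OF l1_diff[OF a a] x0(1), of m n] unfolding sa vsub_\<Phi>[OF a a x0(1)] K_def
        by (simp add: mult_ac)
      also have "\<dots> \<le> vnorm F (vsub F (s m x0) (f x0)) + vnorm F (vsub F (f x0) (s n x0))"
        using I_mem[OF sI x0(1)] I_mem[OF f x0(1)] by (intro vnorm_vsub_triangle[OF NF])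
      also have "vnorm F (vsub F (f x0) (s n x0)) = vnorm F (vsub F (s n x0) (f x0))"
        using I_mem[OF sI x0(1)] I_mem[OF f x0(1)] by (intro vnorm_vsub_commute[OF NF])
      finally have "K * (\<Sum>p. norm (a m p - a n p)) < K * e" using N[OF mn(1)] N[OF mn(2)] by simp
      then show ?thesis using K by simp
    qed
    then show ?thesis by blast
  qed
  obtain b where b: "l1 b" and blim: "(\<lambda>n. \<Sum>p. norm (a n p - b p)) \<longlonglongrightarrow> 0"
    by (rule l1_complete[OF a cau])
  have eq: "f x = \<Phi> b x" if x: "x \<in> spc E" for x
  proof (rule limit_unique[OF NF, of "\<lambda>n. s n x"])
    show "(\<lambda>n. vnorm F (vsub F (s n x) (\<Phi> b x))) \<longlonglongrightarrow> 0"
    proof (rule tendsto_sandwich)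
      show "\<forall>\<^sub>F n in sequentially. 0 \<le> vnorm F (vsub F (s n x) (\<Phi> b x))"
        using vnorm_nonneg[OF NF] VF I_mem[OF sI x] \<Phi>_mem[OF b x] by simp
      show "\<forall>\<^sub>F n in sequentially. vnorm F (vsub F (s n x) (\<Phi> b x))
          \<le> C * ((\<Sum>p. norm (a n p - b p)) * l1_norm (u x))"
        using \<Phi>_up[OF l1_diff[OF a b] x] unfolding sa vsub_\<Phi>[OF a b x] by simp
      show "(\<lambda>n. C * ((\<Sum>p. norm (a n p - b p)) * l1_norm (u x))) \<longlonglongrightarrow> 0"
        using tendsto_mult_left[OF tendsto_mult_right[OF blim, of "l1_norm (u x)"], of C] by simp
    qed simp
  qed (use I_mem[OF sI x] I_mem[OF f x] \<Phi>_mem[OF b x] ptlim[OF x] in auto)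
  have "f = \<Phi> b"
    by (rule extensionalityI[OF I_extensional[OF f] I_extensional[OF \<Phi>_in_I[OF b]] eq])
  then show ?thesis using b by (auto simp: V_def)
qed

abbreviation "VS \<equiv> opspace E F V (nI E F)"

lemma VS_simps: "spc VS = V" "vadd VS = opadd E F" "vzero VS = opzero E F" "vsmul VS = opsmul E F"
    "vnorm VS = nI E F" "vsub VS = opsub E F"
  by (auto simp: opspace_def vsub_def opsub_def intro!: ext)

lemma vector_sp_VS: "vector_sp VS"
proof -
  note simps = \<Phi>_add \<Phi>_smul l1_add l1_smul \<Phi>_zero[symmetric]
  have "\<exists>g\<in>V. opadd E F f g = opzero E F" if "f \<in> V" for f
  proof -
    obtain a where a: "l1 a" "f = \<Phi> a" using \<open>f \<in> V\<close> by (auto simp: V_def)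
    then have "opadd E F f (\<Phi> (\<lambda>n. - 1 * a n)) = opzero E F" "\<Phi> (\<lambda>n. - 1 * a n) \<in> V"
      using l1_smul[OF a(1), of "- 1"] by (auto simp: simps V_def)
    then show ?thesis by blast
  qed
  then show ?thesis unfolding vector_sp_def VS_simps
    by (auto simp: V_def simps algebra_simps)
qed

lemma banach_sp_VS: "banach_sp VS"
  unfolding banach_sp_def
proof (intro conjI allI impI, goal_cases)
  case 1
  have "f \<in> I E F" if "f \<in> V" for f using that V_sub_I by blast
  then show ?case unfolding normed_sp_def VS_simps
    using vector_sp_VS nI_nonneg nI_zero nI_smul nI_add by blast
next
  case (2 s)
  then have s: "s n \<in> V" for n by (simp add: VS_simps)
  have "\<exists>f\<in>I E F. (\<lambda>n. nI E F (opsub E F (s n) f)) \<longlonglongrightarrow> 0"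
    by (rule I_complete) (use 2 s V_sub_I in \<open>auto simp: VS_simps\<close>)
  then show ?case using V_closed[of s, OF s] unfolding VS_simps by blast
qed

text \<open>Evaluation at one point x with \<open>u x\<close> nonzero is bounded below by
  \<open>\<Phi>_low\<close> in terms of the coefficients.\<close>

lemma \<Phi>_inj:
  assumes "l1 a" "l1 b" "\<Phi> a = \<Phi> b"
  shows "a = b"
proof -
  obtain x where x: "x \<in> spc E" "l1_norm (u x) \<noteq> 0" using u_nonzero by blast
  have "\<Phi> (\<lambda>n. a n - b n) x = vzero F"
    using vsub_\<Phi>[OF assms(1,2) x(1)] assms(3) vsub_self[OF NF \<Phi>_mem[OF assms(2) x(1)]] by simp
  then have "vnorm F (\<Phi> (\<lambda>n. a n - b n) x) = 0" using vnorm_eq_0_iff[OF NF] VF by simp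
  then have "c * (l1_norm (\<lambda>n. a n - b n) * l1_norm (u x)) \<le> 0"
    using \<Phi>_low[OF l1_diff[OF assms(1,2)] x(1)] by simp
  moreover have "0 \<le> l1_norm (\<lambda>n. a n - b n)" by (rule l1_norm_nonneg[OF l1_diff[OF assms(1,2)]])
  moreover have "0 < l1_norm (u x)" using l1_norm_nonneg[OF u_l1[OF x(1)]] x(2) by simp
  ultimately have "l1_norm (\<lambda>n. a n - b n) = 0" using c by (simp add: mult_le_0_iff)
  then have "norm (a n - b n) = 0" for n
    using suminf_eq_zero_iff[OF l1_diff[OF assms(1,2)]] by simp
  then show ?thesis by auto
qed

lemma lincomb_VS:
  assumes "\<And>i. i < N \<Longrightarrow> l1 (\<beta> i)"
  shows "l1 (\<lambda>n. \<Sum>i<N. d i * \<beta> i n)"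
    and "lincomb VS (map (\<lambda>i. (d i, \<Phi> (\<beta> i))) [0..<N]) = \<Phi> (\<lambda>n. \<Sum>i<N. d i * \<beta> i n)"
proof -
  have gen: "l1 (\<lambda>n. \<Sum>i\<leftarrow>js. d i * \<beta> i n) \<and>
      lincomb VS (map (\<lambda>i. (d i, \<Phi> (\<beta> i))) js) = \<Phi> (\<lambda>n. \<Sum>i\<leftarrow>js. d i * \<beta> i n)"
    if "\<And>j. j \<in> set js \<Longrightarrow> l1 (\<beta> j)" for js
    using that by (induction js) (auto simp: VS_simps \<Phi>_zero \<Phi>_smul \<Phi>_add l1_add l1_smul)
  have "(\<Sum>i\<leftarrow>[0..<N]. d i * \<beta> i n) = (\<Sum>i<N. d i * \<beta> i n)" for n
    by (simp add: interv_sum_list_conv_sum_set_nat atLeast0LessThan)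
  then show "l1 (\<lambda>n. \<Sum>i<N. d i * \<beta> i n)"
    and "lincomb VS (map (\<lambda>i. (d i, \<Phi> (\<beta> i))) [0..<N]) = \<Phi> (\<lambda>n. \<Sum>i<N. d i * \<beta> i n)"
    using gen[of "[0..<N]"] assms by auto
qed

text \<open>By linearity and injectivity of \<open>\<Phi>\<close> a finite spanning list of length N
  would put every l1 sequence, in particular every unit sequence, into the span of N coefficient
  sequences.\<close>

lemma infinite_dim_VS: "infinite_dim VS"
  unfolding infinite_dim_def
proof
  assume "\<exists>B. set B \<subseteq> spc VS \<and> (\<forall>x\<in>spc VS. \<exists>cs. length cs = length B \<and> x = lincomb VS (zip cs B))"
  then obtain B where B: "set B \<subseteq> V"
    and span: "\<And>f. f \<in> V \<Longrightarrow> \<exists>cs. length cs = length B \<and> f = lincomb VS (zip cs B)"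
    by (auto simp: VS_simps)
  define N where "N = length B"
  have "\<exists>a. l1 a \<and> B ! i = \<Phi> a" if "i < N" for i
    using B nth_mem[of i B] that unfolding N_def V_def by blast
  then obtain \<beta> where \<beta>: "\<And>i. i < N \<Longrightarrow> l1 (\<beta> i)" and B\<beta>: "\<And>i. i < N \<Longrightarrow> B ! i = \<Phi> (\<beta> i)" by metis
  obtain k where k: "\<And>d. (\<lambda>n. if n = k then 1 else 0) \<noteq> (\<lambda>n. \<Sum>i<N. d i * \<beta> i n)"
    using unit_sequences_not_in_finite_span[of N \<beta>] by blast
  define e where "e n = (if n = k then 1 else 0 :: 'k)" for n
  have e: "l1 e" by (rule summable_finite[of "{k}"]) (auto simp: e_def)
  then obtain cs where cs: "length cs = N" "\<Phi> e = lincomb VS (zip cs B)"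
    using span[of "\<Phi> e"] unfolding N_def V_def by blast
  have "zip cs B = map (\<lambda>i. (cs ! i, \<Phi> (\<beta> i))) [0..<N]"
    by (rule nth_equalityI) (use cs(1) B\<beta> in \<open>auto simp: N_def\<close>)
  then have "\<Phi> e = \<Phi> (\<lambda>n. \<Sum>i<N. cs ! i * \<beta> i n)" using cs(2) lincomb_VS(2)[OF \<beta>] by simp
  then have "e = (\<lambda>n. \<Sum>i<N. cs ! i * \<beta> i n)"
    by (rule \<Phi>_inj[OF e lincomb_VS(1)[OF \<beta>, where d = "\<lambda>i. cs ! i"], rotated -1]) simp_all
  moreover have "e = (\<lambda>n. if n = k then 1 else 0)" by (auto simp: e_def)
  ultimately show False using k[of "\<lambda>i. cs ! i"] by simp
qed

lemma not_abs_1_summing: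
  assumes f: "f \<in> V" "f \<noteq> opzero E F" and xs: "\<And>j. xs j \<in> spc E"
    and weak: "\<And>\<phi> n. \<phi> \<in> dual_ball E \<Longrightarrow> (\<Sum>j<n. norm (\<phi> (xs j))) \<le> B"
    and div: "\<not> summable (\<lambda>j. l1_norm (u (xs j)))"
  shows "\<not> abs_1_summing E F f"
proof
  assume "abs_1_summing E F f"
  then have s: "summable (\<lambda>j. vnorm F (f (xs j)))" using xs weak unfolding abs_1_summing_def by blast
  obtain a where a: "l1 a" "f = \<Phi> a" using f by (auto simp: V_def)
  have "a \<noteq> (\<lambda>n. 0)" using f(2) a(2) \<Phi>_zero by auto
  then have "l1_norm a \<noteq> 0" using suminf_eq_zero_iff[OF a(1)] by (auto simp: fun_eq_iff)
  then have K: "0 < c * l1_norm a" using c l1_norm_nonneg[OF a(1)] by simp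
  have "summable (\<lambda>j. c * l1_norm a * l1_norm (u (xs j)))"
    by (rule summable_comparison_test'[OF s, of 0])
      (use \<Phi>_low[OF a(1) xs] c l1_norm_nonneg[OF a(1)] l1_norm_nonneg[OF u_l1[OF xs]]
        in \<open>simp add: a(2) mult.assoc abs_mult\<close>)
  then have "summable (\<lambda>j. l1_norm (u (xs j)))" using K by (subst (asm) summable_cmult_iff) auto
  then show False using div by blast
qed

end

theorem theorem3p6:
  fixes E F :: "('k::{real_normed_field, banach, second_countable_topology}, 'u) nspace"
    and M :: "'m::topological_space measure"
    and I :: "('k, 'u) nspace \<Rightarrow> ('k, 'u) nspace \<Rightarrow> ('u \<Rightarrow> 'u) set"
    and nI :: "('k, 'u) nspace \<Rightarrow> ('k, 'u) nspace \<Rightarrow> ('u \<Rightarrow> 'u) \<Rightarrow> real"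
  assumes E: "banach_sp E" "infinite_dim E"
    and M: "sets M = sets (borel :: 'm measure)" "embeds_in_L1 E M"
    and F: "banach_sp F" "infinite_dim F" "contains_l1 F"
    and I: "banach_op_ideal I nI"
    and Il1: "\<forall>L. banach_sp L \<and> isomorphic_to_l1 L \<longrightarrow> idop L \<in> I L L"
  shows "\<exists>V. V \<subseteq> I E F \<and> opzero E F \<in> V \<and>
           (\<forall>f\<in>V. \<forall>g\<in>V. opadd E F f g \<in> V) \<and>
           (\<forall>a. \<forall>f\<in>V. opsmul E F a f \<in> V) \<and>
           (\<forall>s f. (\<forall>n. s n \<in> V) \<and> f \<in> I E F \<and>
                  (\<lambda>n. nI E F (opsub E F (s n) f)) \<longlonglongrightarrow> 0 \<longrightarrow> f \<in> V) \<and>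
           banach_sp (opspace E F V (nI E F)) \<and>
           infinite_dim (opspace E F V (nI E F)) \<and>
           (\<forall>u\<in>V. u \<noteq> opzero E F \<longrightarrow> \<not> abs_1_summing E F u)"
proof -
  obtain J c C where c: "0 < c" and J:
      "\<forall>a b. summable (\<lambda>n. norm (a n)) \<and> summable (\<lambda>n. norm (b n)) \<longrightarrow> J (\<lambda>n. a n + b n) = vadd F (J a) (J b)"
      "\<forall>s a. summable (\<lambda>n. norm (a n)) \<longrightarrow> J (\<lambda>n. s * a n) = vsmul F s (J a)"
      "\<forall>a. summable (\<lambda>n. norm (a n)) \<longrightarrow> J a \<in> spc F \<and>
        c * (\<Sum>n. norm (a n)) \<le> vnorm F (J a) \<and> vnorm F (J a) \<le> C * (\<Sum>n. norm (a n))"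
    using F(3) unfolding contains_l1_def l1_embedding_def by (elim exE conjE)
  have "normed_sp E" using E(1) by (simp add: banach_sp_def)
  then obtain u D xs B where
    u: "\<And>x y. x \<in> spc E \<Longrightarrow> y \<in> spc E \<Longrightarrow> u (vadd E x y) = (\<lambda>p. u x p + u y p)"
      "\<And>a x. x \<in> spc E \<Longrightarrow> u (vsmul E a x) = (\<lambda>p. a * u x p)"
      "\<And>x. x \<in> spc E \<Longrightarrow> summable (\<lambda>p. norm (u x p))"
      "\<And>x. x \<in> spc E \<Longrightarrow> (\<Sum>p. norm (u x p)) \<le> D * vnorm E x"
    and xs: "\<And>j. xs j \<in> spc E" "\<And>\<phi> n. \<phi> \<in> dual_ball E \<Longrightarrow> (\<Sum>j<n. norm (\<phi> (xs j))) \<le> B"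
      "\<not> summable (\<lambda>j. \<Sum>p. norm (u (xs j) p))"
    by (rule non_summing_operator_into_l1[OF _ E(2) M(2)]) (rule that)
  \<comment> \<open>A divergent series has a nonzero term; it supplies the evaluation point behind
    injectivity and closedness.\<close>
  have "\<exists>x\<in>spc E. (\<Sum>p. norm (u x p)) \<noteq> 0"
  proof (rule ccontr)
    assume "\<not> ?thesis"
    then have "(\<lambda>j. \<Sum>p. norm (u (xs j) p)) = (\<lambda>j. 0)" using xs(1) by auto
    then show False using xs(3) by simp
  qed
  have "J (\<lambda>n. a n + b n) = vadd F (J a) (J b)"
    if "summable (\<lambda>n. norm (a n))" "summable (\<lambda>n. norm (b n))" for a b
    using J(1) that by simp
  have "J (\<lambda>n. s * a n) = vsmul F s (J a)" "J a \<in> spc F"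
    "c * (\<Sum>n. norm (a n)) \<le> vnorm F (J a)" "vnorm F (J a) \<le> C * (\<Sum>n. norm (a n))"
    if "summable (\<lambda>n. norm (a n))" for s a
    using J(2,3) that by simp_all
  have "idop L \<in> I L L" if "banach_sp L" "isomorphic_to_l1 L" for L
    using Il1 that by simp
  interpret l1_factorization E F I nI J c C u D
    by unfold_locales fact+
  have "opadd E F f g \<in> V" "opsmul E F a f \<in> V" if "f \<in> V" "g \<in> V" for f g a
    using vadd_mem[OF vector_sp_VS] vsmul_mem[OF vector_sp_VS] that unfolding VS_simps by blast+
  moreover have "opzero E F \<in> V" using vzero_mem[OF vector_sp_VS] unfolding VS_simps .
  moreover have "f \<in> V" if "\<forall>n. s n \<in> V" "f \<in> I E F" "(\<lambda>n. nI E F (opsub E F (s n) f)) \<longlonglongrightarrow> 0" for s f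
    using V_closed that by blast
  moreover have "\<not> abs_1_summing E F f" if "f \<in> V" "f \<noteq> opzero E F" for f
    using not_abs_1_summing[OF that xs] .
  ultimately show ?thesis
    using V_sub_I banach_sp_VS infinite_dim_VS by (intro exI[of _ V]) blast
qed

end
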